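(* Let $X$ be a u.l.f.\ metric space. Then the canonical homomorphism $\mathrm{BijCoa}(X)\to\mathrm{Out}(\mathrm{C}^*_u(X))$, sending the class of a bijective coarse equivalence $f\colon X\to X$ to the class of the automorphism $\mathrm{Ad}(u_f)$, where $u_f\delta_x=\delta_{f(x)}$, is a group isomorphism.
   Context: $\mathrm{C}^*_u(X)$ is the norm closure of finite-propagation operators on $\ell_2(X)$. $\mathrm{BijCoa}(X)$ is the group of bijective coarse equivalences $X\to X$ modulo closeness ($f\sim g$ iff $\sup_x d(f(x),g(x))<\infty$). $\mathrm{Out}(\mathrm{C}^*_u(X))$ is the group of $^*$-automorphisms of $\mathrm{C}^*_u(X)$ modulo inner automorphisms (conjugation by unitaries of $\mathrm{C}^*_u(X)$). For a bijective coarse equivalence $f$, $\mathrm{Ad}(u_f)(a)=u_fau_f^*$ is an automorphism of $\mathrm{C}^*_u(X)$, and the resulting map on classes is a well-defined group homomorphism. *)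

theory Defs
  imports "HOL-Analysis.Analysis" "HOL-Algebra.Coset"
begin

text \<open>A (bounded) operator on ell_2(X) is represented by its matrix
  a x y = <delta_x, a delta_y>.\<close>

type_synonym 'a mat = "'a \<Rightarrow> 'a \<Rightarrow> complex"

definition ell2 :: "('a \<Rightarrow> complex) \<Rightarrow> bool" where
  "ell2 v \<longleftrightarrow> (\<lambda>x. (cmod (v x))\<^sup>2) summable_on UNIV"

definition l2norm :: "('a \<Rightarrow> complex) \<Rightarrow> real" where
  "l2norm v = sqrt (\<Sum>\<^sub>\<infinity>x. (cmod (v x))\<^sup>2)"

definition mat_app :: "'a mat \<Rightarrow> ('a \<Rightarrow> complex) \<Rightarrow> ('a \<Rightarrow> complex)" where
  "mat_app a v = (\<lambda>x. \<Sum>\<^sub>\<infinity>y. a x y * v y)"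

definition bdd_op :: "'a mat \<Rightarrow> bool" where
  "bdd_op a \<longleftrightarrow> (\<exists>C. \<forall>v. ell2 v \<longrightarrow>
      (\<forall>x. (\<lambda>y. a x y * v y) summable_on UNIV) \<and>
      ell2 (mat_app a v) \<and> l2norm (mat_app a v) \<le> C * l2norm v)"

definition op_norm :: "'a mat \<Rightarrow> real" where
  "op_norm a = Sup {l2norm (mat_app a v) | v. ell2 v \<and> l2norm v \<le> 1}"

definition mat_add :: "'a mat \<Rightarrow> 'a mat \<Rightarrow> 'a mat" where
  "mat_add a b = (\<lambda>x y. a x y + b x y)"

definition mat_diff :: "'a mat \<Rightarrow> 'a mat \<Rightarrow> 'a mat" where
  "mat_diff a b = (\<lambda>x y. a x y - b x y)"

definition mat_scale :: "complex \<Rightarrow> 'a mat \<Rightarrow> 'a mat" where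
  "mat_scale c a = (\<lambda>x y. c * a x y)"

definition mat_mult :: "'a mat \<Rightarrow> 'a mat \<Rightarrow> 'a mat" where
  "mat_mult a b = (\<lambda>x y. \<Sum>\<^sub>\<infinity>z. a x z * b z y)"

definition mat_adj :: "'a mat \<Rightarrow> 'a mat" where
  "mat_adj a = (\<lambda>x y. cnj (a y x))"

definition mat_id :: "'a mat" where
  "mat_id = (\<lambda>x y. if x = y then 1 else 0)"

definition finite_prop :: "('a::metric_space) mat \<Rightarrow> bool" where
  "finite_prop a \<longleftrightarrow> (\<exists>R. \<forall>x y. dist x y > R \<longrightarrow> a x y = 0)"

definition Cu :: "('a::metric_space) mat set" where
  "Cu = {a. bdd_op a \<and> (\<forall>\<epsilon>>0. \<exists>b. bdd_op b \<and> finite_prop b \<and> op_norm (mat_diff a b) < \<epsilon>)}"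

definition star_aut :: "(('a::metric_space) mat \<Rightarrow> 'a mat) \<Rightarrow> bool" where
  "star_aut \<phi> \<longleftrightarrow> \<phi> \<in> extensional Cu \<and> bij_betw \<phi> Cu Cu \<and>
     (\<forall>a\<in>Cu. \<forall>b\<in>Cu. \<phi> (mat_add a b) = mat_add (\<phi> a) (\<phi> b)) \<and>
     (\<forall>c. \<forall>a\<in>Cu. \<phi> (mat_scale c a) = mat_scale c (\<phi> a)) \<and>
     (\<forall>a\<in>Cu. \<forall>b\<in>Cu. \<phi> (mat_mult a b) = mat_mult (\<phi> a) (\<phi> b)) \<and>
     (\<forall>a\<in>Cu. \<phi> (mat_adj a) = mat_adj (\<phi> a))"

definition AutG :: "(('a::metric_space) mat \<Rightarrow> 'a mat) monoid" where
  "AutG = \<lparr>carrier = {\<phi>. star_aut \<phi>}, mult = (\<lambda>\<phi> \<psi>. compose Cu \<phi> \<psi>),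
           one = restrict id Cu\<rparr>"

definition unitary_Cu :: "('a::metric_space) mat \<Rightarrow> bool" where
  "unitary_Cu u \<longleftrightarrow> u \<in> Cu \<and> mat_mult u (mat_adj u) = mat_id \<and> mat_mult (mat_adj u) u = mat_id"

definition Ad :: "('a::metric_space) mat \<Rightarrow> ('a mat \<Rightarrow> 'a mat)" where
  "Ad u = restrict (\<lambda>a. mat_mult (mat_mult u a) (mat_adj u)) Cu"

definition Inn :: "(('a::metric_space) mat \<Rightarrow> 'a mat) set" where
  "Inn = {Ad u | u. unitary_Cu u}"

definition OutG :: "(('a::metric_space) mat \<Rightarrow> 'a mat) set monoid" where
  "OutG = AutG Mod Inn"

definition bornologous :: "(('a::metric_space) \<Rightarrow> 'a) \<Rightarrow> bool" where
  "bornologous f \<longleftrightarrow> (\<forall>r. \<exists>s. \<forall>x y. dist x y \<le> r \<longrightarrow> dist (f x) (f y) \<le> s)"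

definition close :: "(('a::metric_space) \<Rightarrow> 'a) \<Rightarrow> ('a \<Rightarrow> 'a) \<Rightarrow> bool" where
  "close f g \<longleftrightarrow> (\<exists>C. \<forall>x. dist (f x) (g x) \<le> C)"

definition coarse_equiv :: "(('a::metric_space) \<Rightarrow> 'a) \<Rightarrow> bool" where
  "coarse_equiv f \<longleftrightarrow> bornologous f \<and>
     (\<exists>g. bornologous g \<and> close (g \<circ> f) id \<and> close (f \<circ> g) id)"

definition BijCoaG0 :: "(('a::metric_space) \<Rightarrow> 'a) monoid" where
  "BijCoaG0 = \<lparr>carrier = {f. bij f \<and> coarse_equiv f}, mult = (\<circ>), one = id\<rparr>"

definition CloseId :: "(('a::metric_space) \<Rightarrow> 'a) set" where
  "CloseId = {f. bij f \<and> coarse_equiv f \<and> close f id}"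

text \<open>BijCoa(X): the right cosets of CloseId are exactly the closeness classes.\<close>
definition BijCoaG :: "(('a::metric_space) \<Rightarrow> 'a) set monoid" where
  "BijCoaG = BijCoaG0 Mod CloseId"

definition umat :: "('a \<Rightarrow> 'a) \<Rightarrow> 'a mat" where
  "umat f = (\<lambda>x y. if x = f y then 1 else 0)"

definition ulf :: "'a::metric_space itself \<Rightarrow> bool" where
  "ulf _ \<longleftrightarrow> (\<forall>r. \<exists>N::nat. \<forall>x::'a. finite (cball x r) \<and> card (cball x r) \<le> N)"

end

theory Submission
  imports Defs "HOL-Library.Function_Algebras"
begin

text \<open>Every automorphism of the uniform Roe algebra is spatial, \<open>\<phi> = Ad U\<close>. By a Baire category
  argument, \<open>U m U\<^sup>*\<close> is approximable by matrices of bounded propagation uniformly over the matrices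
  \<open>m\<close> of propagation at most \<open>r\<close> with entries in the unit disc, and likewise for \<open>U\<^sup>*\<close>.

  Two averages over random signs exploit this uniformity. The first shows that every column of
  \<open>U\<close> has an entry \<open>U\<^bsub>f(x),x\<^esub>\<close> of modulus bounded away from zero; the resulting map \<open>f\<close> and its
  analogue \<open>g\<close> for \<open>U\<^sup>*\<close> are mutually inverse coarse equivalences. The second shows that \<open>U\<close> is
  approximable by matrices supported near the graph of \<open>f\<close>. Hence \<open>f\<close> satisfies a Hall condition
  and is close to an injection; the same holds for \<open>g\<close>, and the Schroeder-Bernstein construction
  yields a bijection \<open>h\<close> close to \<open>f\<close> with \<open>U u\<^sub>h\<^sup>*\<close> in the algebra, which is surjectivity. For
  injectivity, if \<open>Ad u\<^sub>f = Ad v\<close> then the entries \<open>v\<^bsub>f(x),x\<^esub>\<close> have modulus one, so that \<open>f\<close> is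
  close to the identity when \<open>v\<close> is in the algebra.\<close>

section \<open>Square-summable functions\<close>

text \<open>The obstacle is the order of quantifiers: each single \<open>conj_by U m\<close> lies in
  the algebra, but with a propagation depending on \<open>m\<close>, while the averages need one
  radius for all choices of signs. Bounded geometry removes it: conjugation becomes continuous for
  entrywise convergence on a compact box of matrices. The two averages depend on each other. The
  first yields the lower bound \<open>\<delta>\<close>; the second divides by the entries
  \<open>U (f x) x\<close>, and its diagonal factor has norm at most \<open>1 / \<delta>\<close>. No
  probability is involved: an expectation over signs is an iterated midpoint, and the properties
  averaged are closed under midpoints. The map \<open>f\<close> need not be injective, but its
  fibres have bounded diameter, so finitely many colours split the space into pieces on which
  \<open>f\<close> is injective; the second average is applied to each piece. A coarse equivalence
  alone need not be close to a bijection. The cardinality information comes from \<open>U\<close>: a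
  matrix at distance less than one from a unitary has trivial kernel, and a dimension count turns
  this into Hall's condition.\<close>

lemma has_sum_finite_sum:
  fixes f :: "'i \<Rightarrow> 'x \<Rightarrow> complex"
  assumes "\<And>i. i \<in> F \<Longrightarrow> (f i has_sum s i) A"
  shows "((\<lambda>x. \<Sum>i\<in>F. f i x) has_sum (\<Sum>i\<in>F. s i)) A"
  using assms by (induction F rule: infinite_finite_induct) (auto intro: has_sum_add)

lemma summable_on_finite_sum:
  fixes f :: "'i \<Rightarrow> 'x \<Rightarrow> complex"
  assumes "\<And>i. i \<in> F \<Longrightarrow> f i summable_on A"
  shows "(\<lambda>x. \<Sum>i\<in>F. f i x) summable_on A"
  using has_sum_finite_sum[of F f A "\<lambda>i. infsum (f i) A"] assms by (auto simp: has_sum_iff)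

lemma infsum_finite_sum:
  fixes f :: "'i \<Rightarrow> 'x \<Rightarrow> complex"
  assumes "\<And>i. i \<in> F \<Longrightarrow> f i summable_on A"
  shows "(\<Sum>\<^sub>\<infinity>x\<in>A. \<Sum>i\<in>F. f i x) = (\<Sum>i\<in>F. infsum (f i) A)"
  using has_sum_finite_sum[of F f A "\<lambda>i. infsum (f i) A"] assms by (auto simp: has_sum_iff)

lemma L2_set_power2: "(L2_set f A)\<^sup>2 = (\<Sum>x\<in>A. (f x)\<^sup>2)"
  by (simp add: L2_set_def sum_nonneg)

lemma L2_set_subset_mono:
  assumes "finite B" "A \<subseteq> B"
  shows "L2_set f A \<le> L2_set f B"
  unfolding L2_set_def by (intro real_sqrt_le_mono sum_mono2 assms) auto

lemma cmod_sum_mult_le: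
  "cmod (\<Sum>x\<in>A. v x * w x) \<le> L2_set (\<lambda>x. cmod (v x)) A * L2_set (\<lambda>x. cmod (w x)) A"
proof -
  have "cmod (\<Sum>x\<in>A. v x * w x) \<le> (\<Sum>x\<in>A. cmod (v x) * cmod (w x))"
    by (rule order_trans[OF norm_sum]) (simp add: norm_mult)
  also have "\<dots> \<le> L2_set (\<lambda>x. cmod (v x)) A * L2_set (\<lambda>x. cmod (w x)) A"
    using L2_set_mult_ineq[of "\<lambda>x. cmod (v x)" "\<lambda>x. cmod (w x)" A] by simp
  finally show ?thesis .
qed

text \<open>For duality estimates in which a vector is paired with its own conjugate: the bound on
  \<open>s * s\<close> then carries one factor \<open>s\<close>, which may vanish.\<close>

lemma le_if_square_le:
  fixes s c :: real
  assumes "s * s \<le> c * s" "0 \<le> c" "0 \<le> s"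
  shows "s \<le> c"
proof (cases "s = 0")
  case False
  with assms(3) have "0 < s" by simp
  with assms(1) show ?thesis by (simp add: mult_le_cancel_right_pos)
qed (use assms in simp)

lemma sum_mult_cnj: "(\<Sum>x\<in>F. v x * cnj (v x)) = of_real (\<Sum>x\<in>F. (cmod (v x))\<^sup>2)"
  by (simp only: of_real_sum complex_norm_square)

lemma l2norm_nonneg [simp]: "0 \<le> l2norm v"
  unfolding l2norm_def by (simp add: infsum_nonneg)

lemma L2_set_le_l2norm:
  assumes "ell2 v"
  shows "L2_set (\<lambda>x. cmod (v x)) F \<le> l2norm v"
proof (cases "finite F")
  case True
  then show ?thesis using assms unfolding L2_set_def l2norm_def ell2_def
    by (intro real_sqrt_le_mono finite_sum_le_infsum) auto
qed auto

lemma ell2_if_L2_set_le: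
  assumes "\<And>F. finite F \<Longrightarrow> L2_set (\<lambda>x. cmod (v x)) F \<le> C"
  shows "ell2 v" "l2norm v \<le> C"
proof -
  have C0: "0 \<le> C" using assms[of "{}"] by simp
  have b: "(\<Sum>x\<in>F. (cmod (v x))\<^sup>2) \<le> C\<^sup>2" if "finite F" for F
    using power_mono[OF assms[OF that] L2_set_nonneg, of 2] by (simp add: L2_set_power2)
  have s: "(\<lambda>x. (cmod (v x))\<^sup>2) summable_on UNIV"
    by (intro nonneg_bdd_above_summable_on) (auto simp: bdd_above_def intro!: exI[of _ "C\<^sup>2"] b)
  then show "ell2 v" by (simp add: ell2_def)
  have "(\<Sum>\<^sub>\<infinity>x. (cmod (v x))\<^sup>2) \<le> C\<^sup>2"
    using s by (rule infsum_le_finite_sums) (auto intro: b)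
  then show "l2norm v \<le> C"
    unfolding l2norm_def using C0 real_sqrt_le_mono by fastforce
qed

lemma ell2_finite_support:
  assumes "finite F"
  shows "ell2 (\<lambda>x. if x \<in> F then v x else 0)"
    and "l2norm (\<lambda>x. if x \<in> F then v x else 0) = L2_set (\<lambda>x. cmod (v x)) F"
proof -
  have "((\<lambda>x. (cmod (if x \<in> F then v x else 0))\<^sup>2) has_sum (\<Sum>x\<in>F. (cmod (v x))\<^sup>2)) UNIV"
    using has_sum_finite_neutralI[of F UNIV "\<lambda>x. (cmod (if x \<in> F then v x else 0))\<^sup>2"] assms by auto
  then show "ell2 (\<lambda>x. if x \<in> F then v x else 0)"
    and "l2norm (\<lambda>x. if x \<in> F then v x else 0) = L2_set (\<lambda>x. cmod (v x)) F"
    unfolding ell2_def l2norm_def L2_set_def by (auto simp: has_sum_iff)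
qed

lemma ell2_mult_abs_summable:
  assumes "ell2 v" "ell2 w"
  shows "(\<lambda>x. cmod (v x * w x)) summable_on UNIV"
proof (rule nonneg_bdd_above_summable_on)
  have "(\<Sum>x\<in>F. cmod (v x * w x)) \<le> l2norm v * l2norm w" for F
  proof -
    have "(\<Sum>x\<in>F. cmod (v x * w x)) \<le> L2_set (\<lambda>x. cmod (v x)) F * L2_set (\<lambda>x. cmod (w x)) F"
      using L2_set_mult_ineq[of "\<lambda>x. cmod (v x)" "\<lambda>x. cmod (w x)" F] by (simp add: norm_mult)
    also have "\<dots> \<le> l2norm v * l2norm w"
      by (intro mult_mono L2_set_le_l2norm assms) auto
    finally show ?thesis .
  qed
  then show "bdd_above (sum (\<lambda>x. cmod (v x * w x)) ` {F. F \<subseteq> UNIV \<and> finite F})"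
    by (auto simp: bdd_above_def)
qed auto

lemma ell2_mult_summable:
  assumes "ell2 v" "ell2 w"
  shows "(\<lambda>x. v x * w x) summable_on UNIV"
  using ell2_mult_abs_summable[OF assms] by (rule abs_summable_summable)

lemma cmod_infsum_mult_le:
  assumes "ell2 v" "ell2 w"
  shows "cmod (\<Sum>\<^sub>\<infinity>x. v x * w x) \<le> l2norm v * l2norm w"
proof -
  have "((\<lambda>F. cmod (\<Sum>x\<in>F. v x * w x)) \<longlongrightarrow> cmod (\<Sum>\<^sub>\<infinity>x. v x * w x)) (finite_subsets_at_top UNIV)"
    using ell2_mult_summable[OF assms] by (intro tendsto_intros infsum_tendsto)
  moreover have "cmod (\<Sum>x\<in>F. v x * w x) \<le> l2norm v * l2norm w" for F
    by (rule order_trans[OF cmod_sum_mult_le]) (intro mult_mono L2_set_le_l2norm assms; simp)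
  ultimately show ?thesis
    by (intro tendsto_upperbound[of _ _ "finite_subsets_at_top UNIV"]) auto
qed

text \<open>Supplies the norm convergence of truncations on which associativity of the matrix
  product rests.\<close>

lemma l2norm_tail_tendsto:
  assumes "ell2 v"
  shows "((\<lambda>F. l2norm (\<lambda>x. if x \<in> F then 0 else v x)) \<longlongrightarrow> 0) (finite_subsets_at_top UNIV)"
proof -
  have s: "(\<lambda>x. (cmod (v x))\<^sup>2) summable_on UNIV" using assms by (simp add: ell2_def)
  have t: "(\<Sum>\<^sub>\<infinity>x. (cmod (if x \<in> F then 0 else v x))\<^sup>2)
      = (\<Sum>\<^sub>\<infinity>x. (cmod (v x))\<^sup>2) - (\<Sum>x\<in>F. (cmod (v x))\<^sup>2)" if "finite F" for F
  proof -
    have "(\<Sum>\<^sub>\<infinity>x. (cmod (v x))\<^sup>2) =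
        (\<Sum>\<^sub>\<infinity>x. (cmod (if x \<in> F then 0 else v x))\<^sup>2 + (if x \<in> F then (cmod (v x))\<^sup>2 else 0))"
      by (intro infsum_cong) auto
    also have "\<dots> = (\<Sum>\<^sub>\<infinity>x. (cmod (if x \<in> F then 0 else v x))\<^sup>2) + (\<Sum>\<^sub>\<infinity>x. (if x \<in> F then (cmod (v x))\<^sup>2 else 0))"
    proof (rule infsum_add)
      show "(\<lambda>x. (cmod (if x \<in> F then 0 else v x))\<^sup>2) summable_on UNIV"
        by (rule summable_on_comparison_test[OF s]) auto
      show "(\<lambda>x. if x \<in> F then (cmod (v x))\<^sup>2 else 0) summable_on UNIV"
        by (rule summable_on_comparison_test[OF s]) auto
    qed
    also have "(\<Sum>\<^sub>\<infinity>x. (if x \<in> F then (cmod (v x))\<^sup>2 else 0)) = (\<Sum>x\<in>F. (cmod (v x))\<^sup>2)"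
      using has_sum_finite_neutralI[of F UNIV "\<lambda>x. if x \<in> F then (cmod (v x))\<^sup>2 else 0"] that
      by (auto simp: has_sum_iff)
    finally show ?thesis by simp
  qed
  have "((\<lambda>F. sqrt ((\<Sum>\<^sub>\<infinity>x. (cmod (v x))\<^sup>2) - (\<Sum>x\<in>F. (cmod (v x))\<^sup>2))) \<longlongrightarrow>
      sqrt ((\<Sum>\<^sub>\<infinity>x. (cmod (v x))\<^sup>2) - (\<Sum>\<^sub>\<infinity>x. (cmod (v x))\<^sup>2))) (finite_subsets_at_top UNIV)"
    by (intro tendsto_intros infsum_tendsto s)
  then show ?thesis
    unfolding diff_self real_sqrt_zero
    by (rule Lim_transform_eventually)
       (auto intro!: eventually_finite_subsets_at_top_weakI simp: l2norm_def t)
qed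

lemma ell2_tail: "ell2 v \<Longrightarrow> ell2 (\<lambda>x. if x \<in> F then 0 else v x)"
  unfolding ell2_def by (erule summable_on_comparison_test) auto

section \<open>Bounded matrices\<close>

text \<open>The norm is tested on finitely supported vectors only, so that the condition is evidently
  preserved under adjoints and entrywise limits.\<close>

definition norm_le :: "real \<Rightarrow> 'a mat \<Rightarrow> bool" where
  "norm_le C a \<longleftrightarrow> (\<forall>F G v w. finite F \<longrightarrow> finite G \<longrightarrow>
     cmod (\<Sum>x\<in>F. \<Sum>y\<in>G. w x * a x y * v y)
       \<le> C * L2_set (\<lambda>x. cmod (w x)) F * L2_set (\<lambda>y. cmod (v y)) G)"

lemma norm_leD:
  assumes "norm_le C a" "finite F" "finite G"
  shows "cmod (\<Sum>x\<in>F. \<Sum>y\<in>G. w x * a x y * v y)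
       \<le> C * L2_set (\<lambda>x. cmod (w x)) F * L2_set (\<lambda>y. cmod (v y)) G"
  using assms unfolding norm_le_def by blast

lemma norm_le_entry:
  assumes "norm_le C a"
  shows "cmod (a x y) \<le> C"
  using norm_leD[OF assms, of "{x}" "{y}" "\<lambda>_. 1" "\<lambda>_. 1"] by simp

lemma norm_le_nonneg: "norm_le C a \<Longrightarrow> 0 \<le> C"
  using norm_le_entry[of C a undefined undefined] norm_ge_zero[of "a undefined undefined"] by linarith

lemma norm_le_mono:
  assumes "norm_le C a" "C \<le> D"
  shows "norm_le D a"
  unfolding norm_le_def
proof (intro allI impI)
  fix F G :: "'a set" and v w :: "'a \<Rightarrow> complex" assume "finite F" "finite G"
  note norm_leD[OF assms(1) this, of w v]
  also have "C * L2_set (\<lambda>x. cmod (w x)) F * L2_set (\<lambda>y. cmod (v y)) G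
      \<le> D * L2_set (\<lambda>x. cmod (w x)) F * L2_set (\<lambda>y. cmod (v y)) G"
    by (intro mult_right_mono assms L2_set_nonneg)
  finally show "cmod (\<Sum>x\<in>F. \<Sum>y\<in>G. w x * a x y * v y) \<le> \<dots>" .
qed

lemma norm_le_adj_iff [simp]: "norm_le C (mat_adj a) \<longleftrightarrow> norm_le C a"
proof -
  have "norm_le C (mat_adj a)" if "norm_le C a" for a :: "'a mat"
    unfolding norm_le_def
  proof (intro allI impI)
    fix F G :: "'a set" and v w :: "'a \<Rightarrow> complex" assume fin: "finite F" "finite G"
    have "(\<Sum>x\<in>F. \<Sum>y\<in>G. w x * mat_adj a x y * v y)
        = cnj (\<Sum>x\<in>G. \<Sum>y\<in>F. cnj (v x) * a x y * cnj (w y))"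
      by (subst sum.swap) (simp add: mat_adj_def mult_ac)
    then have "cmod (\<Sum>x\<in>F. \<Sum>y\<in>G. w x * mat_adj a x y * v y)
      = cmod (\<Sum>x\<in>G. \<Sum>y\<in>F. cnj (v x) * a x y * cnj (w y))" by (simp only: complex_mod_cnj)
    also have "\<dots> \<le> C * L2_set (\<lambda>x. cmod (w x)) F * L2_set (\<lambda>y. cmod (v y)) G"
      using norm_leD[OF that fin(2,1), of "\<lambda>x. cnj (v x)" "\<lambda>x. cnj (w x)"] by (simp add: mult_ac)
    finally show "cmod (\<Sum>x\<in>F. \<Sum>y\<in>G. w x * mat_adj a x y * v y) \<le> \<dots>" .
  qed
  from this[of a] this[of "mat_adj a"] show ?thesis by (auto simp: mat_adj_def)
qed

lemma norm_le_transpose: "norm_le C a \<Longrightarrow> norm_le C (\<lambda>x y. a y x)"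
proof (unfold norm_le_def, intro allI impI)
  fix F G :: "'a set" and v w :: "'a \<Rightarrow> complex"
  assume a: "\<forall>F G v w. finite F \<longrightarrow> finite G \<longrightarrow> cmod (\<Sum>x\<in>F. \<Sum>y\<in>G. w x * a x y * v y)
       \<le> C * L2_set (\<lambda>x. cmod (w x)) F * L2_set (\<lambda>y. cmod (v y)) G" and "finite F" "finite G"
  have "(\<Sum>x\<in>F. \<Sum>y\<in>G. w x * a y x * v y) = (\<Sum>y\<in>G. \<Sum>x\<in>F. v y * a y x * w x)"
    by (subst sum.swap) (simp add: mult_ac)
  then show "cmod (\<Sum>x\<in>F. \<Sum>y\<in>G. w x * a y x * v y)
       \<le> C * L2_set (\<lambda>x. cmod (w x)) F * L2_set (\<lambda>y. cmod (v y)) G"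
    using a[rule_format, OF \<open>finite G\<close> \<open>finite F\<close>, of v w] by (simp add: mult_ac)
qed

lemma norm_le_col:
  assumes "norm_le C a"
  shows "ell2 (\<lambda>x. a x y)" "l2norm (\<lambda>x. a x y) \<le> C"
proof -
  have "L2_set (\<lambda>x. cmod (a x y)) F \<le> C" if "finite F" for F
  proof -
    let ?S = "L2_set (\<lambda>x. cmod (a x y)) F"
    \<comment> \<open>Pairing the column with its own conjugate turns the form into the square of
      its norm.\<close>
    have "?S\<^sup>2 = cmod (\<Sum>x\<in>F. \<Sum>y\<in>{y}. cnj (a x y) * a x y * 1)"
    proof -
      have "(\<Sum>x\<in>F. \<Sum>y\<in>{y}. cnj (a x y) * a x y * 1) = of_real (\<Sum>x\<in>F. (cmod (a x y))\<^sup>2)"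
        using sum_mult_cnj[of "\<lambda>x. a x y" F] by (simp add: mult.commute)
      then show ?thesis by (simp only: norm_of_real) (simp add: L2_set_power2 sum_nonneg)
    qed
    also have "\<dots> \<le> C * ?S * 1"
      using norm_leD[OF assms that, of "{y}" "\<lambda>x. cnj (a x y)" "\<lambda>_. 1"] by simp
    finally have "?S * ?S \<le> C * ?S" by (simp add: power2_eq_square)
    then show ?thesis using norm_le_nonneg[OF assms] by (rule le_if_square_le) simp
  qed
  from ell2_if_L2_set_le[OF this] show "ell2 (\<lambda>x. a x y)" "l2norm (\<lambda>x. a x y) \<le> C" by blast+
qed

lemma norm_le_row:
  assumes "norm_le C a"
  shows "ell2 (\<lambda>y. a x y)" "l2norm (\<lambda>y. a x y) \<le> C"
  using norm_le_col[OF norm_le_transpose[OF assms]] .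

lemma mat_app_summable:
  "norm_le C a \<Longrightarrow> ell2 v \<Longrightarrow> (\<lambda>y. a x y * v y) summable_on UNIV"
  using ell2_mult_summable[OF norm_le_row(1)] .

text \<open>The defining bound sees finite sums only. Pairing the image with its conjugate on a
  finite set \<open>F\<close> gives the square of its norm there, and letting \<open>G\<close>
  exhaust the space brings in all of \<open>v\<close>.\<close>

lemma norm_le_mat_app:
  assumes "norm_le C a" "ell2 v"
  shows "ell2 (mat_app a v)" "l2norm (mat_app a v) \<le> C * l2norm v"
proof -
  have "L2_set (\<lambda>x. cmod (mat_app a v x)) F \<le> C * l2norm v" if fin: "finite F" for F
  proof -
    let ?S = "L2_set (\<lambda>x. cmod (mat_app a v x)) F"
    define w where "w x = cnj (mat_app a v x)" for x
    have "((\<lambda>G. \<Sum>x\<in>F. \<Sum>y\<in>G. w x * (a x y * v y)) \<longlongrightarrow> (\<Sum>x\<in>F. w x * mat_app a v x)) (finite_subsets_at_top UNIV)"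
      unfolding mat_app_def sum_distrib_left[symmetric]
      by (intro tendsto_sum tendsto_mult tendsto_const infsum_tendsto mat_app_summable[OF assms])
    then have "((\<lambda>G. cmod (\<Sum>x\<in>F. \<Sum>y\<in>G. w x * a x y * v y)) \<longlongrightarrow> cmod (\<Sum>x\<in>F. w x * mat_app a v x)) (finite_subsets_at_top UNIV)"
      by (intro tendsto_norm) (simp add: mult.assoc)
    moreover have "cmod (\<Sum>x\<in>F. \<Sum>y\<in>G. w x * a x y * v y) \<le> C * ?S * l2norm v" if "finite G" for G
    proof -
      note norm_leD[OF assms(1) fin that, of w v]
      also have "C * L2_set (\<lambda>x. cmod (w x)) F * L2_set (\<lambda>y. cmod (v y)) G \<le> C * ?S * l2norm v"
        using L2_set_le_l2norm[OF assms(2)] norm_le_nonneg[OF assms(1)]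
        by (intro mult_mono) (auto simp: w_def)
      finally show ?thesis .
    qed
    ultimately have "cmod (\<Sum>x\<in>F. w x * mat_app a v x) \<le> C * ?S * l2norm v"
      by (intro tendsto_upperbound[of _ _ "finite_subsets_at_top UNIV"])
         (auto intro!: eventually_finite_subsets_at_top_weakI)
    moreover have "(\<Sum>x\<in>F. w x * mat_app a v x) = of_real (?S\<^sup>2)"
      unfolding L2_set_power2 sum_mult_cnj[symmetric] by (simp add: w_def mult.commute)
    ultimately have "?S * ?S \<le> (C * l2norm v) * ?S"
      by (simp only: norm_of_real) (simp add: power2_eq_square mult_ac)
    then show ?thesis using norm_le_nonneg[OF assms(1)] by (auto intro: le_if_square_le)
  qed
  from ell2_if_L2_set_le[OF this] show "ell2 (mat_app a v)" "l2norm (mat_app a v) \<le> C * l2norm v" by blast+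
qed

lemma mat_app_finite_support:
  assumes "finite G"
  shows "mat_app a (\<lambda>y. if y \<in> G then v y else 0) x = (\<Sum>y\<in>G. a x y * v y)"
proof -
  have "((\<lambda>y. a x y * (if y \<in> G then v y else 0)) has_sum (\<Sum>y\<in>G. a x y * v y)) UNIV"
    using has_sum_finite_neutralI[of G UNIV "\<lambda>y. a x y * (if y \<in> G then v y else 0)"] assms by auto
  then show ?thesis unfolding mat_app_def by (simp add: has_sum_iff)
qed

lemma norm_le_if_mat_app_le:
  assumes "0 \<le> C" and "\<And>v. ell2 v \<Longrightarrow> ell2 (mat_app a v) \<and> l2norm (mat_app a v) \<le> C * l2norm v"
  shows "norm_le C a"
  unfolding norm_le_def
proof (intro allI impI)
  fix F G :: "'a set" and v w :: "'a \<Rightarrow> complex" assume fin: "finite F" "finite G"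
  define v' where "v' y = (if y \<in> G then v y else 0)" for y
  have v': "ell2 v'" "l2norm v' = L2_set (\<lambda>x. cmod (v x)) G"
    using ell2_finite_support[OF fin(2), of v] by (simp_all add: v'_def[abs_def])
  have "(\<Sum>x\<in>F. \<Sum>y\<in>G. w x * a x y * v y) = (\<Sum>x\<in>F. w x * mat_app a v' x)"
    using mat_app_finite_support[OF fin(2), of a v] by (simp add: v'_def[abs_def] sum_distrib_left mult.assoc)
  also have "cmod \<dots> \<le> L2_set (\<lambda>x. cmod (w x)) F * L2_set (\<lambda>x. cmod (mat_app a v' x)) F"
    by (rule cmod_sum_mult_le)
  also have "\<dots> \<le> L2_set (\<lambda>x. cmod (w x)) F * (C * l2norm v')"
    using assms(2)[OF v'(1)] L2_set_le_l2norm[of "mat_app a v'" F] by (intro mult_left_mono) auto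
  finally show "cmod (\<Sum>x\<in>F. \<Sum>y\<in>G. w x * a x y * v y)
     \<le> C * L2_set (\<lambda>x. cmod (w x)) F * L2_set (\<lambda>y. cmod (v y)) G"
    by (simp add: v'(2) mult_ac)
qed

lemma bdd_op_iff: "bdd_op a \<longleftrightarrow> (\<exists>C. norm_le C a)"
proof
  assume "bdd_op a"
  then obtain C where C: "\<And>v. ell2 v \<Longrightarrow> ell2 (mat_app a v) \<and> l2norm (mat_app a v) \<le> C * l2norm v"
    unfolding bdd_op_def by blast
  have "norm_le (max C 0) a"
  proof (rule norm_le_if_mat_app_le)
    fix v :: "'a \<Rightarrow> complex" assume "ell2 v"
    moreover have "C * l2norm v \<le> max C 0 * l2norm v" by (intro mult_right_mono) auto
    ultimately show "ell2 (mat_app a v) \<and> l2norm (mat_app a v) \<le> max C 0 * l2norm v"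
      using C[of v] by linarith
  qed simp
  then show "\<exists>C. norm_le C a" ..
next
  assume "\<exists>C. norm_le C a"
  then obtain C where C: "norm_le C a" ..
  show "bdd_op a" unfolding bdd_op_def
    using mat_app_summable[OF C] norm_le_mat_app[OF C] by (intro exI[of _ C]) auto
qed

lemma mat_app_scale: "mat_app a (\<lambda>y. c * v y) = (\<lambda>x. c * mat_app a v x)"
  unfolding mat_app_def by (simp add: mult.left_commute infsum_cmult_right')

lemma l2norm_scale: "l2norm (\<lambda>y. c * v y) = cmod c * l2norm v"
  unfolding l2norm_def by (simp add: norm_mult power_mult_distrib infsum_cmult_right' real_sqrt_mult)

lemma ell2_scale: "ell2 v \<Longrightarrow> ell2 (\<lambda>y. c * v y)"
  unfolding ell2_def by (simp add: norm_mult power_mult_distrib summable_on_cmult_right)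

lemma op_norm_le:
  assumes "norm_le C a"
  shows "op_norm a \<le> C"
  unfolding op_norm_def
proof (rule cSup_least)
  have "ell2 (\<lambda>x::'a. 0)" "l2norm (\<lambda>x::'a. 0) \<le> 1" by (simp_all add: ell2_def l2norm_def)
  then show "{l2norm (mat_app a v) |v. ell2 v \<and> l2norm v \<le> 1} \<noteq> {}" by (auto intro!: exI[of _ "\<lambda>_. 0"])
  fix t assume "t \<in> {l2norm (mat_app a v) |v. ell2 v \<and> l2norm v \<le> 1}"
  then obtain v where v: "ell2 v" "l2norm v \<le> 1" "t = l2norm (mat_app a v)" by auto
  have "t \<le> C * l2norm v" using norm_le_mat_app[OF assms v(1)] v(3) by simp
  also have "\<dots> \<le> C * 1" using v(2) norm_le_nonneg[OF assms] by (intro mult_left_mono)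
  finally show "t \<le> C" by simp
qed

text \<open>Boundedness makes the supremum in \<open>op_norm\<close> meaningful; normalising a
  vector of nonzero norm then gives the estimate, and vectors of norm zero are treated
  apart.\<close>

lemma norm_le_op_norm:
  assumes "bdd_op a"
  shows "norm_le (op_norm a) a"
proof -
  obtain C where C: "norm_le C a" using assms bdd_op_iff by blast
  have bdd: "bdd_above {l2norm (mat_app a v) |v. ell2 v \<and> l2norm v \<le> 1}"
  proof (rule bdd_aboveI)
    fix t assume "t \<in> {l2norm (mat_app a v) |v. ell2 v \<and> l2norm v \<le> 1}"
    then obtain v where v: "ell2 v" "l2norm v \<le> 1" "t = l2norm (mat_app a v)" by auto
    have "t \<le> C * l2norm v" using norm_le_mat_app[OF C v(1)] v(3) by simp
    also have "\<dots> \<le> C * 1" using v(2) norm_le_nonneg[OF C] by (intro mult_left_mono)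
    finally show "t \<le> C" by simp
  qed
  have up: "l2norm (mat_app a v) \<le> op_norm a" if "ell2 v" "l2norm v \<le> 1" for v
    unfolding op_norm_def using that by (intro cSup_upper bdd) auto
  have "0 \<le> l2norm (mat_app a (\<lambda>_. 0))" by simp
  also have "\<dots> \<le> op_norm a" by (rule up) (simp_all add: ell2_def l2norm_def)
  finally have nn: "0 \<le> op_norm a" .
  show ?thesis
  proof (rule norm_le_if_mat_app_le[OF nn], intro conjI)
    fix v :: "'a \<Rightarrow> complex" assume v: "ell2 v"
    show "ell2 (mat_app a v)" by (rule norm_le_mat_app[OF C v])
    show "l2norm (mat_app a v) \<le> op_norm a * l2norm v"
    proof (cases "l2norm v = 0")
      case True
      then show ?thesis using norm_le_mat_app(2)[OF C v] by simp
    next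
      case False
      define c :: complex where "c = of_real (1 / l2norm v)"
      have "l2norm (mat_app a (\<lambda>x. c * v x)) \<le> op_norm a"
      proof (intro up ell2_scale v)
        show "l2norm (\<lambda>x. c * v x) \<le> 1" unfolding l2norm_scale using False by (simp add: c_def norm_divide)
      qed
      then show ?thesis
        unfolding mat_app_scale l2norm_scale
        using False by (simp add: c_def norm_divide field_simps less_le)
    qed
  qed
qed

lemma norm_le_mult:
  assumes "norm_le C a" "norm_le D b"
  shows "norm_le (C * D) (mat_mult a b)"
  unfolding norm_le_def
proof (intro allI impI)
  fix F G :: "'a set" and v w :: "'a \<Rightarrow> complex" assume fin: "finite F" "finite G"
  define v' where "v' y = (if y \<in> G then v y else 0)" for y
  have v': "ell2 v'" "l2norm v' = L2_set (\<lambda>x. cmod (v x)) G"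
    using ell2_finite_support[OF fin(2), of v] by (simp_all add: v'_def[abs_def])
  let ?u = "mat_app b v'"
  have u: "ell2 ?u" "l2norm ?u \<le> D * l2norm v'" by (rule norm_le_mat_app[OF assms(2) v'(1)])+
  have ab: "(\<Sum>y\<in>G. mat_mult a b x y * v y) = mat_app a ?u x" for x
  proof -
    have "(\<Sum>y\<in>G. mat_mult a b x y * v y) = (\<Sum>y\<in>G. \<Sum>\<^sub>\<infinity>z. a x z * b z y * v y)"
      by (simp add: mat_mult_def infsum_cmult_left')
    also have "\<dots> = (\<Sum>\<^sub>\<infinity>z. \<Sum>y\<in>G. a x z * b z y * v y)"
      by (intro infsum_finite_sum[symmetric] summable_on_cmult_left ell2_mult_summable
           norm_le_row[OF assms(1)] norm_le_col[OF assms(2)])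
    also have "\<dots> = mat_app a ?u x" unfolding mat_app_def[of a]
      using mat_app_finite_support[OF fin(2), of b v]
      by (simp add: v'_def[abs_def] sum_distrib_left mult.assoc)
    finally show ?thesis .
  qed
  have "(\<Sum>x\<in>F. \<Sum>y\<in>G. w x * mat_mult a b x y * v y) = (\<Sum>x\<in>F. w x * mat_app a ?u x)"
    by (simp add: ab[symmetric] sum_distrib_left mult.assoc)
  also have "cmod \<dots> \<le> L2_set (\<lambda>x. cmod (w x)) F * L2_set (\<lambda>x. cmod (mat_app a ?u x)) F"
    by (rule cmod_sum_mult_le)
  also have "\<dots> \<le> L2_set (\<lambda>x. cmod (w x)) F * (C * (D * l2norm v'))"
  proof (intro mult_left_mono L2_set_nonneg)
    have "L2_set (\<lambda>x. cmod (mat_app a ?u x)) F \<le> l2norm (mat_app a ?u)"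
      by (intro L2_set_le_l2norm norm_le_mat_app[OF assms(1) u(1)])
    also have "\<dots> \<le> C * l2norm ?u" by (rule norm_le_mat_app[OF assms(1) u(1)])
    also have "\<dots> \<le> C * (D * l2norm v')" by (intro mult_left_mono u norm_le_nonneg[OF assms(1)])
    finally show "L2_set (\<lambda>x. cmod (mat_app a ?u x)) F \<le> C * (D * l2norm v')" .
  qed
  finally show "cmod (\<Sum>x\<in>F. \<Sum>y\<in>G. w x * mat_mult a b x y * v y)
     \<le> C * D * L2_set (\<lambda>x. cmod (w x)) F * L2_set (\<lambda>y. cmod (v y)) G"
    by (simp add: v'(2) mult_ac)
qed

text \<open>The double series need not converge absolutely, so Fubini does not apply; both sides
  are continuous in \<open>v\<close>, and they agree on truncations of \<open>v\<close>.\<close>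

lemma bilinear_form_assoc:
  assumes b: "norm_le C b" and v: "ell2 v" and w: "ell2 w"
  shows "(\<Sum>\<^sub>\<infinity>z. (\<Sum>\<^sub>\<infinity>t. v t * b t z) * w z) = (\<Sum>\<^sub>\<infinity>t. v t * (\<Sum>\<^sub>\<infinity>z. b t z * w z))"
proof -
  let ?T = "\<lambda>t z. b z t"
  have bT: "norm_le C ?T" by (rule norm_le_transpose[OF b])
  have app: "mat_app ?T u z = (\<Sum>\<^sub>\<infinity>t. u t * b t z)" for u z
    by (simp add: mat_app_def mult.commute)
  let ?tail = "\<lambda>F x. if x \<in> F then 0 else v x"
  let ?L = "\<Sum>\<^sub>\<infinity>z. mat_app ?T v z * w z"
  let ?R = "\<lambda>F. \<Sum>t\<in>F. v t * (\<Sum>\<^sub>\<infinity>z. b t z * w z)"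
  have split: "?L - ?R F = (\<Sum>\<^sub>\<infinity>z. mat_app ?T (?tail F) z * w z)" if F: "finite F" for F
  proof -
    have "mat_app ?T v z = mat_app ?T (?tail F) z + (\<Sum>t\<in>F. v t * b t z)" for z
    proof -
      have "mat_app ?T v z = (\<Sum>\<^sub>\<infinity>t. b t z * ?tail F t + b t z * (if t \<in> F then v t else 0))"
        unfolding mat_app_def by (intro infsum_cong) auto
      also have "\<dots> = mat_app ?T (?tail F) z + mat_app ?T (\<lambda>t. if t \<in> F then v t else 0) z"
        unfolding mat_app_def
        by (intro infsum_add ell2_mult_summable norm_le_col[OF b] ell2_tail v ell2_finite_support F)
      finally show ?thesis by (simp add: mat_app_finite_support[OF F] mult.commute)
    qed
    then have "?L = (\<Sum>\<^sub>\<infinity>z. mat_app ?T (?tail F) z * w z + (\<Sum>t\<in>F. v t * (b t z * w z)))"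
      by (simp add: distrib_right sum_distrib_right mult.assoc)
    also have "\<dots> = (\<Sum>\<^sub>\<infinity>z. mat_app ?T (?tail F) z * w z) + (\<Sum>\<^sub>\<infinity>z. \<Sum>t\<in>F. v t * (b t z * w z))"
      by (intro infsum_add ell2_mult_summable norm_le_mat_app[OF bT] ell2_tail v w summable_on_finite_sum
          summable_on_cmult_right norm_le_row[OF b])
    also have "(\<Sum>\<^sub>\<infinity>z. \<Sum>t\<in>F. v t * (b t z * w z)) = ?R F"
      by (subst infsum_finite_sum)
        (auto intro!: summable_on_cmult_right ell2_mult_summable w norm_le_row[OF b] simp: infsum_cmult_right')
    finally show ?thesis by simp
  qed
  have "((\<lambda>F. ?L - ?R F) \<longlongrightarrow> 0) (finite_subsets_at_top UNIV)"
  proof (rule Lim_null_comparison)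
    have "cmod (?L - ?R F) \<le> C * l2norm (?tail F) * l2norm w" if "finite F" for F
    proof -
      have "cmod (?L - ?R F) \<le> l2norm (mat_app ?T (?tail F)) * l2norm w"
        unfolding split[OF that] by (intro cmod_infsum_mult_le w norm_le_mat_app[OF bT] ell2_tail v)
      also have "\<dots> \<le> C * l2norm (?tail F) * l2norm w"
        by (intro mult_right_mono norm_le_mat_app[OF bT] ell2_tail v) simp
      finally show ?thesis .
    qed
    then show "\<forall>\<^sub>F F in finite_subsets_at_top UNIV. cmod (?L - ?R F) \<le> C * l2norm (?tail F) * l2norm w"
      by (intro eventually_finite_subsets_at_top_weakI)
    have "((\<lambda>F. C * l2norm (?tail F) * l2norm w) \<longlongrightarrow> C * 0 * l2norm w) (finite_subsets_at_top UNIV)"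
      by (intro tendsto_intros l2norm_tail_tendsto v)
    then show "((\<lambda>F. C * l2norm (?tail F) * l2norm w) \<longlongrightarrow> 0) (finite_subsets_at_top UNIV)" by simp
  qed
  moreover have "((\<lambda>F. ?L - ?R F) \<longlongrightarrow> ?L - (\<Sum>\<^sub>\<infinity>t. v t * (\<Sum>\<^sub>\<infinity>z. b t z * w z))) (finite_subsets_at_top UNIV)"
    using norm_le_mat_app[OF b w] 
    by (intro tendsto_intros infsum_tendsto ell2_mult_summable v) (simp add: mat_app_def[abs_def])
  ultimately have "?L - (\<Sum>\<^sub>\<infinity>t. v t * (\<Sum>\<^sub>\<infinity>z. b t z * w z)) = 0"
    using tendsto_unique finite_subsets_at_top_neq_bot by blast
  then show ?thesis by (simp add: app)
qed

lemma bdd_opI: "norm_le C a \<Longrightarrow> bdd_op a"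
  unfolding bdd_op_iff ..

lemma bdd_opE:
  assumes "bdd_op a"
  obtains C where "norm_le C a"
  using assms unfolding bdd_op_iff by blast

lemma mat_mult_assoc:
  assumes "bdd_op a" "bdd_op b" "bdd_op c"
  shows "mat_mult (mat_mult a b) c = mat_mult a (mat_mult b c)"
proof (intro ext)
  fix x y
  obtain A B C where *: "norm_le A a" "norm_le B b" "norm_le C c" using assms bdd_op_iff by metis
  show "mat_mult (mat_mult a b) c x y = mat_mult a (mat_mult b c) x y"
    unfolding mat_mult_def by (rule bilinear_form_assoc[OF *(2) norm_le_row(1)[OF *(1)] norm_le_col(1)[OF *(3)]])
qed

lemma mat_mult_summable:
  assumes "bdd_op a" "bdd_op b"
  shows "(\<lambda>z. a x z * b z y) summable_on UNIV"
proof -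
  obtain A B where *: "norm_le A a" "norm_le B b" using assms bdd_op_iff by metis
  show ?thesis by (rule ell2_mult_summable[OF norm_le_row(1)[OF *(1)] norm_le_col(1)[OF *(2)]])
qed

section \<open>Norm bounds for linear combinations, sparse matrices and moved columns\<close>

lemma norm_le_add:
  assumes "norm_le C a" "norm_le D b"
  shows "norm_le (C + D) (mat_add a b)"
  unfolding norm_le_def
proof (intro allI impI)
  fix F G :: "'a set" and v w :: "'a \<Rightarrow> complex" assume fin: "finite F" "finite G"
  have "(\<Sum>x\<in>F. \<Sum>y\<in>G. w x * mat_add a b x y * v y)
     = (\<Sum>x\<in>F. \<Sum>y\<in>G. w x * a x y * v y) + (\<Sum>x\<in>F. \<Sum>y\<in>G. w x * b x y * v y)"
    by (simp add: mat_add_def distrib_left distrib_right sum.distrib)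
  also have "cmod \<dots> \<le> C * L2_set (\<lambda>x. cmod (w x)) F * L2_set (\<lambda>y. cmod (v y)) G
     + D * L2_set (\<lambda>x. cmod (w x)) F * L2_set (\<lambda>y. cmod (v y)) G"
    by (intro order_trans[OF norm_triangle_ineq] add_mono norm_leD assms fin)
  finally show "cmod (\<Sum>x\<in>F. \<Sum>y\<in>G. w x * mat_add a b x y * v y)
    \<le> (C + D) * L2_set (\<lambda>x. cmod (w x)) F * L2_set (\<lambda>y. cmod (v y)) G"
    by (simp add: distrib_right)
qed

lemma norm_le_scale:
  assumes "norm_le C a"
  shows "norm_le (cmod c * C) (mat_scale c a)"
  unfolding norm_le_def
proof (intro allI impI)
  fix F G :: "'a set" and v w :: "'a \<Rightarrow> complex" assume fin: "finite F" "finite G"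
  have "(\<Sum>x\<in>F. \<Sum>y\<in>G. w x * mat_scale c a x y * v y) = c * (\<Sum>x\<in>F. \<Sum>y\<in>G. w x * a x y * v y)"
    by (simp add: mat_scale_def sum_distrib_left mult_ac)
  also have "cmod \<dots> \<le> cmod c * (C * L2_set (\<lambda>x. cmod (w x)) F * L2_set (\<lambda>y. cmod (v y)) G)"
    unfolding norm_mult by (intro mult_left_mono norm_leD assms fin) simp
  finally show "cmod (\<Sum>x\<in>F. \<Sum>y\<in>G. w x * mat_scale c a x y * v y)
    \<le> cmod c * C * L2_set (\<lambda>x. cmod (w x)) F * L2_set (\<lambda>y. cmod (v y)) G"
    by (simp add: mult_ac)
qed

lemma mat_diff_eq_add: "mat_diff a b = mat_add a (mat_scale (-1) b)"
  by (simp add: mat_diff_def mat_add_def mat_scale_def)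

lemma norm_le_diff:
  assumes "norm_le C a" "norm_le D b"
  shows "norm_le (C + D) (mat_diff a b)"
  using norm_le_add[OF assms(1) norm_le_scale[OF assms(2), of "-1"]] by (simp add: mat_diff_eq_add)

lemma norm_le_zero [simp]: "norm_le 0 (\<lambda>x y. 0)"
  by (simp add: norm_le_def)

lemma norm_le_sum:
  assumes "\<And>i. i \<in> I \<Longrightarrow> norm_le (C i) (a i)"
  shows "norm_le (\<Sum>i\<in>I. C i) (\<lambda>x y. \<Sum>i\<in>I. a i x y)"
  using assms
proof (induction I rule: infinite_finite_induct)
  case (insert i I)
  then show ?case using norm_le_add[of "C i" "a i" "sum C I" "\<lambda>x y. \<Sum>i\<in>I. a i x y"]
    by (simp add: mat_add_def)
qed auto

text \<open>Cauchy-Schwarz over the pairs in the support of \<open>m\<close>: every row index and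
  every column index occurs in at most \<open>N\<close> of them, so each of the two factors costs
  \<open>sqrt N\<close>.\<close>

lemma norm_le_Schur:
  fixes m :: "'a mat" and N :: nat
  assumes K: "\<And>x y. cmod (m x y) \<le> K"
    and row: "\<And>x. finite {y. m x y \<noteq> 0} \<and> card {y. m x y \<noteq> 0} \<le> N"
    and col: "\<And>y. finite {x. m x y \<noteq> 0} \<and> card {x. m x y \<noteq> 0} \<le> N"
  shows "norm_le (K * N) m"
  unfolding norm_le_def
proof (intro allI impI)
  fix F G :: "'a set" and v w :: "'a \<Rightarrow> complex" assume fin: "finite F" "finite G"
  let ?W = "L2_set (\<lambda>x. cmod (w x)) F" and ?V = "L2_set (\<lambda>y. cmod (v y)) G"
  let ?P = "{p \<in> F \<times> G. m (fst p) (snd p) \<noteq> 0}"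
  have K0: "0 \<le> K" using order_trans[OF norm_ge_zero K[of undefined undefined]] .
  have finP: "finite ?P" using fin by auto
  have "(L2_set (\<lambda>p. cmod (w (fst p))) ?P)\<^sup>2 \<le> N * ?W\<^sup>2"
  proof -
    have "(L2_set (\<lambda>p. cmod (w (fst p))) ?P)\<^sup>2 = (\<Sum>p\<in>Sigma F (\<lambda>x. {y\<in>G. m x y \<noteq> 0}). (cmod (w (fst p)))\<^sup>2)"
      unfolding L2_set_power2 by (rule sum.cong) auto
    also have "\<dots> = (\<Sum>x\<in>F. \<Sum>y\<in>{y\<in>G. m x y \<noteq> 0}. (cmod (w x))\<^sup>2)"
      using fin by (subst sum.Sigma) (auto simp: case_prod_unfold)
    also have "\<dots> \<le> (\<Sum>x\<in>F. N * (cmod (w x))\<^sup>2)"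
    proof (rule sum_mono)
      fix x
      have "card {y\<in>G. m x y \<noteq> 0} \<le> card {y. m x y \<noteq> 0}" using row by (intro card_mono) auto
      also have "\<dots> \<le> N" using row by blast
      finally show "(\<Sum>y\<in>{y\<in>G. m x y \<noteq> 0}. (cmod (w x))\<^sup>2) \<le> N * (cmod (w x))\<^sup>2"
        by (simp add: mult_right_mono)
    qed
    finally show ?thesis by (simp add: L2_set_power2 sum_distrib_left)
  qed
  then have 1: "L2_set (\<lambda>p. cmod (w (fst p))) ?P \<le> sqrt N * ?W"
    by (rule power2_le_imp_le[OF ord_le_eq_trans]) (simp_all add: power_mult_distrib)
  have "(L2_set (\<lambda>p. cmod (v (snd p))) ?P)\<^sup>2 \<le> N * ?V\<^sup>2"
  proof -
    have "(L2_set (\<lambda>p. cmod (v (snd p))) ?P)\<^sup>2 = (\<Sum>p\<in>Sigma G (\<lambda>y. {x\<in>F. m x y \<noteq> 0}). (cmod (v (fst p)))\<^sup>2)"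
      unfolding L2_set_power2
      by (rule sum.reindex_bij_witness[of _ "\<lambda>p. (snd p, fst p)" "\<lambda>p. (snd p, fst p)"]) auto
    also have "\<dots> = (\<Sum>y\<in>G. \<Sum>x\<in>{x\<in>F. m x y \<noteq> 0}. (cmod (v y))\<^sup>2)"
      using fin by (subst sum.Sigma) (auto simp: case_prod_unfold)
    also have "\<dots> \<le> (\<Sum>y\<in>G. N * (cmod (v y))\<^sup>2)"
    proof (rule sum_mono)
      fix y
      have "card {x\<in>F. m x y \<noteq> 0} \<le> card {x. m x y \<noteq> 0}" using col by (intro card_mono) auto
      also have "\<dots> \<le> N" using col by blast
      finally show "(\<Sum>x\<in>{x\<in>F. m x y \<noteq> 0}. (cmod (v y))\<^sup>2) \<le> N * (cmod (v y))\<^sup>2"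
        by (simp add: mult_right_mono)
    qed
    finally show ?thesis by (simp add: L2_set_power2 sum_distrib_left)
  qed
  then have 2: "L2_set (\<lambda>p. cmod (v (snd p))) ?P \<le> sqrt N * ?V"
    by (rule power2_le_imp_le[OF ord_le_eq_trans]) (simp_all add: power_mult_distrib)
  have "(\<Sum>x\<in>F. \<Sum>y\<in>G. w x * m x y * v y) = (\<Sum>p\<in>F\<times>G. w (fst p) * m (fst p) (snd p) * v (snd p))"
    by (simp add: sum.cartesian_product case_prod_unfold)
  also have "\<dots> = (\<Sum>p\<in>?P. (m (fst p) (snd p) * w (fst p)) * v (snd p))"
    using fin by (intro sum.mono_neutral_cong_right) auto
  also have "cmod \<dots> \<le> L2_set (\<lambda>p. cmod (m (fst p) (snd p) * w (fst p))) ?P * L2_set (\<lambda>p. cmod (v (snd p))) ?P"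
    by (rule cmod_sum_mult_le)
  also have "\<dots> \<le> (K * L2_set (\<lambda>p. cmod (w (fst p))) ?P) * L2_set (\<lambda>p. cmod (v (snd p))) ?P"
    using K K0 by (subst L2_set_right_distrib) (auto intro!: mult_right_mono L2_set_mono simp: norm_mult)
  also have "\<dots> \<le> (K * (sqrt N * ?W)) * (sqrt N * ?V)"
    using K0 by (intro mult_mono 1 2) auto
  finally have le: "cmod (\<Sum>x\<in>F. \<Sum>y\<in>G. w x * m x y * v y) \<le> (K * (sqrt N * ?W)) * (sqrt N * ?V)" .
  then show "cmod (\<Sum>x\<in>F. \<Sum>y\<in>G. w x * m x y * v y) \<le> K * N * ?W * ?V"
  proof -
    have "(K * (sqrt N * ?W)) * (sqrt N * ?V) = K * (sqrt N * sqrt N) * ?W * ?V" by (simp only: mult_ac)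
    with le show ?thesis by (simp only: real_sqrt_mult_self abs_of_nat)
  qed
qed

text \<open>The matrix is \<open>a\<close> times the partial isometry sending the basis vector of
  \<open>x\<close> to that of \<open>f x\<close> for \<open>x\<close> in \<open>S\<close>;
  injectivity means that moving a test vector along \<open>f\<close> does not change its
  norm.\<close>

lemma norm_le_reindex_columns:
  assumes a: "norm_le C a" and f: "inj_on f S"
  shows "norm_le C (\<lambda>z x. if x \<in> S then a z (f x) else 0)"
  unfolding norm_le_def
proof (intro allI impI)
  fix F G :: "'a set" and v w :: "'a \<Rightarrow> complex" assume fin: "finite F" "finite G"
  let ?g = "inv_into S f"
  have inj: "inj_on f (G \<inter> S)" using f by (rule inj_on_subset) auto
  have "(\<Sum>x\<in>F. \<Sum>y\<in>G. w x * (if y \<in> S then a x (f y) else 0) * v y)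
      = (\<Sum>x\<in>F. \<Sum>y\<in>G\<inter>S. w x * a x (f y) * v y)"
    using fin by (intro sum.cong sum.mono_neutral_cong_right refl) auto
  also have "\<dots> = (\<Sum>x\<in>F. \<Sum>y\<in>f ` (G \<inter> S). w x * a x y * v (?g y))"
    using f by (simp add: sum.reindex[OF inj])
  also have "cmod \<dots> \<le> C * L2_set (\<lambda>x. cmod (w x)) F * L2_set (\<lambda>y. cmod (v (?g y))) (f ` (G \<inter> S))"
    using fin by (intro norm_leD a) auto
  also have "L2_set (\<lambda>y. cmod (v (?g y))) (f ` (G \<inter> S)) = L2_set (\<lambda>y. cmod (v y)) (G \<inter> S)"
    unfolding L2_set_def using f by (simp add: sum.reindex[OF inj])
  also have "C * L2_set (\<lambda>x. cmod (w x)) F * L2_set (\<lambda>y. cmod (v y)) (G \<inter> S)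
      \<le> C * L2_set (\<lambda>x. cmod (w x)) F * L2_set (\<lambda>y. cmod (v y)) G"
    using norm_le_nonneg[OF a] fin by (intro mult_left_mono L2_set_subset_mono) auto
  finally show "cmod (\<Sum>x\<in>F. \<Sum>y\<in>G. w x * (if y \<in> S then a x (f y) else 0) * v y)
    \<le> C * L2_set (\<lambda>x. cmod (w x)) F * L2_set (\<lambda>y. cmod (v y)) G" .
qed

lemma bdd_op_add [simp]: "bdd_op a \<Longrightarrow> bdd_op b \<Longrightarrow> bdd_op (mat_add a b)"
  by (meson bdd_op_iff norm_le_add)

lemma bdd_op_diff [simp]: "bdd_op a \<Longrightarrow> bdd_op b \<Longrightarrow> bdd_op (mat_diff a b)"
  by (meson bdd_op_iff norm_le_diff)

lemma bdd_op_scale [simp]: "bdd_op a \<Longrightarrow> bdd_op (mat_scale c a)"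
  by (meson bdd_op_iff norm_le_scale)

lemma bdd_op_mult [simp]: "bdd_op a \<Longrightarrow> bdd_op b \<Longrightarrow> bdd_op (mat_mult a b)"
  by (meson bdd_op_iff norm_le_mult)

lemma bdd_op_adj [simp]: "bdd_op (mat_adj a) \<longleftrightarrow> bdd_op a"
  by (simp add: bdd_op_iff)

lemma infsum_single:
  fixes f :: "'a \<Rightarrow> complex"
  assumes "\<And>z. z \<noteq> k \<Longrightarrow> f z = 0"
  shows "infsum f UNIV = f k"
proof -
  have "(f has_sum f k) UNIV"
    using has_sum_finite_neutralI[of "{k}" UNIV f] assms by auto
  then show ?thesis by (simp add: has_sum_iff)
qed

section \<open>Diagonal matrices, matrix units and the algebra of bounded matrices\<close>

definition diag_mat :: "('a \<Rightarrow> complex) \<Rightarrow> 'a mat" where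
  "diag_mat d = (\<lambda>x y. if x = y then d x else 0)"

definition mat_unit :: "'a \<Rightarrow> 'a \<Rightarrow> 'a mat" where
  "mat_unit p q = (\<lambda>x y. if x = p \<and> y = q then 1 else 0)"

lemma norm_le_diag_mat:
  assumes "\<And>x. cmod (d x) \<le> K"
  shows "norm_le K (diag_mat d)"
proof -
  have 1: "{y. diag_mat d x y \<noteq> 0} \<subseteq> {x}" "{y. diag_mat d y x \<noteq> 0} \<subseteq> {x}" for x
    by (auto simp: diag_mat_def split: if_splits)
  have "0 \<le> K" using order_trans[OF norm_ge_zero assms[of undefined]] .
  have "norm_le (K * of_nat 1) (diag_mat d)"
  proof (rule norm_le_Schur)
    show "finite {y. diag_mat d x y \<noteq> 0} \<and> card {y. diag_mat d x y \<noteq> 0} \<le> 1" for x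
      using card_mono[OF _ 1(1), of x] finite_subset[OF 1(1), of x] by simp
    show "finite {y. diag_mat d y x \<noteq> 0} \<and> card {y. diag_mat d y x \<noteq> 0} \<le> 1" for x
      using card_mono[OF _ 1(2), of x] finite_subset[OF 1(2), of x] by simp
  qed (use assms \<open>0 \<le> K\<close> in \<open>auto simp: diag_mat_def\<close>)
  then show ?thesis by simp
qed

lemma mat_id_eq: "mat_id = diag_mat (\<lambda>_. 1)"
  by (simp add: mat_id_def diag_mat_def)

lemma bdd_op_id [simp]: "bdd_op mat_id"
  unfolding mat_id_eq bdd_op_iff using norm_le_diag_mat[of "\<lambda>_. 1" 1] by auto

lemma mat_mult_diag_right [simp]: "mat_mult a (diag_mat d) x y = a x y * d y"
  unfolding mat_mult_def by (subst infsum_single[of y]) (auto simp: diag_mat_def)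

lemma mat_mult_diag_left [simp]: "mat_mult (diag_mat d) a x y = d x * a x y"
  unfolding mat_mult_def by (subst infsum_single[of x]) (auto simp: diag_mat_def)

lemma mat_mult_id_right [simp]: "mat_mult a mat_id = a"
  by (intro ext) (simp add: mat_id_eq)

lemma mat_mult_id_left [simp]: "mat_mult mat_id a = a"
  by (intro ext) (simp add: mat_id_eq)

lemma mat_adj_id [simp]: "mat_adj mat_id = mat_id"
  by (intro ext) (auto simp add: mat_id_def mat_adj_def)

lemma mat_adj_adj [simp]: "mat_adj (mat_adj a) = a"
  by (simp add: mat_adj_def)

lemma mat_mult_unit_left: "mat_mult (mat_unit p q) a x y = (if x = p then a q y else 0)"
  unfolding mat_mult_def by (subst infsum_single[of q]) (auto simp: mat_unit_def)

lemma mat_mult_unit_right: "mat_mult a (mat_unit p q) x y = (if y = q then a x p else 0)"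
  unfolding mat_mult_def by (subst infsum_single[of p]) (auto simp: mat_unit_def)

lemma mat_adj_unit [simp]: "mat_adj (mat_unit p q) = mat_unit q p"
  by (intro ext) (auto simp: mat_adj_def mat_unit_def)

lemma mat_mult_add_right:
  assumes "bdd_op a" "bdd_op b" "bdd_op c"
  shows "mat_mult a (mat_add b c) = mat_add (mat_mult a b) (mat_mult a c)"
  unfolding mat_mult_def mat_add_def distrib_left
  by (intro ext infsum_add mat_mult_summable assms)

lemma mat_mult_add_left:
  assumes "bdd_op a" "bdd_op b" "bdd_op c"
  shows "mat_mult (mat_add a b) c = mat_add (mat_mult a c) (mat_mult b c)"
  unfolding mat_mult_def mat_add_def distrib_right
  by (intro ext infsum_add mat_mult_summable assms)

lemma mat_mult_scale_right: "mat_mult a (mat_scale c b) = mat_scale c (mat_mult a b)"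
  unfolding mat_mult_def mat_scale_def
  by (intro ext) (simp add: mult.left_commute[of _ c] infsum_cmult_right')

lemma mat_mult_scale_left: "mat_mult (mat_scale c a) b = mat_scale c (mat_mult a b)"
  unfolding mat_mult_def mat_scale_def
  by (intro ext) (simp add: mult.assoc infsum_cmult_right')

lemma mat_mult_diff_right:
  assumes "bdd_op a" "bdd_op b" "bdd_op c"
  shows "mat_mult a (mat_diff b c) = mat_diff (mat_mult a b) (mat_mult a c)"
  using assms by (simp add: mat_diff_eq_add mat_mult_add_right mat_mult_scale_right)

lemma mat_mult_diff_left:
  assumes "bdd_op a" "bdd_op b" "bdd_op c"
  shows "mat_mult (mat_diff a b) c = mat_diff (mat_mult a c) (mat_mult b c)"
  using assms by (simp add: mat_diff_eq_add mat_mult_add_left mat_mult_scale_left)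

lemma mat_adj_mult: "mat_adj (mat_mult a b) = mat_mult (mat_adj b) (mat_adj a)"
  unfolding mat_mult_def mat_adj_def by (intro ext) (simp flip: infsum_cnj add: mult.commute)

lemma mat_adj_diff: "mat_adj (mat_diff a b) = mat_diff (mat_adj a) (mat_adj b)"
  by (simp add: mat_adj_def mat_diff_def)

section \<open>Approximability by matrices of finite propagation\<close>

definition prop_le :: "real \<Rightarrow> ('a::metric_space) mat \<Rightarrow> bool" where
  "prop_le R a \<longleftrightarrow> (\<forall>x y. R < dist x y \<longrightarrow> a x y = 0)"

text \<open>The radius is kept explicit so that uniformity in it can be expressed; the non-strict
  bound lets the condition survive entrywise limits.\<close>

definition approx_le :: "real \<Rightarrow> real \<Rightarrow> ('a::metric_space) mat \<Rightarrow> bool" where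
  "approx_le \<epsilon> R a \<longleftrightarrow> (\<exists>b. prop_le R b \<and> norm_le \<epsilon> (mat_diff a b))"

lemma prop_leD: "prop_le R a \<Longrightarrow> R < dist x y \<Longrightarrow> a x y = 0"
  by (simp add: prop_le_def)

lemma bdd_op_if_norm_le_diff:
  assumes "bdd_op a" "norm_le C (mat_diff a b)"
  shows "bdd_op b"
proof -
  have "bdd_op (mat_diff a (mat_diff a b))" by (rule bdd_op_diff[OF assms(1) bdd_opI[OF assms(2)]])
  moreover have "mat_diff a (mat_diff a b) = b" by (simp add: mat_diff_def)
  ultimately show ?thesis by simp
qed

text \<open>Trades the supremum in \<open>op_norm\<close> for \<open>norm_le\<close>; halving the
  tolerance recovers the strict inequality of the definition.\<close>

lemma Cu_iff: "a \<in> Cu \<longleftrightarrow> bdd_op a \<and> (\<forall>\<epsilon>>0. \<exists>R. approx_le \<epsilon> R a)"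
proof (intro iffI conjI allI impI)
  assume a: "a \<in> Cu"
  then show "bdd_op a" by (simp add: Cu_def)
  fix \<epsilon> :: real assume "0 < \<epsilon>"
  then obtain b where b: "bdd_op b" "finite_prop b" "op_norm (mat_diff a b) < \<epsilon>"
    using a unfolding Cu_def by blast
  then obtain R where "prop_le R b" unfolding finite_prop_def prop_le_def by blast
  moreover have "norm_le \<epsilon> (mat_diff a b)"
    using b \<open>bdd_op a\<close> norm_le_op_norm[of "mat_diff a b"] norm_le_mono less_imp_le by (metis bdd_op_diff)
  ultimately show "\<exists>R. approx_le \<epsilon> R a" unfolding approx_le_def by blast
next
  assume a: "bdd_op a \<and> (\<forall>\<epsilon>>0. \<exists>R. approx_le \<epsilon> R a)"
  have "\<exists>b. bdd_op b \<and> finite_prop b \<and> op_norm (mat_diff a b) < \<epsilon>" if "0 < \<epsilon>" for \<epsilon>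
  proof -
    from that have "0 < \<epsilon>/2" by simp
    then obtain R b where b: "prop_le R b" "norm_le (\<epsilon>/2) (mat_diff a b)"
      using a unfolding approx_le_def by blast
    have "op_norm (mat_diff a b) < \<epsilon>" using op_norm_le[OF b(2)] that by simp
    moreover have "bdd_op b" using a b(2) bdd_op_if_norm_le_diff by blast
    ultimately show ?thesis using b(1) unfolding finite_prop_def prop_le_def by blast
  qed
  then show "a \<in> Cu" using a by (simp add: Cu_def)
qed

lemma Cu_bdd_op: "a \<in> Cu \<Longrightarrow> bdd_op a" by (simp add: Cu_iff)

lemma approx_le_mono: "approx_le \<epsilon> R a \<Longrightarrow> \<epsilon> \<le> \<epsilon>' \<Longrightarrow> R \<le> R' \<Longrightarrow> approx_le \<epsilon>' R' a"
  unfolding approx_le_def prop_le_def by (meson norm_le_mono less_le_trans order_le_less_trans)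

lemma approx_le_add:
  assumes "approx_le \<epsilon> R a" "approx_le \<delta> R b"
  shows "approx_le (\<epsilon> + \<delta>) R (mat_add a b)"
proof -
  obtain a' b' where *: "prop_le R a'" "norm_le \<epsilon> (mat_diff a a')" "prop_le R b'" "norm_le \<delta> (mat_diff b b')"
    using assms unfolding approx_le_def by blast
  have "mat_diff (mat_add a b) (mat_add a' b') = mat_add (mat_diff a a') (mat_diff b b')"
    by (simp add: mat_diff_def mat_add_def algebra_simps)
  moreover have "prop_le R (mat_add a' b')" using * by (simp add: prop_le_def mat_add_def)
  ultimately show ?thesis using norm_le_add[OF *(2,4)] unfolding approx_le_def by metis
qed

lemma approx_le_scale:
  assumes "approx_le \<epsilon> R a"
  shows "approx_le (cmod c * \<epsilon>) R (mat_scale c a)"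
proof -
  obtain a' where *: "prop_le R a'" "norm_le \<epsilon> (mat_diff a a')"
    using assms unfolding approx_le_def by blast
  have "mat_diff (mat_scale c a) (mat_scale c a') = mat_scale c (mat_diff a a')"
    by (simp add: mat_diff_def mat_scale_def algebra_simps)
  moreover have "prop_le R (mat_scale c a')" using * by (simp add: prop_le_def mat_scale_def)
  ultimately show ?thesis using norm_le_scale[OF *(2)] unfolding approx_le_def by metis
qed

lemma approx_le_zero: "approx_le 0 R (\<lambda>x y. 0)"
  unfolding approx_le_def by (rule exI[of _ "\<lambda>x y. 0"]) (simp add: prop_le_def mat_diff_def)

lemma approx_le_sum:
  assumes "\<And>i. i \<in> I \<Longrightarrow> approx_le (e i) R (a i)"
  shows "approx_le (\<Sum>i\<in>I. e i) R (\<lambda>x y. \<Sum>i\<in>I. a i x y)"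
  using assms
proof (induction I rule: infinite_finite_induct)
  case (insert i I)
  then show ?case using approx_le_add[of "e i" R "a i" "sum e I" "\<lambda>x y. \<Sum>i\<in>I. a i x y"]
    by (simp add: mat_add_def)
qed (auto simp: approx_le_zero)

lemma approx_le_adj: 
  assumes "approx_le \<epsilon> R a"
  shows "approx_le \<epsilon> R (mat_adj a)"
proof -
  obtain a' where *: "prop_le R a'" "norm_le \<epsilon> (mat_diff a a')"
    using assms unfolding approx_le_def by blast
  have "norm_le \<epsilon> (mat_diff (mat_adj a) (mat_adj a'))" using *(2) by (simp flip: mat_adj_diff)
  moreover have "prop_le R (mat_adj a')" using *(1) by (simp add: prop_le_def mat_adj_def dist_commute)
  ultimately show ?thesis unfolding approx_le_def by blast
qed

lemma approx_le_mult_diag: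
  assumes "approx_le \<epsilon> R a" "norm_le K (diag_mat d)"
  shows "approx_le (\<epsilon> * K) R (mat_mult a (diag_mat d))"
proof -
  obtain a' where *: "prop_le R a'" "norm_le \<epsilon> (mat_diff a a')"
    using assms unfolding approx_le_def by blast
  have "mat_diff (mat_mult a (diag_mat d)) (mat_mult a' (diag_mat d)) = mat_mult (mat_diff a a') (diag_mat d)"
    by (intro ext) (simp add: mat_diff_def algebra_simps)
  moreover have "prop_le R (mat_mult a' (diag_mat d))" using *(1) by (simp add: prop_le_def)
  ultimately show ?thesis using norm_le_mult[OF *(2) assms(2)] unfolding approx_le_def by metis
qed

text \<open>Converts norm approximation into geometry: far from the diagonal the approximant
  vanishes, so the whole entry counts as error. The distance estimates for \<open>f\<close> and
  \<open>g\<close> rest on this.\<close>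

lemma approx_le_entry:
  assumes "approx_le \<epsilon> R a" "\<epsilon> < cmod (a x y)"
  shows "dist x y \<le> R"
proof (rule ccontr)
  obtain a' where *: "prop_le R a'" "norm_le \<epsilon> (mat_diff a a')"
    using assms unfolding approx_le_def by blast
  assume "\<not> dist x y \<le> R"
  then have "a' x y = 0" using *(1) by (simp add: prop_le_def)
  then show False using norm_le_entry[OF *(2), of x y] assms(2) by (simp add: mat_diff_def)
qed

lemma prop_le_mult:
  assumes "prop_le R a" "prop_le S b"
  shows "prop_le (R + S) (mat_mult a b)"
  unfolding prop_le_def
proof (intro allI impI)
  fix x y :: 'a assume d: "R + S < dist x y"
  have "a x z * b z y = 0" for z
    using dist_triangle[of x y z] d prop_leD[OF assms(1), of x z] prop_leD[OF assms(2), of z y]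
    by (cases "R < dist x z") auto
  then show "mat_mult a b x y = 0" unfolding mat_mult_def by (simp only: infsum_0_simp)
qed

section \<open>The uniform Roe algebra is closed under the algebraic operations\<close>

lemma Cu_add: "a \<in> Cu \<Longrightarrow> b \<in> Cu \<Longrightarrow> mat_add a b \<in> Cu"
  unfolding Cu_iff
proof (intro conjI allI impI)
  assume a: "bdd_op a \<and> (\<forall>\<epsilon>>0. \<exists>R. approx_le \<epsilon> R a)" and b: "bdd_op b \<and> (\<forall>\<epsilon>>0. \<exists>R. approx_le \<epsilon> R b)"
  then show "bdd_op (mat_add a b)" by simp
  fix \<epsilon> :: real assume "0 < \<epsilon>"
  then obtain R S where "approx_le (\<epsilon>/2) R a" "approx_le (\<epsilon>/2) S b" using a b half_gt_zero by meson
  then have "approx_le (\<epsilon>/2) (max R S) a" "approx_le (\<epsilon>/2) (max R S) b" by (auto elim: approx_le_mono)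
  from approx_le_add[OF this] show "\<exists>R. approx_le \<epsilon> R (mat_add a b)" by auto
qed

lemma Cu_scale: "a \<in> Cu \<Longrightarrow> mat_scale c a \<in> Cu"
  unfolding Cu_iff
proof (intro conjI allI impI)
  assume a: "bdd_op a \<and> (\<forall>\<epsilon>>0. \<exists>R. approx_le \<epsilon> R a)"
  then show "bdd_op (mat_scale c a)" by simp
  fix \<epsilon> :: real assume "0 < \<epsilon>"
  moreover have pos: "0 < cmod c + 1" by (simp add: add_nonneg_pos)
  ultimately obtain R where "approx_le (\<epsilon>/(cmod c + 1)) R a" using a by (meson divide_pos_pos)
  from approx_le_scale[OF this, of c] have "approx_le (cmod c * (\<epsilon>/(cmod c + 1))) R (mat_scale c a)" .
  then have "approx_le \<epsilon> R (mat_scale c a)"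
    by (rule approx_le_mono) (use pos \<open>0 < \<epsilon>\<close> in \<open>auto simp: field_simps\<close>)
  then show "\<exists>R. approx_le \<epsilon> R (mat_scale c a)" ..
qed

lemma Cu_adj: "a \<in> Cu \<Longrightarrow> mat_adj a \<in> Cu"
  unfolding Cu_iff by (auto dest: approx_le_adj)

lemma Cu_if_prop_le: "bdd_op a \<Longrightarrow> prop_le R a \<Longrightarrow> a \<in> Cu"
  unfolding Cu_iff approx_le_def
  by (auto intro!: exI[of _ R] exI[of _ a] norm_le_mono[OF norm_le_zero] simp: mat_diff_def)

lemma Cu_mult:
  assumes a: "a \<in> Cu" and b: "b \<in> Cu"
  shows "mat_mult a b \<in> Cu"
  unfolding Cu_iff
proof (intro conjI allI impI)
  have ba: "bdd_op a" and bb: "bdd_op b" using a b by (simp_all add: Cu_iff)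
  then show "bdd_op (mat_mult a b)" by simp
  fix \<epsilon> :: real assume e: "0 < \<epsilon>"
  obtain B where B: "norm_le B b" by (rule bdd_opE[OF bb])
  have B0: "0 \<le> B" using norm_le_nonneg[OF B] .
  obtain R a' where a': "prop_le R a'" "norm_le (\<epsilon> / (2 * (B + 1))) (mat_diff a a')"
    using a e B0 unfolding Cu_iff approx_le_def by (metis add_nonneg_pos divide_pos_pos mult_pos_pos zero_less_numeral zero_less_one)
  have ba': "bdd_op a'" using bdd_op_if_norm_le_diff[OF ba a'(2)] .
  then obtain A where A: "norm_le A a'" by (rule bdd_opE)
  have A0: "0 \<le> A" using norm_le_nonneg[OF A] .
  \<comment> \<open>The tolerance for \<open>b\<close> is fixed only after \<open>a'\<close>,
    because the norm of \<open>a'\<close> enters the second error term \<open>a' (b - b')\<close>.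
    The added 1 keeps the denominator positive.\<close>
  obtain S b' where b': "prop_le S b'" "norm_le (\<epsilon> / (2 * (A + 1))) (mat_diff b b')"
    using b e A0 unfolding Cu_iff approx_le_def by (metis add_nonneg_pos divide_pos_pos mult_pos_pos zero_less_numeral zero_less_one)
  have bb': "bdd_op b'" using bdd_op_if_norm_le_diff[OF bb b'(2)] .
  have eq: "mat_diff (mat_mult a b) (mat_mult a' b') =
      mat_add (mat_mult (mat_diff a a') b) (mat_mult a' (mat_diff b b'))"
    using ba bb ba' bb' by (simp add: mat_mult_diff_left mat_mult_diff_right) (simp add: mat_add_def mat_diff_def)
  have "norm_le (\<epsilon> / (2 * (B + 1)) * B + A * (\<epsilon> / (2 * (A + 1)))) (mat_diff (mat_mult a b) (mat_mult a' b'))"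
    unfolding eq by (intro norm_le_add norm_le_mult a' b' A B)
  moreover have "\<epsilon> / (2 * (B + 1)) * B \<le> \<epsilon>/2" "A * (\<epsilon> / (2 * (A + 1))) \<le> \<epsilon>/2"
    using e A0 B0 by (auto simp: field_simps)
  ultimately have "norm_le \<epsilon> (mat_diff (mat_mult a b) (mat_mult a' b'))"
    by (elim norm_le_mono) linarith
  then show "\<exists>R. approx_le \<epsilon> R (mat_mult a b)"
    using prop_le_mult[OF a'(1) b'(1)] unfolding approx_le_def by blast
qed

lemma Cu_id: "mat_id \<in> Cu"
  by (rule Cu_if_prop_le[of _ 0], simp) (auto simp: prop_le_def mat_id_def)

lemma Cu_zero: "(\<lambda>x y. 0) \<in> Cu"
  by (rule Cu_if_prop_le[of _ 0]) (auto simp: prop_le_def bdd_op_iff intro: norm_le_zero)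

lemma Cu_sum:
  assumes "\<And>i. i \<in> I \<Longrightarrow> a i \<in> Cu"
  shows "(\<lambda>x y. \<Sum>i\<in>I. a i x y) \<in> Cu"
  using assms
proof (induction I rule: infinite_finite_induct)
  case (insert i I)
  then show ?case using Cu_add[of "a i" "\<lambda>x y. \<Sum>i\<in>I. a i x y"]
    by (simp add: mat_add_def)
qed (auto simp: Cu_zero)

lemma norm_le_mat_unit: "norm_le 1 (mat_unit p q)"
proof -
  have 1: "{y. mat_unit p q x y \<noteq> 0} \<subseteq> {q}" "{y. mat_unit p q y x \<noteq> 0} \<subseteq> {p}" for x
    by (auto simp: mat_unit_def split: if_splits)
  have "norm_le (1 * of_nat 1) (mat_unit p q)"
  proof (rule norm_le_Schur)
    show "finite {y. mat_unit p q x y \<noteq> 0} \<and> card {y. mat_unit p q x y \<noteq> 0} \<le> 1" for x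
      using card_mono[OF _ 1(1), of x] finite_subset[OF 1(1), of x] by simp
    show "finite {y. mat_unit p q y x \<noteq> 0} \<and> card {y. mat_unit p q y x \<noteq> 0} \<le> 1" for x
      using card_mono[OF _ 1(2), of x] finite_subset[OF 1(2), of x] by simp
  qed (auto simp: mat_unit_def)
  then show ?thesis by simp
qed

lemma Cu_mat_unit: "mat_unit p q \<in> Cu"
proof (rule Cu_if_prop_le)
  show "bdd_op (mat_unit p q)" by (rule bdd_opI[OF norm_le_mat_unit])
  show "prop_le (dist p q) (mat_unit p q)" by (auto simp: prop_le_def mat_unit_def)
qed

section \<open>Unitaries normalizing the uniform Roe algebra\<close>

definition unitary_op :: "'a mat \<Rightarrow> bool" where
  "unitary_op U \<longleftrightarrow> bdd_op U \<and> mat_mult U (mat_adj U) = mat_id \<and> mat_mult (mat_adj U) U = mat_id"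

definition conj_by :: "'a mat \<Rightarrow> 'a mat \<Rightarrow> 'a mat" where
  "conj_by U a = mat_mult (mat_mult U a) (mat_adj U)"

text \<open>The condition on \<open>mat_adj U\<close> makes conjugation map the algebra onto itself.
  The notion is then symmetric, so whatever is shown for \<open>f\<close> and \<open>U\<close> also
  holds for \<open>g\<close> and the adjoint.\<close>

definition normalizes_Cu :: "('a::metric_space) mat \<Rightarrow> bool" where
  "normalizes_Cu U \<longleftrightarrow> unitary_op U \<and> (\<forall>a\<in>Cu. conj_by U a \<in> Cu) \<and> (\<forall>a\<in>Cu. conj_by (mat_adj U) a \<in> Cu)"

lemma unitary_op_bdd: "unitary_op U \<Longrightarrow> bdd_op U"
  by (simp add: unitary_op_def)

lemma unitary_op_adj: "unitary_op U \<Longrightarrow> unitary_op (mat_adj U)"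
  by (simp add: unitary_op_def)

lemma normalizes_Cu_adj: "normalizes_Cu U \<Longrightarrow> normalizes_Cu (mat_adj U)"
  by (simp add: normalizes_Cu_def unitary_op_adj)

lemma normalizes_Cu_bdd: "normalizes_Cu U \<Longrightarrow> bdd_op U"
  by (simp add: normalizes_Cu_def unitary_op_def)

lemma bdd_op_conj_by [simp]: "bdd_op U \<Longrightarrow> bdd_op a \<Longrightarrow> bdd_op (conj_by U a)"
  by (simp add: conj_by_def)

lemma conj_by_add:
  "bdd_op U \<Longrightarrow> bdd_op a \<Longrightarrow> bdd_op b \<Longrightarrow> conj_by U (mat_add a b) = mat_add (conj_by U a) (conj_by U b)"
  by (simp add: conj_by_def mat_mult_add_left mat_mult_add_right)

lemma conj_by_scale: "conj_by U (mat_scale c a) = mat_scale c (conj_by U a)"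
  by (simp add: conj_by_def mat_mult_scale_left mat_mult_scale_right)

lemma conj_by_adj: "bdd_op U \<Longrightarrow> bdd_op a \<Longrightarrow> conj_by U (mat_adj a) = mat_adj (conj_by U a)"
  by (simp add: conj_by_def mat_adj_mult mat_mult_assoc)

lemma conj_by_conj_by:
  "bdd_op U \<Longrightarrow> bdd_op V \<Longrightarrow> bdd_op a \<Longrightarrow> conj_by U (conj_by V a) = conj_by (mat_mult U V) a"
  by (simp add: conj_by_def mat_adj_mult mat_mult_assoc)

lemma conj_by_id [simp]: "conj_by mat_id a = a"
  by (simp add: conj_by_def)

lemma unitary_op_cancel:
  assumes "unitary_op U" "bdd_op a"
  shows "mat_mult (mat_adj U) (mat_mult U a) = a" "mat_mult U (mat_mult (mat_adj U) a) = a"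
  using assms mat_mult_assoc[of "mat_adj U" U a] mat_mult_assoc[of U "mat_adj U" a]
  by (simp_all add: unitary_op_def)

lemma conj_by_mult:
  assumes "unitary_op U" "bdd_op a" "bdd_op b"
  shows "conj_by U (mat_mult a b) = mat_mult (conj_by U a) (conj_by U b)"
  using assms unitary_op_bdd[OF assms(1)]
  by (simp add: conj_by_def mat_mult_assoc unitary_op_cancel)

lemma conj_by_sum:
  assumes "bdd_op U" "\<And>i. i \<in> I \<Longrightarrow> bdd_op (a i)"
  shows "conj_by U (\<lambda>x y. \<Sum>i\<in>I. a i x y) = (\<lambda>x y. \<Sum>i\<in>I. conj_by U (a i) x y)
     \<and> bdd_op (\<lambda>x y. \<Sum>i\<in>I. a i x y)"
  using assms(2)
proof (induction I rule: infinite_finite_induct)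
  case (insert i I)
  have eq: "(\<lambda>x y. \<Sum>i\<in>insert i I. a i x y) = mat_add (a i) (\<lambda>x y. \<Sum>i\<in>I. a i x y)"
    using insert by (simp add: mat_add_def)
  show ?case unfolding eq using insert assms(1)
    by (simp add: conj_by_add) (simp add: mat_add_def)
qed (auto simp: conj_by_def mat_mult_def intro: bdd_opI[OF norm_le_zero])

lemma conj_by_mat_unit: "conj_by U (mat_unit p q) x y = U x p * cnj (U y q)"
  unfolding conj_by_def
  by (subst mat_mult_def, subst infsum_single[of q]) (auto simp: mat_mult_unit_right mat_adj_def)

lemma conj_by_diag_finite:
  assumes "finite F"
  shows "conj_by U (diag_mat (\<lambda>z. if z \<in> F then d z else 0)) x y = (\<Sum>z\<in>F. U x z * d z * cnj (U y z))"
proof -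
  have "((\<lambda>z. U x z * (if z \<in> F then d z else 0) * cnj (U y z)) has_sum (\<Sum>z\<in>F. U x z * d z * cnj (U y z))) UNIV"
    using has_sum_finite_neutralI[of F UNIV "\<lambda>z. U x z * (if z \<in> F then d z else 0) * cnj (U y z)"] assms by auto
  then show ?thesis unfolding conj_by_def by (subst mat_mult_def) (simp add: mat_adj_def has_sum_iff)
qed

lemma adj_mult_self_diag:
  assumes "bdd_op a"
  shows "((\<lambda>z. (cmod (a z x))\<^sup>2) has_sum Re (mat_mult (mat_adj a) a x x)) UNIV"
proof -
  have "((\<lambda>z. cnj (a z x) * a z x) has_sum mat_mult (mat_adj a) a x x) UNIV"
    using has_sum_infsum[OF mat_mult_summable[of "mat_adj a" a x x]] assms
    unfolding mat_mult_def mat_adj_def[of a] by (simp flip: mat_adj_def[of a])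
  from has_sum_Re[OF this] show ?thesis by (simp add: mult.commute[of "cnj _"] flip: complex_norm_square)
qed

text \<open>Boundedness is a conclusion here because the unitary implementing an automorphism is
  built column by column. For orthonormal columns, the squared norm of a finite combination expands
  to the sum of the squared moduli of its coefficients.\<close>

lemma norm_le_isometry:
  assumes "\<And>x x'. ((\<lambda>y. cnj (U y x) * U y x') has_sum (if x = x' then 1 else 0)) UNIV"
  shows "norm_le 1 U"
  unfolding norm_le_def
proof (intro allI impI)
  fix F G :: "'a set" and v w :: "'a \<Rightarrow> complex" assume fin: "finite F" "finite G"
  let ?W = "L2_set (\<lambda>x. cmod (w x)) F" and ?V = "L2_set (\<lambda>y. cmod (v y)) G"
  define u where "u y = (\<Sum>x\<in>G. U y x * v x)" for y
  have "((\<lambda>y. \<Sum>x\<in>G. \<Sum>x'\<in>G. (cnj (v x) * v x') * (cnj (U y x) * U y x')) has_sum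
      (\<Sum>x\<in>G. \<Sum>x'\<in>G. (cnj (v x) * v x') * (if x = x' then 1 else 0))) UNIV"
    by (intro has_sum_finite_sum has_sum_cmult_right assms)
  also have "(\<lambda>y. \<Sum>x\<in>G. \<Sum>x'\<in>G. (cnj (v x) * v x') * (cnj (U y x) * U y x')) = (\<lambda>y. u y * cnj (u y))"
  proof
    fix y
    have "cnj (u y) * u y = (\<Sum>x\<in>G. \<Sum>x'\<in>G. cnj (U y x * v x) * (U y x' * v x'))"
      unfolding u_def cnj_sum sum_product ..
    then show "(\<Sum>x\<in>G. \<Sum>x'\<in>G. (cnj (v x) * v x') * (cnj (U y x) * U y x')) = u y * cnj (u y)"
      by (simp only: complex_cnj_mult mult_ac)
  qed
  also have "(\<Sum>x\<in>G. \<Sum>x'\<in>G. (cnj (v x) * v x') * (if x = x' then 1 else 0)) = (\<Sum>x\<in>G. v x * cnj (v x))"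
    using fin by (intro sum.cong) (simp_all add: mult.commute if_distrib cong: if_cong)
  also have "\<dots> = of_real (?V\<^sup>2)" by (simp only: sum_mult_cnj L2_set_power2)
  finally have "((\<lambda>y. u y * cnj (u y)) has_sum of_real (?V\<^sup>2)) UNIV" .
  from has_sum_Re[OF this] have hs: "((\<lambda>y. (cmod (u y))\<^sup>2) has_sum ?V\<^sup>2) UNIV"
    by (simp flip: complex_norm_square)
  have "(L2_set (\<lambda>y. cmod (u y)) F)\<^sup>2 \<le> ?V\<^sup>2"
    unfolding L2_set_power2[of _ F] by (rule finite_sum_le_has_sum[OF hs]) (use fin in auto)
  then have le: "L2_set (\<lambda>y. cmod (u y)) F \<le> ?V" by (rule power2_le_imp_le) simp
  have "(\<Sum>x\<in>F. \<Sum>y\<in>G. w x * U x y * v y) = (\<Sum>x\<in>F. w x * u x)"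
    by (simp add: u_def sum_distrib_left mult.assoc)
  also have "cmod \<dots> \<le> ?W * L2_set (\<lambda>y. cmod (u y)) F" by (rule cmod_sum_mult_le)
  also have "\<dots> \<le> ?W * ?V" by (intro mult_left_mono le) simp
  finally show "cmod (\<Sum>x\<in>F. \<Sum>y\<in>G. w x * U x y * v y) \<le> 1 * ?W * ?V" by simp
qed

lemma unitary_op_columns:
  assumes "unitary_op U"
  shows "((\<lambda>y. cnj (U y x) * U y x') has_sum (if x = x' then 1 else 0)) UNIV"
proof -
  have "((\<lambda>y. cnj (U y x) * U y x') has_sum mat_mult (mat_adj U) U x x') UNIV"
    using has_sum_infsum[OF mat_mult_summable[of "mat_adj U" U x x']] unitary_op_bdd[OF assms]
    unfolding mat_mult_def mat_adj_def[of U] by (simp flip: mat_adj_def[of U])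
  then show ?thesis using assms by (simp add: unitary_op_def mat_id_def)
qed

lemma unitary_op_norm_le: "unitary_op U \<Longrightarrow> norm_le 1 U"
  by (intro norm_le_isometry unitary_op_columns)

lemma unitary_op_column_norm:
  assumes "unitary_op U"
  shows "((\<lambda>y. (cmod (U y x))\<^sup>2) has_sum 1) UNIV"
  using adj_mult_self_diag[OF unitary_op_bdd[OF assms], of x] assms by (simp add: unitary_op_def mat_id_def)

section \<open>The topology of entrywise convergence\<close>

lemma compact_PiE_UNIV:
  fixes S :: "'i \<Rightarrow> 'b::topological_space set"
  assumes "\<And>i. compact (S i)"
  shows "compact (PiE UNIV S)"
  using compactin_PiE[of "\<lambda>_. euclidean" UNIV S] assms
  by (simp add: euclidean_product_topology)

lemma Hausdorff_space_mat: "Hausdorff_space (euclidean :: ('a mat) topology)"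
proof -
  have "Hausdorff_space (euclidean :: ('a \<Rightarrow> complex) topology)"
    unfolding euclidean_product_topology[symmetric] Hausdorff_space_product_topology by simp
  then show ?thesis
    by (subst euclidean_product_topology[symmetric]) (simp add: Hausdorff_space_product_topology)
qed

lemma compact_imp_closed_mat:
  fixes S :: "'a mat set"
  assumes "compact S"
  shows "closed S"
  using compactin_imp_closedin[OF Hausdorff_space_mat, of S] assms by simp

lemma tendsto_fun:
  fixes f :: "'b \<Rightarrow> 'i \<Rightarrow> 'd::topological_space"
  assumes "\<And>x. ((\<lambda>i. f i x) \<longlongrightarrow> l x) F"
  shows "(f \<longlongrightarrow> l) F"
  using limitin_componentwise[of "\<lambda>_. euclidean" UNIV f l F] assms
  by (simp add: euclidean_product_topology)

lemma tendsto_mat: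
  fixes f :: "'b \<Rightarrow> 'a mat"
  assumes "\<And>x y. ((\<lambda>i. f i x y) \<longlongrightarrow> a x y) F"
  shows "(f \<longlongrightarrow> a) F"
  by (rule tendsto_fun, rule tendsto_fun, rule assms)

lemma continuous_on_entry [continuous_intros]: "continuous_on S (\<lambda>m :: 'a mat. m x y)"
  by (rule continuous_on_product_then_coordinatewise, rule continuous_on_product_then_coordinatewise,
      rule continuous_on_id)

lemma open_fun_contains_basis:
  fixes W :: "('i \<Rightarrow> 'd::topological_space) set"
  assumes "open W" "f \<in> W"
  shows "\<exists>X. f \<in> PiE UNIV X \<and> (\<forall>i. open (X i)) \<and> finite {i. X i \<noteq> UNIV} \<and> PiE UNIV X \<subseteq> W"
  using product_topology_open_contains_basis[of "\<lambda>_. euclidean" UNIV W f] assms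
  by (simp add: euclidean_product_topology)

text \<open>A matrix is a function into functions, so the product basis is used twice: for finitely
  many rows, and for finitely many columns in each of them. \<open>F\<close> collects all these
  indices, so one square controls everything.\<close>

lemma open_mat_contains_cylinder:
  fixes V :: "'a mat set"
  assumes "open V" "m0 \<in> V"
  obtains F where "finite F" "\<And>m. (\<And>x y. x \<in> F \<Longrightarrow> y \<in> F \<Longrightarrow> m x y = m0 x y) \<Longrightarrow> m \<in> V"
proof -
  note base = open_fun_contains_basis
  obtain X where X: "m0 \<in> PiE UNIV X" "\<And>i. open (X i)" "finite {i. X i \<noteq> UNIV}" "PiE UNIV X \<subseteq> V"
    using base[OF assms] by blast
  have "\<exists>G. finite G \<and> (\<forall>f. (\<forall>y\<in>G. f y = m0 i y) \<longrightarrow> f \<in> X i)" for i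
  proof -
    have "m0 i \<in> X i" using X(1) by auto
    from base[OF X(2) this] obtain Y where Y: "m0 i \<in> PiE UNIV Y" "finite {j. Y j \<noteq> UNIV}" "PiE UNIV Y \<subseteq> X i"
      by blast
    have "f \<in> X i" if "\<forall>y\<in>{j. Y j \<noteq> UNIV}. f y = m0 i y" for f
    proof -
      have "f j \<in> Y j" for j using Y(1) that by (cases "Y j = UNIV") (auto simp: PiE_iff)
      then show ?thesis using Y(3) by (auto simp: PiE_iff)
    qed
    then show ?thesis using Y(2) by blast
  qed
  then obtain G where G: "\<And>i. finite (G i)" "\<And>i f. (\<forall>y\<in>G i. f y = m0 i y) \<Longrightarrow> f \<in> X i" by metis
  let ?I = "{i. X i \<noteq> UNIV}"
  show ?thesis
  proof (rule that)
    show "finite (?I \<union> (\<Union>i\<in>?I. G i))" using X(3) G(1) by auto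
    fix m assume m: "\<And>x y. x \<in> ?I \<union> (\<Union>i\<in>?I. G i) \<Longrightarrow> y \<in> ?I \<union> (\<Union>i\<in>?I. G i) \<Longrightarrow> m x y = m0 x y"
    have "m i \<in> X i" for i
    proof (cases "X i = UNIV")
      case False
      then show ?thesis by (intro G(2) ballI m) auto
    qed auto
    then show "m \<in> V" using X(4) by (auto simp: PiE_iff)
  qed
qed

definition entry_box :: "real \<Rightarrow> 'a mat set" where
  "entry_box C = {m. \<forall>x y. cmod (m x y) \<le> C}"

lemma compact_entry_box: "compact (entry_box C :: 'a mat set)"
proof -
  have "(entry_box C :: 'a mat set) = PiE UNIV (\<lambda>_. PiE UNIV (\<lambda>_. cball 0 C))"
    by (auto simp: entry_box_def PiE_iff)
  moreover have "compact (PiE UNIV (\<lambda>_::'a. PiE UNIV (\<lambda>_::'a. cball (0::complex) C)))"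
    by (intro compact_PiE_UNIV compact_cball)
  ultimately show ?thesis by simp
qed

lemma closed_norm_le: "closed {a :: 'a mat. norm_le C a}"
  unfolding norm_le_def
  by (intro closed_Collect_all closed_Collect_imp open_Collect_const closed_Collect_le continuous_intros)

lemma closed_prop_le: "closed {a. prop_le R a}"
  unfolding prop_le_def
  by (intro closed_Collect_all closed_Collect_imp open_Collect_const closed_Collect_eq continuous_intros)

text \<open>The approximant is existentially quantified, so closedness has to come from compactness.
  When the entries of \<open>a\<close> are bounded by \<open>C\<close>, those of the approximant are
  bounded by \<open>C + \<epsilon>\<close>; the set is thus cut out of the image, under addition, of
  a product of two compact sets.\<close>

lemma closed_approx_le: "closed (entry_box C \<inter> {a :: ('a::metric_space) mat. approx_le \<epsilon> R a})"
proof -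
  define A :: "'a mat set" where "A = entry_box (C + \<epsilon>) \<inter> {a. prop_le R a}"
  define B :: "'a mat set" where "B = entry_box \<epsilon> \<inter> {a. norm_le \<epsilon> a}"
  have "compact (A \<times> B)" unfolding A_def B_def
    by (intro compact_Times compact_Int_closed compact_entry_box closed_norm_le closed_prop_le)
  moreover have "continuous_on (A \<times> B) (\<lambda>p. \<lambda>x y. fst p x y + snd p x y)"
    by (rule continuous_on_coordinatewise_then_product, rule continuous_on_coordinatewise_then_product)
       (rule continuous_on_add; rule continuous_on_product_then_coordinatewise,
        rule continuous_on_product_then_coordinatewise, rule continuous_on_fst continuous_on_snd, rule continuous_on_id)
  ultimately have "compact ((\<lambda>p. \<lambda>x y. fst p x y + snd p x y) ` (A \<times> B))"
    by (rule compact_continuous_image[rotated])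
  then have "closed (entry_box C \<inter> (\<lambda>p. \<lambda>x y. fst p x y + snd p x y) ` (A \<times> B))"
    by (intro closed_Int compact_imp_closed_mat compact_entry_box)
  also have "entry_box C \<inter> (\<lambda>p. \<lambda>x y. fst p x y + snd p x y) ` (A \<times> B) = entry_box C \<inter> {a. approx_le \<epsilon> R a}"
  proof (intro equalityI subsetI)
    fix a assume "a \<in> entry_box C \<inter> (\<lambda>p. \<lambda>x y. fst p x y + snd p x y) ` (A \<times> B)"
    then obtain b d where "a \<in> entry_box C" "b \<in> A" "d \<in> B" "a = (\<lambda>x y. b x y + d x y)" by auto
    then show "a \<in> entry_box C \<inter> {a. approx_le \<epsilon> R a}"
      by (auto simp: A_def B_def approx_le_def mat_diff_def intro!: exI[of _ b])
  next
    fix a :: "'a mat" assume a: "a \<in> entry_box C \<inter> {a. approx_le \<epsilon> R a}"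
    then obtain b where b: "prop_le R b" "norm_le \<epsilon> (mat_diff a b)" by (auto simp: approx_le_def)
    have "cmod (b x y) \<le> C + \<epsilon>" for x y
    proof -
      have "cmod (a x y) \<le> C" using a by (simp add: entry_box_def)
      then show ?thesis
        using norm_triangle_ineq4[of "a x y" "mat_diff a b x y"] norm_le_entry[OF b(2), of x y]
        by (simp add: mat_diff_def)
    qed
    then have "b \<in> A" using b by (auto simp: A_def entry_box_def)
    moreover have "mat_diff a b \<in> B" using b norm_le_entry[OF b(2)] by (auto simp: B_def entry_box_def)
    moreover have "a = (\<lambda>x y. b x y + mat_diff a b x y)" by (simp add: mat_diff_def)
    ultimately show "a \<in> entry_box C \<inter> (\<lambda>p. \<lambda>x y. fst p x y + snd p x y) ` (A \<times> B)"
      using a by (auto intro!: image_eqI[of _ _ "(b, mat_diff a b)"])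
  qed
  finally show ?thesis .
qed

text \<open>The same \<open>R\<close> serves every \<open>G\<close>, and the truncations converge
  entrywise to \<open>a\<close> inside a closed set.\<close>

lemma approx_le_if_finite_columns:
  assumes a: "bdd_op a"
    and fin: "\<And>G. finite G \<Longrightarrow> approx_le \<epsilon> R (\<lambda>x y. if y \<in> G then a x y else 0)"
  shows "approx_le \<epsilon> R a"
proof -
  obtain C where C: "norm_le C a" using a by (rule bdd_opE)
  let ?f = "\<lambda>G x y. if y \<in> G then a x y else 0"
  have "a \<in> entry_box C \<inter> {a. approx_le \<epsilon> R a}"
  proof (rule Lim_in_closed_set[OF closed_approx_le, where f = ?f])
    show "\<forall>\<^sub>F G in finite_subsets_at_top UNIV. ?f G \<in> entry_box C \<inter> {a. approx_le \<epsilon> R a}"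
      using fin norm_le_entry[OF C] norm_le_nonneg[OF C]
      by (intro eventually_finite_subsets_at_top_weakI) (auto simp: entry_box_def)
    show "(?f \<longlongrightarrow> a) (finite_subsets_at_top UNIV)"
    proof (rule tendsto_mat, rule tendsto_eventually)
      fix x y
      show "\<forall>\<^sub>F G in finite_subsets_at_top UNIV. (if y \<in> G then a x y else 0) = a x y"
        unfolding eventually_finite_subsets_at_top by (auto intro!: exI[of _ "{y}"])
    qed
  qed simp
  then show ?thesis by simp
qed

section \<open>Uniform approximability\<close>

definition prop_box :: "real \<Rightarrow> ('a::metric_space) mat set" where
  "prop_box r = {m. prop_le r m \<and> (\<forall>x y. cmod (m x y) \<le> 1)}"

lemma compact_prop_box: "compact (prop_box r :: ('a::metric_space) mat set)"
proof -
  have "prop_box r = entry_box 1 \<inter> {m :: 'a mat. prop_le r m}"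
    by (auto simp: prop_box_def entry_box_def)
  then show ?thesis by (simp add: compact_Int_closed compact_entry_box closed_prop_le)
qed

lemma ulfE:
  assumes "ulf TYPE('a::metric_space)"
  obtains N :: nat where "\<And>x::'a. finite (cball x r)" "\<And>x::'a. card (cball x r) \<le> N"
  using assms unfolding ulf_def by blast

text \<open>Schur test: a row or column of such a matrix is supported in a ball of radius
  \<open>r\<close>, and the sizes of these balls are uniformly bounded.\<close>

lemma prop_box_norm_le:
  assumes "ulf TYPE('a::metric_space)"
  obtains N where "\<And>m :: 'a mat. m \<in> prop_box r \<Longrightarrow> norm_le N m"
proof -
  obtain N :: nat where N: "\<And>x::'a. finite (cball x r)" "\<And>x::'a. card (cball x r) \<le> N"
    using ulfE[OF assms] by blast
  have "norm_le (1 * of_nat N) m" if m: "m \<in> prop_box r" for m :: "'a mat"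
  proof (rule norm_le_Schur)
    show "cmod (m x y) \<le> 1" for x y using m by (simp add: prop_box_def)
    have "{y. m x y \<noteq> 0} \<subseteq> cball x r" "{y. m y x \<noteq> 0} \<subseteq> cball x r" for x
      using m by (auto simp: prop_box_def prop_le_def dist_commute not_less[symmetric])
    then show "finite {y. m x y \<noteq> 0} \<and> card {y. m x y \<noteq> 0} \<le> N"
      "finite {y. m y x \<noteq> 0} \<and> card {y. m y x \<noteq> 0} \<le> N" for x
      using N by (meson card_mono finite_subset le_trans)+
  qed
  then show ?thesis by (rule that)
qed

lemma prop_box_bdd:
  assumes "ulf TYPE('a::metric_space)" "(m :: 'a mat) \<in> prop_box r"
  shows "bdd_op m"
  using prop_box_norm_le[OF assms(1)] assms(2) bdd_opI by metis

lemma prop_box_Cu: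
  assumes "ulf TYPE('a::metric_space)" "(m :: 'a mat) \<in> prop_box r"
  shows "m \<in> Cu"
  using prop_box_bdd[OF assms] assms(2) by (intro Cu_if_prop_le[of m r]) (simp_all add: prop_box_def)

text \<open>An entry of the conjugate is a series whose terms each involve finitely many entries of
  \<open>m\<close>. Uniformly in \<open>m\<close> it is dominated by a summable series, a product of
  two square-summable functions, so the Weierstrass test applies.\<close>

lemma continuous_on_conj_by:
  assumes ulf: "ulf TYPE('a::metric_space)" and U: "bdd_op (U :: 'a mat)"
  shows "continuous_on (prop_box r) (conj_by U)"
proof (intro continuous_on_coordinatewise_then_product)
  fix y y'
  obtain N :: nat where N: "\<And>x::'a. finite (cball x r)" "\<And>x::'a. card (cball x r) \<le> N"
    using ulfE[OF ulf] by blast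
  obtain C where C: "norm_le C U" using U by (rule bdd_opE)
  \<comment> \<open>\<open>J\<close> dominates every matrix of the box entrywise; as it is bounded,
    it sends the moduli of a row of \<open>U\<close> to a square-summable function.\<close>
  define J :: "'a mat" where "J = (\<lambda>x y. if dist x y \<le> r then 1 else 0)"
  have J: "J \<in> prop_box r" by (auto simp: J_def prop_box_def prop_le_def)
  obtain K where K: "norm_le K J" using prop_box_bdd[OF ulf J] by (rule bdd_opE)
  define v :: "'a \<Rightarrow> complex" where "v x = of_real (cmod (U y x))" for x
  have v: "ell2 v" using norm_le_row(1)[OF C, of y] by (simp add: ell2_def v_def)
  have Jv: "mat_app J v x' = of_real (\<Sum>x\<in>cball x' r. cmod (U y x))" for x'
  proof -
    have "((\<lambda>x. J x' x * v x) has_sum (\<Sum>x\<in>cball x' r. J x' x * v x)) UNIV"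
      using N(1)[of x'] by (intro has_sum_finite_neutralI) (auto simp: J_def)
    then show ?thesis by (simp add: mat_app_def has_sum_iff J_def v_def)
  qed
  have Um: "mat_mult U m y x' = (\<Sum>x\<in>cball x' r. U y x * m x x')" if "m \<in> prop_box r" for m x'
  proof -
    have "((\<lambda>x. U y x * m x x') has_sum (\<Sum>x\<in>cball x' r. U y x * m x x')) UNIV"
      using N(1)[of x'] that
      by (intro has_sum_finite_neutralI) (auto simp: prop_box_def prop_le_def dist_commute)
    then show ?thesis by (simp add: mat_mult_def has_sum_iff)
  qed
  let ?M = "\<lambda>x'. (\<Sum>x\<in>cball x' r. cmod (U y x)) * cmod (U y' x')"
  have "?M = (\<lambda>x'. cmod (mat_app J v x' * U y' x'))"
    by (simp add: Jv norm_mult sum_nonneg del: of_real_sum)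
  moreover have "(\<lambda>x'. cmod (mat_app J v x' * U y' x')) summable_on UNIV"
    by (intro ell2_mult_abs_summable norm_le_mat_app[OF K v] norm_le_row[OF C])
  ultimately have sM: "?M summable_on UNIV" by simp
  have "uniform_limit (prop_box r) (\<lambda>F m. \<Sum>x'\<in>F. (\<Sum>x\<in>cball x' r. U y x * m x x') * cnj (U y' x'))
      (\<lambda>m. \<Sum>\<^sub>\<infinity>x'\<in>UNIV. (\<Sum>x\<in>cball x' r. U y x * m x x') * cnj (U y' x')) (finite_subsets_at_top UNIV)"
  proof (rule Weierstrass_m_test_general[OF _ sM])
    fix x' :: 'a and m :: "'a mat" assume m: "m \<in> prop_box r"
    have "cmod (\<Sum>x\<in>cball x' r. U y x * m x x') \<le> (\<Sum>x\<in>cball x' r. cmod (U y x) * 1)"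
      using m by (intro sum_norm_le) (auto simp: norm_mult prop_box_def intro!: mult_left_le)
    then show "cmod ((\<Sum>x\<in>cball x' r. U y x * m x x') * cnj (U y' x')) \<le> ?M x'"
      by (simp add: norm_mult mult_right_mono)
  qed
  then have "continuous_on (prop_box r) (\<lambda>m. \<Sum>\<^sub>\<infinity>x'\<in>UNIV. (\<Sum>x\<in>cball x' r. U y x * m x x') * cnj (U y' x'))"
    by (rule uniform_limit_theorem[rotated]) (auto intro!: always_eventually continuous_intros)
  then show "continuous_on (prop_box r) (\<lambda>m. conj_by U m y y')"
  proof (rule continuous_on_eq)
    fix m :: "'a mat" assume "m \<in> prop_box r"
    from Um[OF this] show "(\<Sum>\<^sub>\<infinity>x'\<in>UNIV. (\<Sum>x\<in>cball x' r. U y x * m x x') * cnj (U y' x')) = conj_by U m y y'"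
      unfolding conj_by_def by (subst (2) mat_mult_def) (simp add: mat_adj_def)
  qed
qed

text \<open>Baire category in the compact space of matrices of propagation at most \<open>r\<close> with entries
  in the unit disc: one of the closed sets of matrices whose conjugates are approximable with
  propagation \<open>n\<close> contains a cylinder, and a finite correction of the entries reaches every matrix.\<close>

lemma uniform_approximability:
  assumes ulf: "ulf TYPE('a::metric_space)" and U: "normalizes_Cu (U :: 'a mat)" and e: "0 < \<epsilon>"
  obtains R where "\<And>m. m \<in> prop_box r \<Longrightarrow> approx_le \<epsilon> R (conj_by U m)"
proof -
  let ?K = "prop_box r :: 'a mat set" and ?X = "top_of_set (prop_box r :: 'a mat set)"
  \<comment> \<open>The other half of \<open>\<epsilon>\<close> is kept for the finite
    correction.\<close>
  define T where "T n = {m \<in> ?K. approx_le (\<epsilon>/2) (real n) (conj_by U m)}" for n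
  have bU: "bdd_op U" using normalizes_Cu_bdd[OF U] .
  have CuU: "conj_by U a \<in> Cu" if "a \<in> Cu" for a using U that by (simp add: normalizes_Cu_def)
  obtain D where D: "\<And>m :: 'a mat. m \<in> ?K \<Longrightarrow> norm_le D m" using prop_box_norm_le[OF ulf] by blast
  obtain C where C: "norm_le C U" using bU by (rule bdd_opE)
  have box: "conj_by U m \<in> entry_box (C * D * C)" if "m \<in> ?K" for m
  proof -
    have "norm_le (C * D * C) (conj_by U m)" unfolding conj_by_def
      by (intro norm_le_mult C D that) (simp add: C)
    then show ?thesis by (simp add: entry_box_def norm_le_entry)
  qed
  have closedT: "closedin ?X (T n)" for n
  proof -
    have "closedin ?X (?K \<inter> conj_by U -` (entry_box (C * D * C) \<inter> {a. approx_le (\<epsilon>/2) (real n) a}))"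
      by (intro continuous_closedin_preimage continuous_on_conj_by ulf bU closed_approx_le)
    also have "?K \<inter> conj_by U -` (entry_box (C * D * C) \<inter> {a. approx_le (\<epsilon>/2) (real n) a}) = T n"
      using box by (auto simp: T_def)
    finally show ?thesis .
  qed
  have cover: "?K \<subseteq> (\<Union>n. T n)"
  proof
    fix m assume m: "m \<in> ?K"
    then obtain R where R: "approx_le (\<epsilon>/2) R (conj_by U m)"
      using CuU[OF prop_box_Cu[OF ulf m]] e unfolding Cu_iff by (meson half_gt_zero)
    obtain n where "R \<le> real n" using real_arch_simple by blast
    with R m have "m \<in> T n" by (auto simp: T_def elim: approx_le_mono)
    then show "m \<in> (\<Union>n. T n)" by blast
  qed
  have cX: "compact_space ?X" by (simp add: compact_space_subtopology compact_prop_box)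
  have "\<exists>n. ?X interior_of T n \<noteq> {}"
  proof (rule ccontr)
    assume "\<not> ?thesis"
    then have "?X interior_of \<Union>(range T) = {}"
      using closedT cX
      by (intro Baire_category_alt disjI2 conjI compact_imp_locally_compact_space
          compact_Hausdorff_imp_regular_space Hausdorff_space_subtopology Hausdorff_space_mat) auto
    moreover have "\<Union>(range T) = topspace ?X" using cover by (auto simp: T_def)
    moreover have "(\<lambda>x y. 0) \<in> ?K" by (simp add: prop_box_def prop_le_def)
    ultimately show False by (simp only: interior_of_topspace) auto
  qed
  then obtain n m0 where "m0 \<in> ?X interior_of T n" by blast
  then obtain W where W: "openin ?X W" "m0 \<in> W" "W \<subseteq> T n" by (auto simp: interior_of_def)
  then obtain V where V: "open V" "W = ?K \<inter> V" by (auto simp: openin_open)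
  obtain F where F: "finite F" "\<And>m. (\<And>x y. x \<in> F \<Longrightarrow> y \<in> F \<Longrightarrow> m x y = m0 x y) \<Longrightarrow> m \<in> V"
    using open_mat_contains_cylinder[OF V(1), of m0] W V by blast
  have m0: "m0 \<in> ?K" using W V by blast
  \<comment> \<open>The correction has \<open>card (F \<times> F)\<close> terms with coefficients of
    modulus at most 2, so its total error stays within \<open>\<epsilon>/2\<close>; the added 1
    covers empty \<open>F\<close>.\<close>
  define \<eta> where "\<eta> = \<epsilon> / (4 * (real (card (F \<times> F)) + 1))"
  have "0 < \<eta>" using e by (simp add: \<eta>_def add_nonneg_pos)
  then have "\<exists>S. approx_le \<eta> S (conj_by U (mat_unit x y))" for x y
    using CuU[OF Cu_mat_unit[of x y]] by (simp add: Cu_iff)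
  then obtain S where S: "\<And>x y. approx_le \<eta> (S x y) (conj_by U (mat_unit x y))" by metis
  define R where "R = Max (insert (real n) ((\<lambda>p. S (fst p) (snd p)) ` (F \<times> F)))"
  have RS: "S x y \<le> R" if "x \<in> F" "y \<in> F" for x y
    unfolding R_def using F(1) that by (intro Max_ge) (auto intro!: image_eqI[of _ _ "(x, y)"])
  have Rn: "real n \<le> R" unfolding R_def using F(1) by (auto intro!: Max_ge)
  have "approx_le \<epsilon> R (conj_by U m)" if m: "m \<in> ?K" for m
  proof -
    \<comment> \<open>This moves \<open>m\<close> into the cylinder around \<open>m0\<close>. It
      stays in the box because propagation and the unit disc are conditions on single
      entries.\<close>
    define m' where "m' x y = (if x \<in> F \<and> y \<in> F then m0 x y else m x y)" for x y
    have "m' \<in> ?K" using m m0 by (auto simp: prop_box_def prop_le_def m'_def)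
    moreover have "m' \<in> V" by (rule F(2)) (simp add: m'_def)
    ultimately have "m' \<in> T n" using W V by auto
    then have 1: "approx_le (\<epsilon>/2) R (conj_by U m')" using Rn by (auto simp: T_def elim: approx_le_mono)
    define a where "a p = mat_scale (m (fst p) (snd p) - m0 (fst p) (snd p)) (mat_unit (fst p) (snd p))" for p
    have ba: "bdd_op (a p)" for p by (simp add: a_def Cu_bdd_op Cu_mat_unit)
    have "m = mat_add m' (\<lambda>x y. \<Sum>p\<in>F\<times>F. a p x y)"
    proof (intro ext)
      fix x y
      have "(\<Sum>p\<in>F\<times>F. a p x y) = (\<Sum>p\<in>F\<times>F. if p = (x, y) then m x y - m0 x y else 0)"
        by (intro sum.cong) (auto simp: a_def mat_scale_def mat_unit_def)
      then show "m x y = mat_add m' (\<lambda>x y. \<Sum>p\<in>F\<times>F. a p x y) x y"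
        using F(1) by (auto simp: mat_add_def m'_def)
    qed
    then have eq: "conj_by U m = mat_add (conj_by U m') (\<lambda>x y. \<Sum>p\<in>F\<times>F. conj_by U (a p) x y)"
      using conj_by_sum[OF bU, where a = a and I = "F \<times> F"] ba prop_box_bdd[OF ulf \<open>m' \<in> ?K\<close>] bU by (metis conj_by_add)
    have "approx_le (\<Sum>p\<in>F\<times>F. 2 * \<eta>) R (\<lambda>x y. \<Sum>p\<in>F\<times>F. conj_by U (a p) x y)"
    proof (rule approx_le_sum)
      fix p assume p: "p \<in> F \<times> F"
      let ?c = "m (fst p) (snd p) - m0 (fst p) (snd p)"
      have "cmod ?c \<le> cmod (m (fst p) (snd p)) + cmod (m0 (fst p) (snd p))" by (rule norm_triangle_ineq4)
      also have "\<dots> \<le> 1 + 1" using m m0 by (intro add_mono) (auto simp: prop_box_def)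
      finally have c: "cmod ?c \<le> 2" by simp
      have "approx_le (cmod ?c * \<eta>) (S (fst p) (snd p)) (conj_by U (a p))"
        unfolding a_def conj_by_scale by (intro approx_le_scale S)
      then show "approx_le (2 * \<eta>) R (conj_by U (a p))"
        using c \<open>0 < \<eta>\<close> p RS by (elim approx_le_mono) (auto intro!: mult_right_mono)
    qed
    from approx_le_add[OF 1 this] have "approx_le (\<epsilon>/2 + (\<Sum>p\<in>F\<times>F. 2 * \<eta>)) R (conj_by U m)"
      unfolding eq .
    moreover have "(\<Sum>p\<in>F\<times>F. 2 * \<eta>) \<le> \<epsilon>/2"
    proof -
      have "(\<Sum>p\<in>F\<times>F. 2 * \<eta>) = \<epsilon>/2 * (real (card (F \<times> F)) / (real (card (F \<times> F)) + 1))"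
        by (simp add: \<eta>_def field_simps del: card_cartesian_product)
      also have "\<dots> \<le> \<epsilon>/2 * 1" using e by (intro mult_left_mono) (auto simp: field_simps)
      finally show ?thesis by simp
    qed
    ultimately show ?thesis by (elim approx_le_mono) auto
  qed
  then show ?thesis using that by blast
qed

section \<open>Averaging over signs\<close>

text \<open>The premise on \<open>P\<close> is closure under midpoints: \<open>a\<close> is the midpoint of \<open>a + b\<close> and \<open>a - b\<close>.
  Averaging a quadratic expression over all choices of signs kills its off-diagonal terms.\<close>

lemma sign_average:
  fixes T :: "'b \<Rightarrow> 'b \<Rightarrow> 'v::ab_group_add"
  assumes "finite F" and mid: "\<And>a b. P (a + b) \<Longrightarrow> P (a - b) \<Longrightarrow> P a"
    and all: "\<And>\<sigma> :: 'b \<Rightarrow> bool. P (c + (\<Sum>y\<in>F. \<Sum>z\<in>F. if \<sigma> y = \<sigma> z then T y z else - T y z))"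
  shows "P (c + (\<Sum>y\<in>F. T y y))"
  using \<open>finite F\<close> all
proof (induction F arbitrary: c rule: finite_induct)
  case (insert k F)
  let ?s = "\<lambda>\<sigma> y z. if \<sigma> y = \<sigma> z then T y z else - T y z"
  have "P ((c + T k k) + (\<Sum>y\<in>F. \<Sum>z\<in>F. ?s \<sigma> y z))" for \<sigma> :: "'b \<Rightarrow> bool"
  proof -
    define Q where "Q = (\<Sum>y\<in>F. \<Sum>z\<in>F. ?s \<sigma> y z)"
    \<comment> \<open>The terms in which the sign of \<open>k\<close> matters: flipping that sign
      negates \<open>L\<close> and leaves \<open>Q\<close> alone. The term \<open>T k k\<close> is
      absorbed into \<open>c\<close>, over which the induction is generalised.\<close>
    define L where "L = (\<Sum>z\<in>F. if \<sigma> z then T k z else - T k z) + (\<Sum>y\<in>F. if \<sigma> y then T y k else - T y k)"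
    have split: "(\<Sum>y\<in>insert k F. \<Sum>z\<in>insert k F. ?s \<tau> y z) =
        T k k + (\<Sum>z\<in>F. ?s \<tau> k z) + ((\<Sum>y\<in>F. ?s \<tau> y k) + (\<Sum>y\<in>F. \<Sum>z\<in>F. ?s \<tau> y z))" for \<tau>
      using insert.hyps by (simp add: sum.distrib)
    have 1: "(\<Sum>y\<in>F. \<Sum>z\<in>F. ?s (\<sigma>(k := t)) y z) = Q" for t
      unfolding Q_def using insert.hyps by (intro sum.cong) auto
    have 2: "(\<Sum>z\<in>F. ?s (\<sigma>(k := True)) k z) + (\<Sum>y\<in>F. ?s (\<sigma>(k := True)) y k) = L"
      unfolding L_def using insert.hyps by (intro arg_cong2[of _ _ _ _ "(+)"] sum.cong) auto
    have 3: "(\<Sum>z\<in>F. ?s (\<sigma>(k := False)) k z) + (\<Sum>y\<in>F. ?s (\<sigma>(k := False)) y k) = - L"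
      unfolding L_def minus_add_distrib sum_negf[symmetric] using insert.hyps
      by (intro arg_cong2[of _ _ _ _ "(+)"] sum.cong) auto
    have "P ((c + T k k + Q) + L)"
      using insert.prems[of "\<sigma>(k := True)"] unfolding split 1 2[symmetric] by (simp only: add_ac)
    moreover have "P ((c + T k k + Q) - L)"
      using insert.prems[of "\<sigma>(k := False)"] unfolding split 1 diff_conv_add_uminus 3[symmetric]
      by (simp only: add_ac)
    ultimately show ?thesis unfolding Q_def[symmetric] by (rule mid)
  qed
  from insert.IH[OF this] show ?case using insert.hyps by (simp add: add_ac)
qed simp

lemma sum_mat_apply: "sum a I x y = (\<Sum>i\<in>I. (a i :: 'a mat) x y)"
  by (induction I rule: infinite_finite_induct) auto

lemma approx_le_midpoint:
  fixes a b :: "('a::metric_space) mat"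
  assumes "approx_le \<epsilon> R (a + b)" "approx_le \<epsilon> R (a - b)"
  shows "approx_le \<epsilon> R a"
proof -
  have "approx_le (cmod (1/2) * \<epsilon> + cmod (1/2) * \<epsilon>) R (mat_add (mat_scale (1/2) (a + b)) (mat_scale (1/2) (a - b)))"
    by (intro approx_le_add approx_le_scale assms)
  moreover have "mat_add (mat_scale (1/2) (a + b)) (mat_scale (1/2) (a - b)) = a"
    by (intro ext) (simp add: mat_add_def mat_scale_def field_simps)
  ultimately show ?thesis by simp
qed

lemma norm_sum_signs_square:
  fixes c :: "'b \<Rightarrow> complex"
  shows "(cmod (\<Sum>y\<in>F. (if \<sigma> y then 1 else -1) * c y))\<^sup>2 =
    (\<Sum>y\<in>F. \<Sum>z\<in>F. if \<sigma> y = \<sigma> z then Re (c y * cnj (c z)) else - Re (c y * cnj (c z)))"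
proof -
  let ?S = "\<Sum>y\<in>F. (if \<sigma> y then 1 else -1) * c y"
  have "(cmod ?S)\<^sup>2 = Re (?S * cnj ?S)" unfolding complex_norm_square[symmetric] by simp
  also have "?S * cnj ?S = (\<Sum>y\<in>F. \<Sum>z\<in>F. if \<sigma> y = \<sigma> z then c y * cnj (c z) else - (c y * cnj (c z)))"
    unfolding cnj_sum sum_product by (intro sum.cong) auto
  also have "Re \<dots> = (\<Sum>y\<in>F. \<Sum>z\<in>F. if \<sigma> y = \<sigma> z then Re (c y * cnj (c z)) else - Re (c y * cnj (c z)))"
    unfolding Re_sum by (intro sum.cong) auto
  finally show ?thesis .
qed

lemma diag_mat_prop_box: "(\<And>x. cmod (d x) \<le> 1) \<Longrightarrow> diag_mat d \<in> prop_box 0"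
  by (auto simp: prop_box_def prop_le_def diag_mat_def)

lemma mat_unit_prop_box: "dist x y \<le> r \<Longrightarrow> mat_unit x y \<in> prop_box r"
  by (auto simp: prop_box_def prop_le_def mat_unit_def)

section \<open>Concentration of the columns\<close>

text \<open>If the \<open>x\<close>-th column of \<open>U\<close> were spread out, then for random signs \<open>d\<close> the \<open>x\<close>-th column of
  \<open>U\<^sup>* d U\<close>, although of norm about one, would have negligible mass in the ball around \<open>x\<close>
  that carries most of it by uniform approximability.\<close>

lemma columns_concentrated:
  assumes ulf: "ulf TYPE('a::metric_space)" and U: "normalizes_Cu (U :: 'a mat)"
  obtains \<delta> f where "0 < \<delta>" "\<And>x. \<delta> \<le> cmod (U (f x) x)"
proof -
  have uU: "unitary_op U" and bU: "bdd_op U" using U by (auto simp: normalizes_Cu_def unitary_op_def)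
  have uU': "unitary_op (mat_adj U)" using unitary_op_adj[OF uU] .
  obtain R where R: "\<And>m :: 'a mat. m \<in> prop_box 0 \<Longrightarrow> approx_le (1/4) R (conj_by (mat_adj U) m)"
    using uniform_approximability[OF ulf normalizes_Cu_adj[OF U], of "1/4" 0] by auto
  obtain N :: nat where N: "\<And>x::'a. finite (cball x R)" "\<And>x::'a. card (cball x R) \<le> N"
    using ulfE[OF ulf] by blast
  \<comment> \<open>Makes \<open>real N * \<delta>\<^sup>2\<close> smaller than 1/4, the lower bound
    obtained below for the mass in the ball.\<close>
  define \<delta> where "\<delta> = 1 / (2 * sqrt (real N + 1))"
  have d0: "0 < \<delta>" by (simp add: \<delta>_def add_nonneg_pos)
  have d2: "real N * \<delta>\<^sup>2 < 1/4"
    by (simp add: \<delta>_def power_divide power_mult_distrib field_simps)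
  have "\<exists>y. \<delta> \<le> cmod (U y x)" for x
  proof (rule ccontr)
    assume "\<not> ?thesis"
    then have small: "cmod (U y x) \<le> \<delta>" for y by (meson less_le not_le)
    have "((\<lambda>y. (cmod (U y x))\<^sup>2) has_sum 1) UNIV" by (rule unitary_op_column_norm[OF uU])
    from has_sum_finite_approximation[OF this, of "1/2"]
    obtain F where F: "finite F" "dist (\<Sum>y\<in>F. (cmod (U y x))\<^sup>2) 1 \<le> 1/2" by auto
    then have half: "1/2 \<le> (\<Sum>y\<in>F. (cmod (U y x))\<^sup>2)" unfolding dist_real_def by linarith
    let ?B = "cball x R"
    \<comment> \<open>\<open>c z y\<close> is the contribution of \<open>y\<close> to the entry
      \<open>(z, x)\<close> of \<open>U\<^sup>* d U\<close>, up to its sign; \<open>T\<close> is the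
      real Gram matrix of these contributions over the ball.\<close>
    define c where "c z y = cnj (U y z) * U y x" for z y
    define T where "T y y' = (\<Sum>z\<in>?B. Re (c z y * cnj (c z y')))" for y y'
    have "1/4 \<le> 0 + (\<Sum>y\<in>F. \<Sum>y'\<in>F. if \<sigma> y = \<sigma> y' then T y y' else - T y y')" for \<sigma> :: "'a \<Rightarrow> bool"
    proof -
      define d :: "'a \<Rightarrow> complex" where "d y = (if y \<in> F then (if \<sigma> y then 1 else -1) else 0)" for y
      let ?D = "diag_mat d"
      have D: "?D \<in> prop_box 0" by (rule diag_mat_prop_box) (simp add: d_def)
      have bD: "bdd_op ?D" using prop_box_bdd[OF ulf D] .
      let ?a = "conj_by (mat_adj U) ?D"
      have ba: "bdd_op ?a" using bU bD by simp
      have a: "?a z x = (\<Sum>y\<in>F. (if \<sigma> y then 1 else -1) * c z y)" for z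
        using conj_by_diag_finite[OF F(1), of "mat_adj U" "\<lambda>y. if \<sigma> y then 1 else -1" z x]
        by (simp add: d_def[abs_def] c_def mat_adj_def mult_ac)
      \<comment> \<open>Real signs make \<open>?D\<close> self-adjoint, with square the projection
        onto \<open>F\<close>. So the squared norm of column \<open>x\<close> of \<open>?a\<close>
        is the mass of column \<open>x\<close> of \<open>U\<close> on \<open>F\<close>, whatever the
        signs.\<close>
      have "mat_adj ?D = ?D" by (intro ext) (auto simp: mat_adj_def diag_mat_def d_def)
      then have "mat_mult (mat_adj ?a) ?a = conj_by (mat_adj U) (mat_mult ?D ?D)"
        using bU bD uU' by (simp add: conj_by_mult flip: conj_by_adj)
      also have "mat_mult ?D ?D = diag_mat (\<lambda>y. if y \<in> F then 1 else 0)"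
        by (intro ext, subst mat_mult_diag_left) (auto simp: diag_mat_def d_def)
      finally have "Re (mat_mult (mat_adj ?a) ?a x x) = (\<Sum>y\<in>F. (cmod (U y x))\<^sup>2)"
        using conj_by_diag_finite[OF F(1), of "mat_adj U" "\<lambda>_. 1" x x] sum_mult_cnj[of "\<lambda>y. U y x" F]
        by (simp add: mat_adj_def mult.commute[of "cnj _"])
      then have "((\<lambda>z. (cmod (?a z x))\<^sup>2) has_sum (\<Sum>y\<in>F. (cmod (U y x))\<^sup>2)) UNIV"
        using adj_mult_self_diag[OF ba, of x] by simp
      from has_sum_finite_approximation[OF this, of "1/16"]
      obtain G where G: "finite G" "dist (\<Sum>z\<in>G. (cmod (?a z x))\<^sup>2) (\<Sum>y\<in>F. (cmod (U y x))\<^sup>2) \<le> 1/16" by auto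
      obtain b where b: "prop_le R b" "norm_le (1/4) (mat_diff ?a b)" using R[OF D] by (auto simp: approx_le_def)
      have "(\<Sum>z\<in>G - ?B. (cmod (?a z x))\<^sup>2) = (\<Sum>z\<in>G - ?B. (cmod (mat_diff ?a b z x))\<^sup>2)"
      proof (rule sum.cong[OF refl])
        fix z assume "z \<in> G - ?B"
        then have "b z x = 0" using b(1) by (auto simp: prop_le_def dist_commute)
        then show "(cmod (?a z x))\<^sup>2 = (cmod (mat_diff ?a b z x))\<^sup>2" by (simp add: mat_diff_def)
      qed
      also have "\<dots> = (L2_set (\<lambda>z. cmod (mat_diff ?a b z x)) (G - ?B))\<^sup>2" by (simp only: L2_set_power2)
      also have "\<dots> \<le> (1/4)\<^sup>2"
        using L2_set_le_l2norm[OF norm_le_col(1)[OF b(2), of x], of "G - ?B"] norm_le_col(2)[OF b(2), of x]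
        by (intro power_mono) auto
      finally have out: "(\<Sum>z\<in>G - ?B. (cmod (?a z x))\<^sup>2) \<le> 1/16" by (simp add: power2_eq_square)
      have "(\<Sum>z\<in>G. (cmod (?a z x))\<^sup>2) \<le> (\<Sum>z\<in>(G - ?B) \<union> ?B. (cmod (?a z x))\<^sup>2)"
        using G(1) N(1) by (intro sum_mono2) auto
      also have "\<dots> = (\<Sum>z\<in>G - ?B. (cmod (?a z x))\<^sup>2) + (\<Sum>z\<in>?B. (cmod (?a z x))\<^sup>2)"
        using G(1) N(1) by (intro sum.union_disjoint) auto
      \<comment> \<open>From the mass 1/2, at most 1/16 is lost by passing to \<open>G\<close> and
        at most 1/16 lies outside the ball; 3/8 remains.\<close>
      finally have "1/4 \<le> (\<Sum>z\<in>?B. (cmod (?a z x))\<^sup>2)"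
        using out half G(2) unfolding dist_real_def by linarith
      also have "\<dots> = (\<Sum>z\<in>?B. \<Sum>y\<in>F. \<Sum>y'\<in>F. if \<sigma> y = \<sigma> y' then Re (c z y * cnj (c z y')) else - Re (c z y * cnj (c z y')))"
        unfolding a norm_sum_signs_square ..
      also have "\<dots> = (\<Sum>y\<in>F. \<Sum>y'\<in>F. if \<sigma> y = \<sigma> y' then T y y' else - T y y')"
      proof -
        let ?g = "\<lambda>z y y'. if \<sigma> y = \<sigma> y' then Re (c z y * cnj (c z y')) else - Re (c z y * cnj (c z y'))"
        have "(\<Sum>z\<in>?B. \<Sum>y\<in>F. \<Sum>y'\<in>F. ?g z y y') = (\<Sum>y\<in>F. \<Sum>z\<in>?B. \<Sum>y'\<in>F. ?g z y y')"
          by (rule sum.swap)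
        also have "\<dots> = (\<Sum>y\<in>F. \<Sum>y'\<in>F. \<Sum>z\<in>?B. ?g z y y')"
          by (rule sum.cong[OF refl], rule sum.swap)
        also have "\<dots> = (\<Sum>y\<in>F. \<Sum>y'\<in>F. if \<sigma> y = \<sigma> y' then T y y' else - T y y')"
          unfolding T_def sum_negf[symmetric] by (intro sum.cong refl) simp
        finally show ?thesis .
      qed
      finally show ?thesis by simp
    qed
    \<comment> \<open>A half-line is closed under midpoints, so the lower bound survives averaging
      while the off-diagonal terms of \<open>T\<close> disappear.\<close>
    from sign_average[OF F(1), of "\<lambda>t. 1/4 \<le> t" 0 T, OF _ this]
    have "1/4 \<le> (\<Sum>y\<in>F. T y y)" by auto
    also have "\<dots> = (\<Sum>z\<in>?B. \<Sum>y\<in>F. (cmod (U y z))\<^sup>2 * (cmod (U y x))\<^sup>2)"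
    proof -
      have "Re (c z y * cnj (c z y)) = (cmod (U y z))\<^sup>2 * (cmod (U y x))\<^sup>2" for z y
        unfolding complex_norm_square[symmetric] by (simp add: c_def norm_mult power_mult_distrib)
      then show ?thesis unfolding T_def by (subst sum.swap) simp
    qed
    \<comment> \<open>The assumed smallness of column \<open>x\<close> bounds one factor by
      \<open>\<delta>\<^sup>2\<close>; what remains of the sum over \<open>F\<close> is at most the
      squared norm of column \<open>z\<close>, which is one.\<close>
    also have "\<dots> \<le> (\<Sum>z\<in>?B. 1 * \<delta>\<^sup>2)"
    proof (rule sum_mono)
      fix z
      have "(\<Sum>y\<in>F. (cmod (U y z))\<^sup>2 * (cmod (U y x))\<^sup>2) \<le> (\<Sum>y\<in>F. (cmod (U y z))\<^sup>2 * \<delta>\<^sup>2)"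
        by (intro sum_mono mult_left_mono power_mono small) auto
      also have "\<dots> = (\<Sum>y\<in>F. (cmod (U y z))\<^sup>2) * \<delta>\<^sup>2" by (simp add: sum_distrib_right)
      also have "\<dots> \<le> 1 * \<delta>\<^sup>2"
        by (intro mult_right_mono finite_sum_le_has_sum[OF unitary_op_column_norm[OF uU]] F(1)) auto
      finally show "(\<Sum>y\<in>F. (cmod (U y z))\<^sup>2 * (cmod (U y x))\<^sup>2) \<le> 1 * \<delta>\<^sup>2" .
    qed
    also have "\<dots> = real (card ?B) * \<delta>\<^sup>2" by simp
    also have "\<dots> \<le> real N * \<delta>\<^sup>2" using N(2) by (intro mult_right_mono) auto
    finally show False using d2 by simp
  qed
  then obtain f where "\<And>x. \<delta> \<le> cmod (U (f x) x)" by metis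
  then show ?thesis using that d0 by blast
qed

section \<open>The coarse equivalence carried by a normalizing unitary\<close>

text \<open>The entry of \<open>conj_by U (mat_unit x y)\<close> at \<open>(f x, f y)\<close> has
  modulus at least \<open>\<delta> * \<delta>\<close>, and a single radius approximates all these
  matrices, for \<open>dist x y \<le> r\<close>, within half of that.\<close>

lemma bornologous_if_concentrated:
  assumes ulf: "ulf TYPE('a::metric_space)" and U: "normalizes_Cu (U :: 'a mat)"
    and d: "0 < \<delta>" "\<And>x. \<delta> \<le> cmod (U (f x) x)"
  shows "bornologous f"
  unfolding bornologous_def
proof
  fix r
  have "0 < \<delta> * \<delta> / 2" using d by simp
  then obtain R where R: "\<And>m. m \<in> prop_box r \<Longrightarrow> approx_le (\<delta> * \<delta> / 2) R (conj_by U m)"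
    using uniform_approximability[OF ulf U] by blast
  have "dist (f x) (f y) \<le> R" if "dist x y \<le> r" for x y
  proof (rule approx_le_entry[OF R[OF mat_unit_prop_box[OF that]]])
    have "\<delta> * \<delta> / 2 < \<delta> * \<delta>" using d by simp
    also have "\<dots> \<le> cmod (U (f x) x) * cmod (U (f y) y)" using d by (intro mult_mono) (auto intro: order_trans)
    finally show "\<delta> * \<delta> / 2 < cmod (conj_by U (mat_unit x y) (f x) (f y))"
      by (simp add: conj_by_mat_unit norm_mult)
  qed
  then show "\<exists>s. \<forall>x y. dist x y \<le> r \<longrightarrow> dist (f x) (f y) \<le> s" by blast
qed

text \<open>The same mechanism for the adjoint: conjugating the matrix unit at
  \<open>(f x, f x)\<close> produces a large entry at \<open>(x, g (f x))\<close>, which must lie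
  within a fixed distance of the diagonal.\<close>

lemma close_if_concentrated:
  assumes ulf: "ulf TYPE('a::metric_space)" and U: "normalizes_Cu (U :: 'a mat)"
    and d: "0 < \<delta>" "\<And>x. \<delta> \<le> cmod (U (f x) x)"
    and d': "0 < \<delta>'" "\<And>y. \<delta>' \<le> cmod (U y (g y))"
  shows "close (g \<circ> f) id"
proof -
  have "0 < \<delta> * \<delta>' / 2" using d d' by simp
  then obtain R where R: "\<And>m. m \<in> prop_box 0 \<Longrightarrow> approx_le (\<delta> * \<delta>' / 2) R (conj_by (mat_adj U) m)"
    using uniform_approximability[OF ulf normalizes_Cu_adj[OF U]] by blast
  have "dist x (g (f x)) \<le> R" for x
  proof (rule approx_le_entry[OF R[OF mat_unit_prop_box[of "f x" "f x"]]])
    have "\<delta> * \<delta>' / 2 < \<delta> * \<delta>'" using d d' by simp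
    also have "\<dots> \<le> cmod (U (f x) x) * cmod (U (f x) (g (f x)))"
      using d d' by (intro mult_mono) (auto intro: order_trans)
    finally show "\<delta> * \<delta>' / 2 < cmod (conj_by (mat_adj U) (mat_unit (f x) (f x)) x (g (f x)))"
      by (simp add: conj_by_mat_unit norm_mult mat_adj_def)
  qed simp
  then show ?thesis unfolding close_def by (intro exI[of _ R]) (simp add: dist_commute)
qed

text \<open>Each fibre lies in a ball of radius \<open>R\<close>, so its points can be numbered
  below a common bound; the number is the colour.\<close>

lemma injective_colouring:
  assumes ulf: "ulf TYPE('a::metric_space)" and fib: "\<And>x y :: 'a. f x = f y \<Longrightarrow> dist x y \<le> R"
  obtains N :: nat and c where "\<And>x. c x < N" "\<And>i. inj_on f {x. c x = i}"
proof -
  obtain N :: nat where N: "\<And>x::'a. finite (cball x R)" "\<And>x::'a. card (cball x R) \<le> N"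
    using ulfE[OF ulf] by blast
  have "\<exists>h. inj_on h {x. f x = y} \<and> h ` {x. f x = y} \<subseteq> {..<N}" for y
  proof (cases "{x. f x = y} = {}")
    case False
    then obtain x0 where "f x0 = y" by blast
    then have sub: "{x. f x = y} \<subseteq> cball x0 R" using fib by auto
    have "card {x. f x = y} \<le> card {..<N}" using card_mono[OF N(1) sub] N(2)[of x0] by simp
    moreover have "finite {x. f x = y}" using finite_subset[OF sub N(1)] .
    ultimately show ?thesis using card_le_inj[of "{x. f x = y}" "{..<N}"] by auto
  qed auto
  then obtain h where h: "\<And>y. inj_on (h y) {x. f x = y}" "\<And>y. h y ` {x. f x = y} \<subseteq> {..<N}" by metis
  show ?thesis
  proof (rule that)
    show "h (f x) x < N" for x using h(2)[of "f x"] by auto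
    show "inj_on f {x. h (f x) x = i}" for i
    proof (rule inj_onI)
      fix x y assume "x \<in> {x. h (f x) x = i}" "y \<in> {x. h (f x) x = i}" "f x = f y"
      then show "x = y" using inj_onD[OF h(1)[of "f y"], of x y] by simp
    qed
  qed
qed

text \<open>Averaging \<open>U d U\<^sup>* d'\<close> over signs, with \<open>d\<close> and \<open>d'\<close> carrying the same signs at \<open>x\<close> and at
  \<open>f x\<close>, isolates the columns of \<open>U\<close> with index in \<open>S\<close>, moved along \<open>f\<close>.\<close>

lemma transported_columns_Cu:
  assumes ulf: "ulf TYPE('a::metric_space)" and U: "normalizes_Cu (U :: 'a mat)"
    and d: "0 < \<delta>" "\<And>x. \<delta> \<le> cmod (U (f x) x)" and inj: "inj_on f S"
  shows "(\<lambda>z y. if y \<in> f ` S then U z (inv_into S f y) else 0) \<in> Cu" (is "?A \<in> Cu")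
  unfolding Cu_iff
proof (intro conjI allI impI)
  have uU: "unitary_op U" and bU: "bdd_op U" using U by (auto simp: normalizes_Cu_def unitary_op_def)
  show bA: "bdd_op ?A"
    by (rule bdd_opI[OF norm_le_reindex_columns[OF unitary_op_norm_le[OF uU]]]) (simp add: inj_on_inv_into)
  fix \<epsilon> :: real assume "0 < \<epsilon>"
  \<comment> \<open>The right diagonal factor will have norm at most \<open>1 / \<delta>\<close>,
    and the factor \<open>\<delta>\<close> in the tolerance compensates for it.\<close>
  then have "0 < \<epsilon> * \<delta>" using d by simp
  then obtain R where R: "\<And>m. m \<in> prop_box 0 \<Longrightarrow> approx_le (\<epsilon> * \<delta>) R (conj_by U m)"
    using uniform_approximability[OF ulf U] by blast
  have "approx_le \<epsilon> R ?A"
  \<comment> \<open>Signs are averaged over finite sets only; since \<open>R\<close> is fixed before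
    \<open>G\<close>, all columns can be recovered in the limit.\<close>
  proof (rule approx_le_if_finite_columns[OF bA])
    fix G :: "'a set" assume G: "finite G"
    define F where "F = {x \<in> S. f x \<in> G}"
    have injF: "inj_on f F" using inj by (rule inj_on_subset) (auto simp: F_def)
    have "f ` F \<subseteq> G" by (auto simp: F_def)
    then have finF: "finite F" using G injF by (meson finite_imageD finite_subset)
    \<comment> \<open>The part of \<open>U d U\<^sup>* d'\<close> carrying the signs of
      \<open>x\<close> and \<open>x'\<close>. For \<open>x = x'\<close> the weight cancels
      \<open>cnj (U (f x) x)\<close> and leaves column \<open>x\<close> of \<open>U\<close>, placed
      at \<open>f x\<close>.\<close>
    define T where "T x x' = (\<lambda>z y. U z x * cnj (U y x) * (if y = f x' then 1 / cnj (U (f x') x') else 0))" for x x'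
    have "approx_le \<epsilon> R (0 + (\<Sum>x\<in>F. \<Sum>x'\<in>F. if \<sigma> x = \<sigma> x' then T x x' else - T x x'))" for \<sigma> :: "'a \<Rightarrow> bool"
    proof -
      define s :: "'a \<Rightarrow> complex" where "s x = (if \<sigma> x then 1 else -1)" for x
      define e where "e x = (if x \<in> F then s x else 0)" for x
      \<comment> \<open>By injectivity of \<open>f\<close> on \<open>F\<close> at most one summand
        is nonzero, and concentration bounds it by \<open>1 / \<delta>\<close>.\<close>
      define e' where "e' y = (\<Sum>x\<in>F. s x * (if y = f x then 1 / cnj (U (f x) x) else 0))" for y
      have D: "diag_mat e \<in> prop_box 0" by (rule diag_mat_prop_box) (simp add: e_def s_def)
      have "cmod (e' y) \<le> 1 / \<delta>" for y
      proof (cases "y \<in> f ` F")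
        case True
        then obtain x0 where x0: "x0 \<in> F" "y = f x0" by blast
        have "e' y = (\<Sum>x\<in>F. if x = x0 then s x / cnj (U (f x) x) else 0)"
          unfolding e'_def using x0 injF by (intro sum.cong) (auto dest: inj_onD)
        also have "\<dots> = s x0 / cnj (U (f x0) x0)" using finF x0 by simp
        also have "cmod \<dots> \<le> 1 / \<delta>" using d by (simp add: s_def norm_divide frac_le)
        finally show ?thesis .
      next
        case False
        then have "e' y = 0" unfolding e'_def by (intro sum.neutral) auto
        then show ?thesis using d by simp
      qed
      then have D': "norm_le (1 / \<delta>) (diag_mat e')" by (rule norm_le_diag_mat)
      have "approx_le (\<epsilon> * \<delta> * (1 / \<delta>)) R (mat_mult (conj_by U (diag_mat e)) (diag_mat e'))"
        by (intro approx_le_mult_diag R D D')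
      moreover have "mat_mult (conj_by U (diag_mat e)) (diag_mat e')
          = 0 + (\<Sum>x\<in>F. \<Sum>x'\<in>F. if \<sigma> x = \<sigma> x' then T x x' else - T x x')"
      proof (intro ext)
        fix z y
        have "mat_mult (conj_by U (diag_mat e)) (diag_mat e') z y = (\<Sum>x\<in>F. U z x * s x * cnj (U y x)) * e' y"
          using conj_by_diag_finite[OF finF, of U s z y] by (simp add: e_def[abs_def])
        also have "\<dots> = (\<Sum>x\<in>F. \<Sum>x'\<in>F. (U z x * s x * cnj (U y x)) * (s x' * (if y = f x' then 1 / cnj (U (f x') x') else 0)))"
          unfolding e'_def sum_product ..
        also have "\<dots> = (\<Sum>x\<in>F. \<Sum>x'\<in>F. (if \<sigma> x = \<sigma> x' then T x x' else - T x x') z y)"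
          by (intro sum.cong refl) (auto simp: T_def s_def)
        finally show "mat_mult (conj_by U (diag_mat e)) (diag_mat e') z y
            = (0 + (\<Sum>x\<in>F. \<Sum>x'\<in>F. if \<sigma> x = \<sigma> x' then T x x' else - T x x')) z y"
          by (simp add: sum_mat_apply)
      qed
      ultimately show ?thesis using d by simp
    qed
    note signs = this
    have "approx_le \<epsilon> R (0 + (\<Sum>x\<in>F. T x x))"
    proof (rule sign_average[OF finF, where P = "approx_le \<epsilon> R" and c = 0 and T = T])
      show "approx_le \<epsilon> R a" if "approx_le \<epsilon> R (a + b)" "approx_le \<epsilon> R (a - b)" for a b :: "'a mat"
        using that by (rule approx_le_midpoint)
    qed (rule signs)
    also have "0 + (\<Sum>x\<in>F. T x x) = (\<lambda>z y. if y \<in> G then ?A z y else 0)"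
    proof (intro ext)
      fix z y
      have U0: "U (f x) x \<noteq> 0" for x using d(1) d(2)[of x] by auto
      have "(0 + (\<Sum>x\<in>F. T x x)) z y = (\<Sum>x\<in>F. if y = f x then U z x else 0)"
        using U0 by (auto simp: sum_mat_apply T_def intro!: sum.cong)
      also have "\<dots> = (if y \<in> G then ?A z y else 0)"
      proof (cases "y \<in> f ` F")
        case True
        then obtain x0 where x0: "x0 \<in> F" "y = f x0" by blast
        have "(\<Sum>x\<in>F. if y = f x then U z x else 0) = (\<Sum>x\<in>F. if x = x0 then U z x else 0)"
          using x0 injF by (intro sum.cong) (auto dest: inj_onD)
        then show ?thesis using finF x0 inj by (auto simp: F_def)
      next
        case False
        then have "(\<Sum>x\<in>F. if y = f x then U z x else 0) = 0" by (intro sum.neutral) auto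
        then show ?thesis using False by (auto simp: F_def)
      qed
      finally show "(0 + (\<Sum>x\<in>F. T x x)) z y = (if y \<in> G then ?A z y else 0)" .
    qed
    finally show "approx_le \<epsilon> R (\<lambda>z y. if y \<in> G then ?A z y else 0)" .
  qed
  then show "\<exists>R. approx_le \<epsilon> R ?A" ..
qed

section \<open>From coarse equivalences to bijections\<close>

text \<open>Gaussian elimination: equation \<open>b\<close> is solved for a pivot unknown
  \<open>p\<close> and substituted into the others, which costs one equation and one
  unknown.\<close>

lemma homogeneous_system_solution:
  fixes a :: "'b \<Rightarrow> 'c \<Rightarrow> 'k::field"
  assumes "finite B" "finite A" "card B < card A"
  shows "\<exists>v. (\<exists>x\<in>A. v x \<noteq> 0) \<and> (\<forall>z\<in>B. (\<Sum>x\<in>A. a z x * v x) = 0)"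
  using assms
proof (induction B arbitrary: A a rule: finite_induct)
  case empty
  then obtain x where "x \<in> A" by fastforce
  then show ?case by (intro exI[of _ "\<lambda>_. 1"]) auto
next
  case (insert b B)
  show ?case
  proof (cases "\<forall>x\<in>A. a b x = 0")
    case True
    obtain v where v: "\<exists>x\<in>A. v x \<noteq> 0" "\<forall>z\<in>B. (\<Sum>x\<in>A. a z x * v x) = 0"
      using insert.IH[of A a] insert.prems insert.hyps by (metis Suc_lessD card_insert_disjoint)
    with True show ?thesis by (intro exI[of _ v]) auto
  next
    case False
    then obtain p where p: "p \<in> A" "a b p \<noteq> 0" by blast
    let ?A = "A - {p}"
    have "finite ?A" "card B < card ?A" using insert.prems insert.hyps p by auto
    then obtain v where v: "\<exists>x\<in>?A. v x \<noteq> 0" "\<forall>z\<in>B. (\<Sum>x\<in>?A. (a z x - a z p * a b x / a b p) * v x) = 0"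
      using insert.IH[of ?A "\<lambda>z x. a z x - a z p * a b x / a b p"] by blast
    define w where "w = v(p := - (\<Sum>x\<in>?A. a b x * v x) / a b p)"
    have "(\<Sum>x\<in>A. a z x * w x) = (\<Sum>x\<in>?A. (a z x - a z p * a b x / a b p) * v x)" for z
    proof -
      have "(\<Sum>x\<in>A. a z x * w x) = a z p * w p + (\<Sum>x\<in>?A. a z x * w x)"
        using insert.prems p by (simp add: sum.remove)
      also have "(\<Sum>x\<in>?A. a z x * w x) = (\<Sum>x\<in>?A. a z x * v x)" by (intro sum.cong) (auto simp: w_def)
      also have "a z p * w p = - (\<Sum>x\<in>?A. a z p * a b x / a b p * v x)"
        by (simp add: w_def sum_distrib_left sum_divide_distrib mult_ac)
      finally show ?thesis by (simp add: left_diff_distrib sum_subtractf)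
    qed
    moreover have "(\<Sum>x\<in>?A. (a b x - a b p * a b x / a b p) * v x) = 0" using p by simp
    moreover have "\<exists>x\<in>A. w x \<noteq> 0" using v(1) by (auto simp: w_def)
    ultimately show ?thesis using v(2) by (intro exI[of _ w]) auto
  qed
qed

text \<open>The Halmos-Vaughan induction. If some nonempty proper subset has exactly as many
  neighbours as elements, it and its complement are matched separately, the latter outside the
  neighbours already used. Otherwise every nonempty proper subset has a spare neighbour, so one pair
  can be fixed and its target deleted.\<close>

lemma Hall_finite:
  fixes N :: "'b \<Rightarrow> 'c set"
  assumes "finite A" "\<And>x. x \<in> A \<Longrightarrow> finite (N x)"
    and "\<And>J. J \<subseteq> A \<Longrightarrow> card J \<le> card (\<Union>x\<in>J. N x)"
  shows "\<exists>g. inj_on g A \<and> (\<forall>x\<in>A. g x \<in> N x)"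
  using assms
proof (induction A arbitrary: N rule: finite_psubset_induct)
  case (psubset A)
  show ?case
  proof (cases "\<exists>J. J \<noteq> {} \<and> J \<subset> A \<and> card J = card (\<Union>x\<in>J. N x)")
    case True
    then obtain J where J: "J \<noteq> {}" "J \<subset> A" "card J = card (\<Union>x\<in>J. N x)" by blast
    define M where "M = (\<Union>x\<in>J. N x)"
    have finJ: "finite J" using J(2) psubset.hyps finite_subset by blast
    have finM: "finite M" unfolding M_def using finJ J(2) psubset.prems(1) by auto
    have "\<exists>g. inj_on g J \<and> (\<forall>x\<in>J. g x \<in> N x)"
      using J(2) psubset.prems by (intro psubset.IH) auto
    then obtain g where g: "inj_on g J" "\<And>x. x \<in> J \<Longrightarrow> g x \<in> N x" by blast
    have "\<exists>h. inj_on h (A - J) \<and> (\<forall>x\<in>A - J. h x \<in> N x - M)"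
    proof (rule psubset.IH)
      show "A - J \<subset> A" using J by auto
      show "finite (N x - M)" if "x \<in> A - J" for x using that psubset.prems(1) by auto
      fix K assume K: "K \<subseteq> A - J"
      have finK: "finite K" using K psubset.hyps finite_subset by blast
      have finNK: "finite (\<Union>x\<in>K. N x - M)" using finK K psubset.prems(1) by auto
      have "card J + card K = card (J \<union> K)" using K finJ finK by (intro card_Un_disjoint[symmetric]) auto
      also have "\<dots> \<le> card (\<Union>x\<in>J \<union> K. N x)" using K J by (intro psubset.prems) auto
      also have "(\<Union>x\<in>J \<union> K. N x) = M \<union> (\<Union>x\<in>K. N x - M)" by (auto simp: M_def)
      also have "card \<dots> = card M + card (\<Union>x\<in>K. N x - M)"
        using finM finNK by (intro card_Un_disjoint) auto
      finally show "card K \<le> card (\<Union>x\<in>K. N x - M)" using J(3) by (simp add: M_def)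
    qed
    then obtain h where h: "inj_on h (A - J)" "\<And>x. x \<in> A - J \<Longrightarrow> h x \<in> N x - M" by blast
    have gM: "g x \<in> M" if "x \<in> J" for x using g(2)[OF that] that by (auto simp: M_def)
    have "inj_on (\<lambda>x. if x \<in> J then g x else h x) A"
    proof (rule inj_onI)
      fix x y assume xy: "x \<in> A" "y \<in> A" "(if x \<in> J then g x else h x) = (if y \<in> J then g y else h y)"
      show "x = y"
        using xy inj_onD[OF g(1), of x y] inj_onD[OF h(1), of x y] gM[of x] gM[of y] h(2)[of x] h(2)[of y]
        by (cases "x \<in> J"; cases "y \<in> J") auto
    qed
    then show ?thesis using g(2) h(2) by (intro exI[of _ "\<lambda>x. if x \<in> J then g x else h x"]) auto
  next
    case noncrit: False
    show ?thesis
    proof (cases "A = {}")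
      case False
      then obtain a where a: "a \<in> A" by blast
      have "card {a} \<le> card (\<Union>x\<in>{a}. N x)" using a by (intro psubset.prems) auto
      then have "N a \<noteq> {}" by auto
      then obtain b where b: "b \<in> N a" by blast
      have "\<exists>h. inj_on h (A - {a}) \<and> (\<forall>x\<in>A - {a}. h x \<in> N x - {b})"
      proof (rule psubset.IH)
        show "A - {a} \<subset> A" using a by auto
        show "finite (N x - {b})" if "x \<in> A - {a}" for x using that psubset.prems(1) by auto
        fix K assume K: "K \<subseteq> A - {a}"
        show "card K \<le> card (\<Union>x\<in>K. N x - {b})"
        proof (cases "K = {}")
          case False
          have "K \<subset> A" using K a by auto
          then have "card K \<noteq> card (\<Union>x\<in>K. N x)" using noncrit False by blast
          moreover have "card K \<le> card (\<Union>x\<in>K. N x)" using K by (intro psubset.prems) auto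
          ultimately have "card K < card (\<Union>x\<in>K. N x)" by simp
          moreover have "(\<Union>x\<in>K. N x - {b}) = (\<Union>x\<in>K. N x) - {b}" by auto
          moreover have "card (\<Union>x\<in>K. N x) - 1 \<le> card ((\<Union>x\<in>K. N x) - {b})"
            by (metis card_Diff1_le card_Diff_singleton_if diff_le_self order_refl)
          ultimately show ?thesis by simp
        qed simp
      qed
      then obtain h where h: "inj_on h (A - {a})" "\<And>x. x \<in> A - {a} \<Longrightarrow> h x \<in> N x - {b}" by blast
      have "inj_on (h(a := b)) A"
      proof (rule inj_onI)
        fix x y assume xy: "x \<in> A" "y \<in> A" "(h(a := b)) x = (h(a := b)) y"
        show "x = y"
          using xy inj_onD[OF h(1), of x y] h(2)[of x] h(2)[of y]
          by (cases "x = a"; cases "y = a") auto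
      qed
      moreover have "\<forall>x\<in>A. (h(a := b)) x \<in> N x" using h(2) b by auto
      ultimately show ?thesis by blast
    qed auto
  qed
qed

text \<open>Compactness: choice functions form a product of finite sets, injectivity is a family of
  closed conditions on pairs of points, and finitely many of these are met by the finite
  case.\<close>

lemma Hall_locally_finite:
  fixes N :: "'b \<Rightarrow> 'c::metric_space set"
  assumes fin: "\<And>x. finite (N x)"
    and Hall: "\<And>J. finite J \<Longrightarrow> card J \<le> card (\<Union>x\<in>J. N x)"
  obtains g where "inj g" "\<And>x. g x \<in> N x"
proof -
  have ne: "N x \<noteq> {}" for x using Hall[of "{x}"] by auto
  \<comment> \<open>Including membership in the finite sets makes \<open>P p\<close> finite, hence
    closed, so that its preimage \<open>Q p\<close> is closed.\<close>
  define P where "P p = {q. fst q \<in> N (fst p) \<and> snd q \<in> N (snd p) \<and> fst q \<noteq> snd q}" for p :: "'b \<times> 'b"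
  define Q where "Q p = {g :: 'b \<Rightarrow> 'c. (g (fst p), g (snd p)) \<in> P p}" for p
  have closedQ: "closed (Q p)" for p
  proof -
    have "P p \<subseteq> N (fst p) \<times> N (snd p)" by (auto simp: P_def)
    then have "finite (P p)" using fin finite_subset by blast
    then have "closed (P p)" by (rule finite_imp_closed)
    moreover have "continuous_on UNIV (\<lambda>g :: 'b \<Rightarrow> 'c. (g (fst p), g (snd p)))"
      by (intro continuous_on_Pair continuous_on_product_coordinates)
    ultimately have "closed ((\<lambda>g :: 'b \<Rightarrow> 'c. (g (fst p), g (snd p))) -` P p)"
      by (rule closed_vimage)
    then show ?thesis by (simp add: Q_def vimage_def)
  qed
  have "PiE UNIV N \<inter> \<Inter>(Q ` {p. fst p \<noteq> snd p}) \<noteq> {}"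
  proof (rule compact_imp_fip)
    show "compact (PiE UNIV N)" using fin by (intro compact_PiE_UNIV finite_imp_compact)
    show "closed T" if "T \<in> Q ` {p. fst p \<noteq> snd p}" for T using that closedQ by auto
    fix \<F> assume "finite \<F>" "\<F> \<subseteq> Q ` {p. fst p \<noteq> snd p}"
    then obtain I where I: "I \<subseteq> {p. fst p \<noteq> snd p}" "finite I" "\<F> = Q ` I"
      by (meson finite_subset_image)
    define A where "A = fst ` I \<union> snd ` I"
    have finA: "finite A" using I by (simp add: A_def)
    have "\<exists>g. inj_on g A \<and> (\<forall>x\<in>A. g x \<in> N x)"
      using finA fin by (intro Hall_finite Hall) (auto dest: finite_subset)
    then obtain g where g: "inj_on g A" "\<And>x. x \<in> A \<Longrightarrow> g x \<in> N x" by blast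
    define h where "h x = (if x \<in> A then g x else (SOME y. y \<in> N x))" for x
    have h: "h x \<in> N x" for x using g(2)[of x] ne[of x] by (auto simp: h_def some_in_eq)
    have "h \<in> Q p" if "p \<in> I" for p
    proof -
      have A: "fst p \<in> A" "snd p \<in> A" "fst p \<noteq> snd p" using that I by (auto simp: A_def)
      then have "h (fst p) \<noteq> h (snd p)" using inj_onD[OF g(1)] by (auto simp: h_def)
      then show ?thesis using h by (simp add: Q_def P_def)
    qed
    then have "h \<in> \<Inter>\<F>" unfolding I(3) by blast
    moreover have "h \<in> PiE UNIV N" using h by (simp add: PiE_iff)
    ultimately show "PiE UNIV N \<inter> \<Inter>\<F> \<noteq> {}" by blast
  qed
  then obtain g where g: "g \<in> PiE UNIV N" "\<And>p. fst p \<noteq> snd p \<Longrightarrow> g \<in> Q p" by blast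
  show ?thesis
  proof (rule that)
    show "inj g"
    proof (rule injI, rule ccontr)
      fix x y assume "g x = g y" "x \<noteq> y"
      then show False using g(2)[of "(x, y)"] by (simp add: Q_def P_def)
    qed
    show "g x \<in> N x" for x using g(1) by auto
  qed
qed

text \<open>The second conclusion is the point: at each \<open>x\<close> the bijection follows
  \<open>f\<close> or inverts \<open>g\<close>, so metric information about both injections passes
  to \<open>h\<close>.\<close>

lemma Schroeder_Bernstein_either:
  fixes f :: "'b \<Rightarrow> 'c" and g :: "'c \<Rightarrow> 'b"
  assumes f: "inj f" and g: "inj g"
  obtains h where "bij h" "\<And>x. h x = f x \<or> g (h x) = x"
proof -
  define X where "X = lfp (\<lambda>X. - (g ` (- (f ` X))))"
  have "mono (\<lambda>X. - (g ` (- (f ` X))))" by (auto simp: mono_def)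
  then have X: "X = - (g ` (- (f ` X)))" unfolding X_def by (rule lfp_unfold)
  define h where "h x = (if x \<in> X then f x else inv_into UNIV g x)" for x
  have out: "\<exists>y. y \<notin> f ` X \<and> x = g y \<and> h x = y" if "x \<notin> X" for x
  proof -
    from that X obtain y where y: "y \<notin> f ` X" "x = g y" by auto
    then have "h x = y" using that g by (simp add: h_def)
    with y show ?thesis by blast
  qed
  have "inj h"
  proof (rule injI)
    fix x y assume xy: "h x = h y"
    show "x = y"
    proof (cases "x \<in> X")
      case True
      then have hx: "h x = f x" by (simp add: h_def)
      have "y \<in> X" using out[of y] xy hx True by (metis imageI)
      then show ?thesis using xy hx f by (simp add: h_def inj_eq)
    next
      case False
      have "y \<notin> X" using out[OF False] xy by (auto simp: h_def)
      then show ?thesis using out[OF False] out[of y] xy by auto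
    qed
  qed
  moreover have "\<exists>x. h x = y" for y
  proof (cases "y \<in> f ` X")
    case True
    then show ?thesis by (auto simp: h_def)
  next
    case False
    then have "g y \<notin> X" using X by blast
    then have "h (g y) = y" using g by (simp add: h_def)
    then show ?thesis ..
  qed
  ultimately have "bij h" unfolding bij_def surj_def by metis
  moreover have "h x = f x \<or> g (h x) = x" for x
    using out[of x] by (cases "x \<in> X") (auto simp: h_def)
  ultimately show ?thesis using that by blast
qed

text \<open>\<open>U\<close> is within distance one half of a matrix \<open>V\<close> supported near the graph of \<open>f\<close>. As \<open>V\<close> is
  injective, it maps \<open>\<ell>\<^sub>2(A)\<close>, for finite \<open>A\<close>, injectively into \<open>\<ell>\<^sub>2\<close> of a neighbourhood of
  \<open>f(A)\<close>; this is Hall's condition.\<close>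

lemma injection_close_to_concentration:
  assumes ulf: "ulf TYPE('a::metric_space)" and U: "normalizes_Cu (U :: 'a mat)"
    and d: "0 < \<delta>" "\<And>x. \<delta> \<le> cmod (U (f x) x)"
    and fib: "\<And>x y. f x = f y \<Longrightarrow> dist x y \<le> S"
  obtains f' R where "inj f'" "\<And>x. dist (f' x) (f x) \<le> R"
proof -
  have uU: "unitary_op U" and bU: "bdd_op U" using U by (auto simp: normalizes_Cu_def unitary_op_def)
  obtain N :: nat and c where c: "\<And>x. c x < N" "\<And>i. inj_on f {x. c x = i}"
    by (rule injective_colouring[OF ulf, of f S]) (erule fib, blast)
  define A where "A i = (\<lambda>z y. if y \<in> f ` {x. c x = i} then U z (inv_into {x. c x = i} f y) else 0)" for i
  \<comment> \<open>One error for each of the \<open>N\<close> colours; together they stay below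
    1/2, and an error below 1 already forces \<open>V\<close> to have trivial kernel.\<close>
  define \<eta> where "\<eta> = 1 / (2 * (real N + 1))"
  have "0 < \<eta>" by (simp add: \<eta>_def add_nonneg_pos)
  have "A i \<in> Cu" for i unfolding A_def by (rule transported_columns_Cu[OF ulf U d c(2)])
  then have "\<exists>b R. prop_le R b \<and> norm_le \<eta> (mat_diff (A i) b)" for i
    using \<open>0 < \<eta>\<close> unfolding Cu_iff approx_le_def by blast
  then obtain b R where b: "\<And>i. prop_le (R i) (b i)" "\<And>i. norm_le \<eta> (mat_diff (A i) (b i))" by metis
  define R0 where "R0 = Max (R ` {..<N})"
  have R0: "R i \<le> R0" if "i < N" for i unfolding R0_def using that by (intro Max_ge) auto
  \<comment> \<open>Undoes the transport along \<open>f\<close>: column \<open>x\<close> of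
    \<open>V\<close> is column \<open>f x\<close> of the approximant for the colour of
    \<open>x\<close>, hence supported within \<open>R0\<close> of \<open>f x\<close>.\<close>
  define V where "V z x = b (c x) z (f x)" for z x
  have "norm_le (\<Sum>i<N. \<eta>) (\<lambda>z x. \<Sum>i<N. if x \<in> {x. c x = i} then mat_diff (A i) (b i) z (f x) else 0)"
    by (intro norm_le_sum norm_le_reindex_columns b c)
  also have "(\<lambda>z x. \<Sum>i<N. if x \<in> {x. c x = i} then mat_diff (A i) (b i) z (f x) else 0) = mat_diff U V"
  proof (intro ext)
    fix z x
    have "inv_into {x'. c x' = c x} f (f x) = x" by (rule inv_into_f_f[OF c(2)]) simp
    then have "A (c x) z (f x) = U z x" by (simp add: A_def)
    then show "(\<Sum>i<N. if x \<in> {x. c x = i} then mat_diff (A i) (b i) z (f x) else 0) = mat_diff U V z x"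
      using c(1)[of x] by (simp add: mat_diff_def V_def)
  qed
  finally have UV: "norm_le (1/2) (mat_diff U V)"
    by (rule norm_le_mono) (simp add: \<eta>_def field_simps)
  have bV: "bdd_op V" using bdd_op_if_norm_le_diff[OF bU UV] .
  have Vsupp: "V z x = 0" if "R0 < dist z (f x)" for z x
    using prop_leD[OF b(1)[of "c x"], of z "f x"] R0[OF c(1)[of x]] that by (simp add: V_def)
  obtain M :: nat where M: "\<And>x::'a. finite (cball x R0)" "\<And>x::'a. card (cball x R0) \<le> M"
    using ulfE[OF ulf] by blast
  have "card J \<le> card (\<Union>x\<in>J. cball (f x) R0)" if J: "finite J" for J
  proof (rule ccontr)
    assume "\<not> ?thesis"
    then have "card (\<Union>x\<in>J. cball (f x) R0) < card J" by simp
    moreover have finB: "finite (\<Union>x\<in>J. cball (f x) R0)" using J M(1) by auto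
    ultimately obtain v where v: "\<exists>x\<in>J. v x \<noteq> 0"
      "\<And>z. z \<in> (\<Union>x\<in>J. cball (f x) R0) \<Longrightarrow> (\<Sum>x\<in>J. V z x * v x) = 0"
      using homogeneous_system_solution[OF finB J, of V] by blast
    \<comment> \<open>The kernel vector is stored as a matrix with one nonzero column, at the
      arbitrary index \<open>undefined\<close>, so that the results on products of matrices apply to
      it.\<close>
    define w :: "'a mat" where "w = (\<lambda>x y. if x \<in> J \<and> y = undefined then v x else 0)"
    have "w = (\<lambda>x y. \<Sum>p\<in>J. mat_scale (v p) (mat_unit p undefined) x y)"
    proof (intro ext)
      fix x y
      show "w x y = (\<Sum>p\<in>J. mat_scale (v p) (mat_unit p undefined) x y)"
        using J by (cases "y = undefined")
          (simp_all add: w_def mat_scale_def mat_unit_def if_distrib[of "(*) _"] cong: if_cong)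
    qed
    moreover have "(\<lambda>x y. \<Sum>p\<in>J. mat_scale (v p) (mat_unit p undefined) x y) \<in> Cu"
      by (intro Cu_sum Cu_scale Cu_mat_unit)
    ultimately have bw: "bdd_op w" using Cu_bdd_op by simp
    have Vw: "mat_mult V w = (\<lambda>x y. 0)"
    proof (intro ext)
      fix z y
      have "((\<lambda>x. V z x * w x y) has_sum (\<Sum>x\<in>J. V z x * w x y)) UNIV"
        using J by (intro has_sum_finite_neutralI) (auto simp: w_def)
      then have "mat_mult V w z y = (\<Sum>x\<in>J. V z x * w x y)" by (simp add: mat_mult_def has_sum_iff)
      also have "\<dots> = 0"
      proof (cases "y = undefined \<and> z \<in> (\<Union>x\<in>J. cball (f x) R0)")
        case True
        then show ?thesis using v(2)[of z] by (simp add: w_def)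
      next
        case False
        then have "V z x * w x y = 0" if "x \<in> J" for x
          using that Vsupp[of z x] by (auto simp: w_def dist_commute not_le)
        then show ?thesis by (rule sum.neutral[rule_format])
      qed
      finally show "mat_mult V w z y = 0" .
    qed
    \<comment> \<open>As \<open>V w = 0\<close>, the vector \<open>U w = (U - V) w\<close> has at
      most half the norm of \<open>w\<close>, whereas \<open>U\<close> is isometric.\<close>
    have "mat_mult U w = mat_mult (mat_diff U V) w"
      using bU bV bw by (simp add: mat_mult_diff_left Vw) (simp add: mat_diff_def)
    then have "w = mat_mult (mat_adj U) (mat_mult (mat_diff U V) w)"
      using unitary_op_cancel(1)[OF uU bw] by simp
    moreover have "norm_le (1 * (1/2 * op_norm w)) (mat_mult (mat_adj U) (mat_mult (mat_diff U V) w))"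
      using unitary_op_norm_le[OF unitary_op_adj[OF uU]] by (intro norm_le_mult UV norm_le_op_norm bw)
    ultimately have "norm_le (1/2 * op_norm w) w" by simp
    then have "op_norm w \<le> 1/2 * op_norm w" by (rule op_norm_le)
    then have "op_norm w \<le> 0" by simp
    then have "norm_le 0 w" using norm_le_mono[OF norm_le_op_norm[OF bw]] by blast
    from norm_le_entry[OF this] have w0: "w x undefined = 0" for x by simp
    obtain x where "x \<in> J" "v x \<noteq> 0" using v(1) by blast
    with w0[of x] show False by (simp add: w_def)
  qed
  from Hall_locally_finite[of "\<lambda>x. cball (f x) R0", OF M(1) this]
  obtain f' where "inj f'" "\<And>x. f' x \<in> cball (f x) R0" by blast
  then show ?thesis using that[of f' R0] by (simp add: dist_commute)
qed

section \<open>Closeness of maps, and the bijection attached to a normalizing unitary\<close>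

lemma bornologous_close:
  assumes "bornologous f" "close h f"
  shows "bornologous h"
  unfolding bornologous_def
proof
  fix r
  obtain s where s: "\<And>x y. dist x y \<le> r \<Longrightarrow> dist (f x) (f y) \<le> s"
    using assms(1) unfolding bornologous_def by blast
  obtain C where C: "\<And>x. dist (h x) (f x) \<le> C" using assms(2) unfolding close_def by blast
  have "dist (h x) (h y) \<le> C + s + C" if "dist x y \<le> r" for x y
    using dist_triangle[of "h x" "h y" "f x"] dist_triangle[of "f x" "h y" "f y"] s[OF that] C[of x] C[of y]
    by (simp add: dist_commute)
  then show "\<exists>s. \<forall>x y. dist x y \<le> r \<longrightarrow> dist (h x) (h y) \<le> s" by blast
qed

lemma closeE:
  assumes "close f g"
  obtains C where "\<And>x. dist (f x) (g x) \<le> C"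
  using assms unfolding close_def by blast

lemma closeI: "(\<And>x. dist (f x) (g x) \<le> C) \<Longrightarrow> close f g"
  unfolding close_def by blast

lemma close_sym: "close f g \<Longrightarrow> close g f"
  unfolding close_def by (simp add: dist_commute)

lemma close_trans:
  assumes "close f g" "close g h"
  shows "close f h"
proof -
  obtain C D where "\<And>x. dist (f x) (g x) \<le> C" "\<And>x. dist (g x) (h x) \<le> D"
    using assms by (meson closeE)
  then show ?thesis by (intro closeI[of f h "C + D"]) (meson add_mono dist_triangle order_trans)
qed

lemma close_compose_left:
  assumes "bornologous k" "close f g"
  shows "close (k \<circ> f) (k \<circ> g)"
proof -
  obtain C where C: "\<And>x. dist (f x) (g x) \<le> C" using assms(2) unfolding close_def by blast
  obtain s where "\<And>x y. dist x y \<le> C \<Longrightarrow> dist (k x) (k y) \<le> s"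
    using assms(1) unfolding bornologous_def by blast
  then show ?thesis using C by (intro closeI[of _ _ s]) simp
qed

lemma close_compose_right: "close f g \<Longrightarrow> close (f \<circ> k) (g \<circ> k)"
  unfolding close_def by auto

lemma mat_mult_umat_adj:
  assumes "bij h"
  shows "mat_mult a (mat_adj (umat h)) z w = a z (inv_into UNIV h w)"
  unfolding mat_mult_def
  using assms by (subst infsum_single[of "inv_into UNIV h w"]) (auto simp: mat_adj_def umat_def bij_is_inj bij_is_surj surj_f_inv_f)

text \<open>Concentration is applied to \<open>U\<close> and to its adjoint; the injections close to
  \<open>f\<close> and \<open>g\<close> combine to a bijection. The product
  \<open>U u\<^sub>h\<^sup>*\<close> is then a finite sum over colours of transported columns
  followed by a correction of bounded propagation from \<open>f\<close> to \<open>h\<close>.\<close>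

theorem normalizer_decomposition:
  assumes ulf: "ulf TYPE('a::metric_space)" and U: "normalizes_Cu (U :: 'a mat)"
  obtains h where "bij h" "coarse_equiv h" "mat_mult U (mat_adj (umat h)) \<in> Cu"
proof -
  note U' = normalizes_Cu_adj[OF U]
  obtain \<delta> f where f: "0 < \<delta>" "\<And>x. \<delta> \<le> cmod (U (f x) x)" using columns_concentrated[OF ulf U] by blast
  obtain \<delta>' g where g: "0 < \<delta>'" "\<And>y. \<delta>' \<le> cmod (mat_adj U (g y) y)"
    using columns_concentrated[OF ulf U'] by blast
  have g': "\<delta>' \<le> cmod (U y (g y))" for y using g(2)[of y] by (simp add: mat_adj_def)
  have f': "\<delta> \<le> cmod (mat_adj U x (f x))" for x using f(2)[of x] by (simp add: mat_adj_def)
  have bf: "bornologous f" by (rule bornologous_if_concentrated[OF ulf U f])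
  have bg: "bornologous g" by (rule bornologous_if_concentrated[OF ulf U' g])
  have gf: "close (g \<circ> f) id" by (rule close_if_concentrated[OF ulf U f g(1) g'])
  have fg: "close (f \<circ> g) id" by (rule close_if_concentrated[OF ulf U' g f(1) f'])
  obtain C where C: "\<And>x. dist (g (f x)) x \<le> C" using closeE[OF gf] by auto
  obtain C' where C': "\<And>x. dist (f (g x)) x \<le> C'" using closeE[OF fg] by auto
  have fibf: "dist x y \<le> C + C" if "f x = f y" for x y
    using dist_triangle[of x y "g (f x)"] C[of x] C[of y] that by (simp add: dist_commute)
  have fibg: "dist x y \<le> C' + C'" if "g x = g y" for x y
    using dist_triangle[of x y "f (g x)"] C'[of x] C'[of y] that by (simp add: dist_commute)
  obtain f1 R where f1: "inj f1" "\<And>x. dist (f1 x) (f x) \<le> R"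
    by (rule injection_close_to_concentration[OF ulf U f, of "C + C"]) (erule fibf, blast)
  obtain g1 R' where g1: "inj g1" "\<And>x. dist (g1 x) (g x) \<le> R'"
    by (rule injection_close_to_concentration[OF ulf U' g, of "C' + C'"]) (erule fibg, blast)
  obtain h where h: "bij h" "\<And>x. h x = f1 x \<or> g1 (h x) = x"
    using Schroeder_Bernstein_either[OF f1(1) g1(1)] by blast
  \<comment> \<open>Where \<open>h\<close> inverts \<open>g1\<close>, the point
    \<open>f x = f (g1 (h x))\<close> is near \<open>h x\<close>, because
    \<open>f \<circ> g1\<close> is close to the identity.\<close>
  have hf: "close h f"
  proof -
    have "close (f \<circ> g1) (f \<circ> g)" by (intro close_compose_left bf closeI[of _ _ R'] g1(2))
    from close_trans[OF this fg] obtain D where D: "\<And>y. dist (f (g1 y)) y \<le> D"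
      unfolding close_def by auto
    have "dist (h x) (f x) \<le> max R D" for x
      using h(2)[of x] f1(2)[of x] D[of "h x"] by (auto simp: dist_commute le_max_iff_disj)
    then show ?thesis by (rule closeI)
  qed
  have "coarse_equiv h"
    unfolding coarse_equiv_def
  proof (intro conjI exI[of _ g])
    show "bornologous h" by (rule bornologous_close[OF bf hf])
    show "close (g \<circ> h) id" by (rule close_trans[OF close_compose_left[OF bg hf] gf])
    show "close (h \<circ> g) id" by (rule close_trans[OF close_compose_right[OF hf] fg])
  qed (rule bg)
  moreover have "mat_mult U (mat_adj (umat h)) \<in> Cu"
  proof -
    obtain N :: nat and c where c: "\<And>x. c x < N" "\<And>i. inj_on f {x. c x = i}"
      by (rule injective_colouring[OF ulf, of f "C + C"]) (erule fibf, blast)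
    define A where "A i = (\<lambda>z y. if y \<in> f ` {x. c x = i} then U z (inv_into {x. c x = i} f y) else 0)" for i
    \<comment> \<open>For \<open>x\<close> of colour \<open>i\<close>, \<open>B i\<close> sends the
      basis vector of \<open>h x\<close> to that of \<open>f x\<close>, and \<open>A i\<close> sends
      the latter to column \<open>x\<close> of \<open>U\<close>. The propagation of
      \<open>B i\<close> is bounded because \<open>h\<close> is close to \<open>f\<close>.\<close>
    define B :: "nat \<Rightarrow> 'a mat" where
      "B i = (\<lambda>y w. if c (inv_into UNIV h w) = i \<and> y = f (inv_into UNIV h w) then 1 else 0)" for i
    obtain D where D: "\<And>x. dist (h x) (f x) \<le> D" using hf unfolding close_def by blast
    have A: "A i \<in> Cu" for i unfolding A_def by (rule transported_columns_Cu[OF ulf U f c(2)])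
    have "B i \<in> prop_box D" for i
    proof -
      have "dist (f (inv_into UNIV h w)) w \<le> D" for w
        using D[of "inv_into UNIV h w"] h(1) by (simp add: bij_is_surj surj_f_inv_f dist_commute)
      then show ?thesis by (auto simp: prop_box_def prop_le_def B_def not_less[symmetric])
    qed
    then have B: "B i \<in> Cu" for i using prop_box_Cu[OF ulf] by blast
    have "mat_mult U (mat_adj (umat h)) = (\<lambda>z w. \<Sum>i<N. mat_mult (A i) (B i) z w)"
    proof (intro ext)
      fix z w
      let ?x = "inv_into UNIV h w"
      have "inv_into {x. c x = c ?x} f (f ?x) = ?x" by (rule inv_into_f_f[OF c(2)]) simp
      then have Ax: "A (c ?x) z (f ?x) = U z ?x" by (simp add: A_def)
      have "mat_mult (A i) (B i) z w = (if c ?x = i then U z ?x else 0)" for i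
        unfolding mat_mult_def
        by (subst infsum_single[of "f ?x"]) (use Ax in \<open>auto simp: B_def\<close>)
      then show "mat_mult U (mat_adj (umat h)) z w = (\<Sum>i<N. mat_mult (A i) (B i) z w)"
        using c(1)[of ?x] by (simp add: mat_mult_umat_adj[OF h(1)])
    qed
    moreover have "(\<lambda>z w. \<Sum>i<N. mat_mult (A i) (B i) z w) \<in> Cu" by (intro Cu_sum Cu_mult A B)
    ultimately show ?thesis by simp
  qed
  ultimately show ?thesis using that h(1) by blast
qed

section \<open>Automorphisms are spatial\<close>

lemma Ad_eq: "Ad U = restrict (conj_by U) Cu"
  by (simp add: Ad_def conj_by_def[abs_def])

lemma normalizes_Cu_conj:
  assumes "normalizes_Cu U" "a \<in> Cu"
  shows "conj_by U a \<in> Cu" "conj_by (mat_adj U) a \<in> Cu"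
    "conj_by U (conj_by (mat_adj U) a) = a" "conj_by (mat_adj U) (conj_by U a) = a"
  using assms by (auto simp: normalizes_Cu_def unitary_op_def conj_by_conj_by Cu_bdd_op)

lemma star_aut_Ad:
  assumes U: "normalizes_Cu U"
  shows "star_aut (Ad U)"
  unfolding star_aut_def
proof (intro conjI ballI allI)
  have uU: "unitary_op U" and bU: "bdd_op U" using U by (auto simp: normalizes_Cu_def unitary_op_def)
  show "Ad U \<in> extensional Cu" by (simp add: Ad_eq)
  show "bij_betw (Ad U) Cu Cu"
    by (rule bij_betw_byWitness[where f' = "conj_by (mat_adj U)"])
      (use normalizes_Cu_conj[OF U] in \<open>auto simp: Ad_eq\<close>)
  fix a b :: "'a mat" and c assume a: "a \<in> Cu" and b: "b \<in> Cu"
  show "Ad U (mat_add a b) = mat_add (Ad U a) (Ad U b)"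
    using a b bU by (simp add: Ad_eq Cu_add Cu_bdd_op conj_by_add)
  show "Ad U (mat_mult a b) = mat_mult (Ad U a) (Ad U b)"
    using a b uU by (simp add: Ad_eq Cu_mult Cu_bdd_op conj_by_mult)
next
  fix c and a :: "'a mat" assume a: "a \<in> Cu"
  show "Ad U (mat_scale c a) = mat_scale c (Ad U a)"
    using a by (simp add: Ad_eq Cu_scale conj_by_scale)
next
  fix a :: "'a mat" assume a: "a \<in> Cu"
  show "Ad U (mat_adj a) = mat_adj (Ad U a)"
    using a normalizes_Cu_bdd[OF U] by (simp add: Ad_eq Cu_adj Cu_bdd_op conj_by_adj)
qed

lemma star_autD:
  assumes "star_aut \<phi>"
  shows "\<phi> \<in> extensional Cu" and bij: "bij_betw \<phi> Cu Cu" and "\<And>a. a \<in> Cu \<Longrightarrow> \<phi> a \<in> Cu"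
    and "\<And>a b. a \<in> Cu \<Longrightarrow> b \<in> Cu \<Longrightarrow> \<phi> (mat_add a b) = mat_add (\<phi> a) (\<phi> b)"
    "\<And>c a. a \<in> Cu \<Longrightarrow> \<phi> (mat_scale c a) = mat_scale c (\<phi> a)"
    "\<And>a b. a \<in> Cu \<Longrightarrow> b \<in> Cu \<Longrightarrow> \<phi> (mat_mult a b) = mat_mult (\<phi> a) (\<phi> b)"
    "\<And>a. a \<in> Cu \<Longrightarrow> \<phi> (mat_adj a) = mat_adj (\<phi> a)"
proof -
  note sa = assms[unfolded star_aut_def]
  from sa show "\<phi> \<in> extensional Cu" by (elim conjE)
  from sa show bij: "bij_betw \<phi> Cu Cu" by (elim conjE)
  show "\<phi> a \<in> Cu" if "a \<in> Cu" for a using bij_betw_apply[OF bij that] .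
  from sa show "\<phi> (mat_add a b) = mat_add (\<phi> a) (\<phi> b)" if "a \<in> Cu" "b \<in> Cu" for a b
    using that by (elim conjE) blast
  from sa show "\<phi> (mat_scale c a) = mat_scale c (\<phi> a)" if "a \<in> Cu" for c a
    using that by (elim conjE) blast
  from sa show "\<phi> (mat_mult a b) = mat_mult (\<phi> a) (\<phi> b)" if "a \<in> Cu" "b \<in> Cu" for a b
    using that by (elim conjE) blast
  from sa show "\<phi> (mat_adj a) = mat_adj (\<phi> a)" if "a \<in> Cu" for a
    using that by (elim conjE) blast
qed

lemma star_aut_surj:
  assumes "star_aut \<phi>" "a \<in> Cu"
  obtains b where "b \<in> Cu" "\<phi> b = a"
proof -
  have "a \<in> \<phi> ` Cu" by (subst bij_betw_imp_surj_on[OF star_autD(2)[OF assms(1)]]) (rule assms(2))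
  then show ?thesis using that by blast
qed

lemma star_aut_id:
  assumes \<phi>: "star_aut \<phi>"
  shows "\<phi> mat_id = mat_id"
proof -
  obtain e where e: "e \<in> Cu" "\<phi> e = mat_id" using star_aut_surj[OF \<phi> Cu_id] .
  have "\<phi> (mat_mult mat_id e) = mat_mult (\<phi> mat_id) (\<phi> e)" by (intro star_autD(6)[OF \<phi>] Cu_id e)
  then show ?thesis using e by simp
qed

text \<open>With \<open>k = \<phi>(e\<^sub>0\<^sub>0)\<^sub>p\<^sub>p > 0\<close>, the vectors \<open>\<phi>(e\<^sub>x\<^sub>0) \<delta>\<^sub>p / \<surd>k\<close> are the columns of the implementing
  unitary.\<close>

lemma star_aut_spatial:
  assumes \<phi>: "star_aut (\<phi> :: ('a::metric_space) mat \<Rightarrow> 'a mat)"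
  obtains U where "normalizes_Cu U" "\<phi> = Ad U"
proof -
  note phi = star_autD[OF \<phi>]
  define o' :: 'a where "o' = undefined"
  define W where "W x = \<phi> (mat_unit x o')" for x
  have W: "W x \<in> Cu" for x unfolding W_def by (intro phi Cu_mat_unit)
  have bW: "bdd_op (W x)" for x using Cu_bdd_op[OF W] .
  define P where "P = W o'"
  have bP: "bdd_op P" using bW by (simp add: P_def)
  have unit_mult: "mat_mult (mat_unit w x) (mat_mult a (mat_unit y z)) = mat_scale (a x y) (mat_unit w z)"
    for w x y z :: 'a and a
    by (intro ext, subst mat_mult_unit_left, subst mat_mult_unit_right) (auto simp: mat_scale_def mat_unit_def)
  \<comment> \<open>Pulled back through \<open>\<phi>\<close>, the product is
    \<open>e\<^sub>0\<^sub>z a e\<^sub>x\<^sub>0\<close>, which is the scalar \<open>a z x\<close>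
    times \<open>e\<^sub>0\<^sub>0\<close>.\<close>
  have WaW: "mat_mult (mat_adj (W z)) (mat_mult (\<phi> a) (W x)) = mat_scale (a z x) P" if a: "a \<in> Cu" for a x z
  proof -
    have "mat_mult (mat_adj (W z)) (mat_mult (\<phi> a) (W x)) = \<phi> (mat_mult (mat_adj (mat_unit z o')) (mat_mult a (mat_unit x o')))"
      unfolding W_def using a by (simp only: phi Cu_mat_unit Cu_mult Cu_adj)
    also have "\<dots> = \<phi> (mat_scale (a z x) (mat_unit o' o'))" by (simp add: unit_mult)
    finally show ?thesis using phi(5)[OF Cu_mat_unit[of o' o'], of "a z x"] by (simp add: P_def W_def)
  qed
  have WW: "mat_mult (mat_adj (W z)) (W x) = mat_scale (mat_id z x) P" for x z
    using WaW[OF Cu_id, of z x] by (simp add: star_aut_id[OF \<phi>])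
  have Padj: "mat_adj P = P" using phi(7)[OF Cu_mat_unit[of o' o']] by (simp add: P_def W_def)
  have PP: "mat_mult (mat_adj P) P = P"
    using WW[of o' o'] by (simp add: P_def mat_scale_def mat_id_def)
  have col: "((\<lambda>z. (cmod (P z x))\<^sup>2) has_sum Re (P x x)) UNIV" for x
    using adj_mult_self_diag[OF bP, of x] by (simp add: PP)
  \<comment> \<open>\<open>P\<close> is a projection, so its diagonal entries are the squared norms
    of its columns. If none were positive, \<open>P\<close> would vanish, contradicting injectivity
    of \<open>\<phi>\<close>.\<close>
  have "\<exists>p. 0 < Re (P p p)"
  proof (rule ccontr)
    assume "\<not> ?thesis"
    then have le: "Re (P x x) \<le> 0" for x by (simp add: not_less)
    have "P z x = 0" for z x
    proof -
      have "(\<Sum>z\<in>{z}. (cmod (P z x))\<^sup>2) \<le> Re (P x x)" by (rule finite_sum_le_has_sum[OF col]) auto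
      from order_trans[OF this le] show ?thesis by simp
    qed
    then have "P = mat_scale 0 P" by (intro ext) (simp add: mat_scale_def)
    then have "\<phi> (mat_unit o' o') = \<phi> (mat_scale 0 (mat_unit o' o'))"
      using phi(5)[OF Cu_mat_unit[of o' o'], of 0] by (simp add: P_def W_def)
    then have "mat_unit o' o' = mat_scale 0 (mat_unit o' o')"
      using inj_onD[OF bij_betw_imp_inj_on[OF phi(2)]] Cu_mat_unit Cu_scale by metis
    from fun_cong[OF fun_cong[OF this, of o'], of o'] show False by (simp add: mat_unit_def mat_scale_def)
  qed
  then obtain p where p: "0 < Re (P p p)" by blast
  define k where "k = Re (P p p)"
  have k: "0 < k" using p by (simp add: k_def)
  have "cnj (P p p) = P p p" using fun_cong[OF fun_cong[OF Padj, of p], of p] by (simp add: mat_adj_def)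
  then have Pk: "P p p = of_real k" by (simp add: k_def complex_eq_iff)
  \<comment> \<open>Column \<open>p\<close> of every \<open>W x\<close> has squared norm
    \<open>P p p = k\<close>, since \<open>W\<^sub>x\<^sup>* W\<^sub>x = P\<close>.\<close>
  define s :: complex where "s = of_real (1 / sqrt k)"
  have ss: "s * s * of_real k = 1" using k unfolding s_def of_real_mult[symmetric] by simp
  have s_cnj: "cnj s = s" by (simp add: s_def)
  define U where "U y x = s * W x y p" for y x
  have cU: "mat_mult c U y x = s * mat_mult c (W x) y p" for c y x
    unfolding mat_mult_def U_def by (simp add: mult.left_commute[of _ s] infsum_cmult_right')
  have UcU: "mat_mult (mat_adj U) (mat_mult c U) z x = s * s * mat_mult (mat_adj (W z)) (mat_mult c (W x)) p p" for c z x
  proof -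
    have "mat_mult (mat_adj U) (mat_mult c U) z x = (\<Sum>\<^sub>\<infinity>t. cnj (U t z) * mat_mult c U t x)"
      unfolding mat_mult_def[of "mat_adj U"] by (simp add: mat_adj_def)
    also have "\<dots> = (\<Sum>\<^sub>\<infinity>t. (s * s) * (cnj (W z t p) * mat_mult c (W x) t p))"
      by (intro infsum_cong) (simp add: cU U_def s_cnj mult_ac)
    also have "\<dots> = s * s * (\<Sum>\<^sub>\<infinity>t. cnj (W z t p) * mat_mult c (W x) t p)" by (rule infsum_cmult_right')
    finally show ?thesis unfolding mat_mult_def[of "mat_adj (W z)"] by (simp add: mat_adj_def)
  qed
  have UphiU: "mat_mult (mat_adj U) (mat_mult (\<phi> a) U) = a" if "a \<in> Cu" for a
    by (intro ext) (use ss in \<open>simp add: UcU WaW[OF that] mat_scale_def Pk mult_ac\<close>)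
  have UU: "mat_mult (mat_adj U) U = mat_id" using UphiU[OF Cu_id] by (simp add: star_aut_id[OF \<phi>])
  have colU: "ell2 (\<lambda>y. U y x)" for x
  proof -
    obtain C where "norm_le C (W x)" using bW by (rule bdd_opE)
    then show ?thesis unfolding U_def by (intro ell2_scale norm_le_col)
  qed
  have iso: "((\<lambda>y. cnj (U y x) * U y x') has_sum (if x = x' then 1 else 0)) UNIV" for x x'
  proof -
    have "ell2 (\<lambda>y. cnj (U y x))" using colU[of x] by (simp add: ell2_def)
    then have "((\<lambda>y. cnj (U y x) * U y x') has_sum (\<Sum>\<^sub>\<infinity>y. cnj (U y x) * U y x')) UNIV"
      using ell2_mult_summable[OF _ colU[of x']] by simp
    also have "(\<Sum>\<^sub>\<infinity>y. cnj (U y x) * U y x') = mat_mult (mat_adj U) U x x'" by (simp add: mat_mult_def mat_adj_def)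
    finally show ?thesis by (simp add: UU mat_id_def)
  qed
  have bU: "bdd_op U" using bdd_opI[OF norm_le_isometry[OF iso]] .
  \<comment> \<open>So far \<open>U\<close> is only an isometry. That its range projection
    \<open>Q\<close> is the identity will use surjectivity of \<open>\<phi>\<close>, through
    preimages of matrix units.\<close>
  define Q where "Q = mat_mult U (mat_adj U)"
  have bQ: "bdd_op Q" using bU by (simp add: Q_def)
  have QQ: "mat_mult (mat_adj Q) Q = Q"
  proof -
    have "mat_mult (mat_adj U) (mat_mult U (mat_adj U)) = mat_adj U"
      using mat_mult_assoc[of "mat_adj U" U "mat_adj U"] bU by (simp add: UU)
    then show ?thesis using bU by (simp add: Q_def mat_adj_mult mat_mult_assoc)
  qed
  obtain q where q: "U q o' \<noteq> 0"
  proof -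
    have "\<exists>q. U q o' \<noteq> 0"
    proof (rule ccontr)
      assume "\<not> ?thesis"
      then have "((\<lambda>_. 0) has_sum (1::complex)) (UNIV :: 'a set)" using iso[of o' o'] by simp
      from has_sum_unique[OF this has_sum_0_simp] show False by simp
    qed
    then show ?thesis using that by blast
  qed
  have Qdiag: "Q y y = 1" for y
  proof -
    \<comment> \<open>The compressions by \<open>U\<close> of \<open>?c ?d\<close> and of
      \<open>?c Q ?d\<close> coincide: both equal \<open>a b\<close>, the first by multiplicativity
      of \<open>\<phi>\<close>, the second as the product of the compressions of \<open>?c\<close>
      and \<open>?d\<close>. Since \<open>?c Q ?d\<close> is \<open>Q y y\<close> times
      \<open>?c ?d\<close>, and the choice of \<open>q\<close> makes the compression nonzero,
      \<open>Q y y = 1\<close>.\<close>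
    let ?c = "mat_unit q y" and ?d = "mat_unit y q"
    have bcd: "bdd_op ?c" "bdd_op ?d" by (intro Cu_bdd_op Cu_mat_unit)+
    obtain a where a: "a \<in> Cu" "\<phi> a = ?c" using star_aut_surj[OF \<phi> Cu_mat_unit] .
    obtain b where b: "b \<in> Cu" "\<phi> b = ?d" using star_aut_surj[OF \<phi> Cu_mat_unit] .
    have "mat_mult (mat_adj U) (mat_mult (mat_mult ?c ?d) U) = mat_mult a b"
      using UphiU[OF Cu_mult[OF a(1) b(1)]] phi(6)[OF a(1) b(1)] a(2) b(2) by simp
    also have "\<dots> = mat_mult (mat_mult (mat_adj U) (mat_mult ?c U)) (mat_mult (mat_adj U) (mat_mult ?d U))"
      using UphiU[OF a(1)] UphiU[OF b(1)] a(2) b(2) by simp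
    also have "\<dots> = mat_mult (mat_adj U) (mat_mult (mat_mult ?c (mat_mult Q ?d)) U)"
      using bU bcd by (simp add: Q_def mat_mult_assoc)
    finally have eq: "mat_mult (mat_adj U) (mat_mult (mat_mult ?c ?d) U) o' o'
        = mat_mult (mat_adj U) (mat_mult (mat_mult ?c (mat_mult Q ?d)) U) o' o'" by simp
    have "mat_mult ?c ?d = mat_unit q q"
      by (intro ext, subst mat_mult_unit_left) (auto simp: mat_unit_def)
    moreover have UqU: "mat_mult (mat_adj U) (mat_mult (mat_unit q q) U) o' o' = cnj (U q o') * U q o'"
      unfolding mat_mult_def[of "mat_adj U"]
      by (subst infsum_single[of q]) (auto simp: mat_mult_unit_left mat_adj_def)
    ultimately have "cnj (U q o') * U q o' = Q y y * (cnj (U q o') * U q o')"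
      using eq by (simp add: unit_mult mat_mult_scale_left mat_mult_scale_right) (simp add: mat_scale_def)
    then show ?thesis using q by simp
  qed
  \<comment> \<open>Column \<open>y\<close> of the projection has squared norm
    \<open>Q y y = 1\<close>, which the diagonal entry already exhausts.\<close>
  have "Q z y = 0" if "z \<noteq> y" for z y
  proof -
    have "((\<lambda>z. (cmod (Q z y))\<^sup>2) has_sum 1) UNIV"
      using adj_mult_self_diag[OF bQ, of y] by (simp add: QQ Qdiag)
    from finite_sum_le_has_sum[OF this, of "{y, z}"] show ?thesis using that Qdiag[of y] by simp
  qed
  then have Qid: "Q = mat_id" using Qdiag by (intro ext) (auto simp: mat_id_def)
  have uU: "unitary_op U" using bU UU Qid by (simp add: unitary_op_def Q_def)
  have phi_eq: "\<phi> a = conj_by U a" if "a \<in> Cu" for a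
  proof -
    have "conj_by U a = conj_by U (mat_mult (mat_adj U) (mat_mult (\<phi> a) U))" using UphiU[OF that] by simp
    also have "\<dots> = mat_mult (mat_mult U (mat_adj U)) (mat_mult (\<phi> a) (mat_mult U (mat_adj U)))"
      using bU Cu_bdd_op[OF phi(3)[OF that]] by (simp add: conj_by_def mat_mult_assoc)
    also have "\<dots> = \<phi> a" using Qid by (simp add: Q_def)
    finally show ?thesis by simp
  qed
  have "normalizes_Cu U"
    unfolding normalizes_Cu_def
  proof (intro conjI ballI uU)
    fix a :: "'a mat" assume a: "a \<in> Cu"
    show "conj_by U a \<in> Cu" using phi_eq[OF a] phi(3)[OF a] by simp
    obtain b where b: "b \<in> Cu" "\<phi> b = a" using star_aut_surj[OF \<phi> a] .
    have "conj_by (mat_adj U) a = b"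
      using UphiU[OF b(1)] b(2) bU Cu_bdd_op[OF a] by (simp add: conj_by_def mat_mult_assoc)
    then show "conj_by (mat_adj U) a \<in> Cu" using b(1) by simp
  qed
  moreover have "\<phi> = Ad U"
  proof
    fix a show "\<phi> a = Ad U a"
      using phi_eq[of a] phi(1) by (cases "a \<in> Cu") (auto simp: Ad_eq extensional_def)
  qed
  ultimately show ?thesis using that by blast
qed

section \<open>The groups\<close>

lemma star_aut_compose:
  assumes "star_aut \<phi>" "star_aut \<psi>"
  shows "star_aut (compose Cu \<phi> \<psi>)"
  using star_autD[OF assms(1)] star_autD[OF assms(2)] unfolding star_aut_def
  by (auto simp: compose_eq Cu_add Cu_scale Cu_mult Cu_adj intro: bij_betw_compose)

lemma star_aut_inv_into:
  assumes \<phi>: "star_aut \<phi>"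
  shows "star_aut (restrict (inv_into Cu \<phi>) Cu)"
proof -
  note phi = star_autD[OF \<phi>]
  let ?\<psi> = "inv_into Cu \<phi>"
  have psi: "?\<psi> a \<in> Cu" "\<phi> (?\<psi> a) = a" if "a \<in> Cu" for a
    using that phi(2) by (auto simp: bij_betw_def inv_into_into f_inv_into_f)
  have psi_eq: "?\<psi> a = b" if "b \<in> Cu" "a = \<phi> b" for a b
    using that phi(2) by (simp add: bij_betw_def)
  show ?thesis unfolding star_aut_def
  proof (intro conjI ballI allI)
    show "restrict ?\<psi> Cu \<in> extensional Cu" by simp
    show "bij_betw (restrict ?\<psi> Cu) Cu Cu"
      using bij_betw_inv_into[OF phi(2)] by (simp add: bij_betw_def inj_on_def)
  qed (auto simp: Cu_add Cu_scale Cu_mult Cu_adj psi phi intro!: psi_eq)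
qed

lemma Ad_id: "Ad mat_id = restrict id Cu"
  by (simp add: Ad_eq restrict_def fun_eq_iff)

lemma unitary_CuD:
  assumes "unitary_Cu u"
  shows "u \<in> Cu" "normalizes_Cu u"
proof -
  show u: "u \<in> Cu" using assms by (simp add: unitary_Cu_def)
  then show "normalizes_Cu u" using assms
    by (auto simp: unitary_Cu_def normalizes_Cu_def unitary_op_def Cu_bdd_op conj_by_def intro!: Cu_mult Cu_adj)
qed

lemma unitary_CuI: "unitary_op u \<Longrightarrow> u \<in> Cu \<Longrightarrow> unitary_Cu u"
  by (simp add: unitary_Cu_def unitary_op_def)

lemma unitary_op_mult:
  assumes "unitary_op u" "unitary_op v"
  shows "unitary_op (mat_mult u v)"
  using assms unitary_op_cancel[OF assms(1)] unitary_op_cancel[OF assms(2)]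
  by (simp add: unitary_op_def mat_adj_mult mat_mult_assoc)

lemma unitary_Cu_mult: "unitary_Cu u \<Longrightarrow> unitary_Cu v \<Longrightarrow> unitary_Cu (mat_mult u v)"
  by (intro unitary_CuI unitary_op_mult Cu_mult) (auto dest: unitary_CuD simp: normalizes_Cu_def)

lemma unitary_Cu_adj: "unitary_Cu u \<Longrightarrow> unitary_Cu (mat_adj u)"
  by (simp add: unitary_Cu_def Cu_adj)

lemma compose_Ad:
  assumes "normalizes_Cu U" "normalizes_Cu V"
  shows "compose Cu (Ad U) (Ad V) = Ad (mat_mult U V)"
  using normalizes_Cu_conj(1)[OF assms(2)] normalizes_Cu_bdd[OF assms(1)] normalizes_Cu_bdd[OF assms(2)]
  by (intro ext) (simp add: Ad_eq compose_def conj_by_conj_by Cu_bdd_op)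

lemma AutG_simps [simp]:
  "carrier AutG = {\<phi>. star_aut \<phi>}" "\<phi> \<otimes>\<^bsub>AutG\<^esub> \<psi> = compose Cu \<phi> \<psi>" "\<one>\<^bsub>AutG\<^esub> = restrict id Cu"
  by (simp_all add: AutG_def)

lemma group_AutG: "group (AutG :: (('a::metric_space) mat \<Rightarrow> 'a mat) monoid)"
proof (rule groupI; (simp only: AutG_simps mem_Collect_eq)?)
  have "unitary_Cu mat_id" by (simp add: unitary_Cu_def Cu_id)
  then show "star_aut (restrict id Cu :: 'a mat \<Rightarrow> 'a mat)"
    using star_aut_Ad[OF unitary_CuD(2)] by (metis Ad_id)
  fix \<phi> \<psi> \<theta> :: "'a mat \<Rightarrow> 'a mat" assume \<phi>: "star_aut \<phi>"
  show "compose Cu (restrict id Cu) \<phi> = \<phi>"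
    using star_autD(1,3)[OF \<phi>] by (intro ext) (auto simp: compose_def extensional_def)
  show "\<exists>\<psi>\<in>{\<phi>. star_aut \<phi>}. compose Cu \<psi> \<phi> = restrict id Cu"
    using star_aut_inv_into[OF \<phi>] compose_inv_into_id[OF star_autD(2)[OF \<phi>]]
    by (intro bexI[of _ "restrict (inv_into Cu \<phi>) Cu"]) (simp_all add: id_def)
  assume \<psi>: "star_aut \<psi>"
  show "star_aut (compose Cu \<phi> \<psi>)" by (rule star_aut_compose[OF \<phi> \<psi>])
  assume \<theta>: "star_aut \<theta>"
  show "compose Cu (compose Cu \<phi> \<psi>) \<theta> = compose Cu \<phi> (compose Cu \<psi> \<theta>)"
    using star_autD(3)[OF \<theta>] by (intro ext) (auto simp: compose_def)
qed

lemma Inn_normal: "(Inn :: (('a::metric_space) mat \<Rightarrow> 'a mat) set) \<lhd> AutG"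
proof -
  interpret G: group "AutG :: ('a mat \<Rightarrow> 'a mat) monoid" by (rule group_AutG)
  have mem: "Ad u \<in> Inn" if "unitary_Cu u" for u :: "'a mat" using that by (auto simp: Inn_def)
  have car: "Ad u \<in> carrier AutG" if "unitary_Cu u" for u :: "'a mat"
    using star_aut_Ad[OF unitary_CuD(2)[OF that]] by simp
  have "subgroup (Inn :: ('a mat \<Rightarrow> 'a mat) set) AutG"
  proof (rule G.subgroupI)
    show "Inn \<subseteq> carrier (AutG :: ('a mat \<Rightarrow> 'a mat) monoid)" using car by (auto simp: Inn_def)
    have "unitary_Cu (mat_id :: 'a mat)" by (simp add: unitary_Cu_def Cu_id)
    then show "Inn \<noteq> ({} :: ('a mat \<Rightarrow> 'a mat) set)" using mem by blast
    fix \<phi> :: "'a mat \<Rightarrow> 'a mat" assume "\<phi> \<in> Inn"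
    then obtain u where u: "unitary_Cu u" "\<phi> = Ad u" by (auto simp: Inn_def)
    have u': "unitary_Cu (mat_adj u)" using unitary_Cu_adj[OF u(1)] .
    have "Ad (mat_adj u) \<otimes>\<^bsub>AutG\<^esub> Ad u = \<one>\<^bsub>AutG\<^esub>"
      using u(1) by (simp add: compose_Ad unitary_CuD[OF u(1)] unitary_CuD[OF u'] unitary_Cu_def flip: Ad_id)
    then have "inv\<^bsub>AutG\<^esub> \<phi> = Ad (mat_adj u)" using G.inv_equality car[OF u(1)] car[OF u'] u(2) by blast
    then show "inv\<^bsub>AutG\<^esub> \<phi> \<in> Inn" using mem[OF u'] by simp
    fix \<psi> :: "'a mat \<Rightarrow> 'a mat" assume "\<psi> \<in> Inn"
    then obtain v where v: "unitary_Cu v" "\<psi> = Ad v" by (auto simp: Inn_def)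
    show "\<phi> \<otimes>\<^bsub>AutG\<^esub> \<psi> \<in> Inn"
      using mem[OF unitary_Cu_mult[OF u(1) v(1)]]
      by (simp add: u(2) v(2) compose_Ad unitary_CuD[OF u(1)] unitary_CuD[OF v(1)])
  qed
  moreover have "\<phi> \<otimes>\<^bsub>AutG\<^esub> \<psi> \<otimes>\<^bsub>AutG\<^esub> inv\<^bsub>AutG\<^esub> \<phi> \<in> Inn"
    if \<phi>: "\<phi> \<in> carrier AutG" and \<psi>: "\<psi> \<in> Inn" for \<phi> \<psi> :: "'a mat \<Rightarrow> 'a mat"
  proof -
    obtain u where u: "unitary_Cu u" "\<psi> = Ad u" using \<psi> by (auto simp: Inn_def)
    note uCu = unitary_CuD(1)[OF u(1)]
    have sa: "star_aut \<phi>" using \<phi> by simp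
    note phi = star_autD[OF sa]
    have "\<phi> (mat_mult u (mat_adj u)) = mat_mult (\<phi> u) (mat_adj (\<phi> u))"
      "\<phi> (mat_mult (mat_adj u) u) = mat_mult (mat_adj (\<phi> u)) (\<phi> u)"
      using uCu by (simp_all add: phi Cu_adj)
    then have pu: "unitary_Cu (\<phi> u)"
      using u(1) phi(3)[OF uCu] star_aut_id[OF sa] by (simp add: unitary_Cu_def)
    \<comment> \<open>An automorphism carries conjugation by \<open>u\<close> to conjugation by
      \<open>\<phi> u\<close>, again a unitary of the algebra.\<close>
    have "\<phi> \<otimes>\<^bsub>AutG\<^esub> \<psi> = Ad (\<phi> u) \<otimes>\<^bsub>AutG\<^esub> \<phi>"
      using uCu by (intro ext) (auto simp: u(2) compose_def Ad_eq conj_by_def phi Cu_mult Cu_adj)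
    then have "\<phi> \<otimes>\<^bsub>AutG\<^esub> \<psi> \<otimes>\<^bsub>AutG\<^esub> inv\<^bsub>AutG\<^esub> \<phi> = Ad (\<phi> u) \<otimes>\<^bsub>AutG\<^esub> \<phi> \<otimes>\<^bsub>AutG\<^esub> inv\<^bsub>AutG\<^esub> \<phi>"
      by simp
    also have "\<dots> = Ad (\<phi> u)"
      using G.m_assoc[OF car[OF pu] \<phi> G.inv_closed[OF \<phi>]] G.r_inv[OF \<phi>] G.r_one[OF car[OF pu]] by metis
    finally show ?thesis using mem[OF pu] by simp
  qed
  ultimately show ?thesis using G.normal_inv_iff by blast
qed

lemma bornologous_comp: "bornologous f \<Longrightarrow> bornologous g \<Longrightarrow> bornologous (f \<circ> g)"
  unfolding bornologous_def comp_def by meson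

text \<open>A coarse inverse of a bijection is close to its actual inverse, and closeness preserves
  being bornologous. In this form the group axioms are immediate.\<close>

lemma bij_coarse_equiv_iff:
  assumes f: "bij f"
  shows "coarse_equiv f \<longleftrightarrow> bornologous f \<and> bornologous (inv_into UNIV f)"
proof
  assume "coarse_equiv f"
  then obtain g where g: "bornologous f" "bornologous g" "close (g \<circ> f) id"
    unfolding coarse_equiv_def by blast
  have "close (inv_into UNIV f) g"
  proof (rule close_sym)
    have "close (g \<circ> f \<circ> inv_into UNIV f) (id \<circ> inv_into UNIV f)" by (rule close_compose_right[OF g(3)])
    moreover have "g \<circ> f \<circ> inv_into UNIV f = g" using f by (auto simp: fun_eq_iff bij_is_surj surj_f_inv_f)
    ultimately show "close g (inv_into UNIV f)" by simp
  qed
  then show "bornologous f \<and> bornologous (inv_into UNIV f)" using g bornologous_close by blast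
next
  assume "bornologous f \<and> bornologous (inv_into UNIV f)"
  moreover have "close (inv_into UNIV f \<circ> f) id" "close (f \<circ> inv_into UNIV f) id"
    using f by (auto simp: close_def bij_is_inj bij_is_surj surj_f_inv_f intro: exI[of _ 0])
  ultimately show "coarse_equiv f" unfolding coarse_equiv_def by blast
qed

lemma BijCoaG0_simps [simp]:
  "carrier BijCoaG0 = {f. bij f \<and> coarse_equiv f}" "f \<otimes>\<^bsub>BijCoaG0\<^esub> g = f \<circ> g" "\<one>\<^bsub>BijCoaG0\<^esub> = id"
  by (simp_all add: BijCoaG0_def)

lemma bornologous_id: "bornologous id"
  unfolding bornologous_def by auto

lemma group_BijCoaG0: "group (BijCoaG0 :: (('a::metric_space) \<Rightarrow> 'a) monoid)"
proof (rule groupI; (simp only: BijCoaG0_simps mem_Collect_eq)?)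
  show "bij id \<and> coarse_equiv (id :: 'a \<Rightarrow> 'a)"
    by (simp add: bij_coarse_equiv_iff bornologous_id del: id_apply)
  fix f g h :: "'a \<Rightarrow> 'a" assume f: "bij f \<and> coarse_equiv f"
  show "id \<circ> f = f" by simp
  show "\<exists>g\<in>{f. bij f \<and> coarse_equiv f}. g \<circ> f = id"
    using f by (intro bexI[of _ "inv_into UNIV f"])
      (auto simp: bij_coarse_equiv_iff bij_imp_bij_inv inv_inv_eq bij_is_inj)
  assume g: "bij g \<and> coarse_equiv g"
  show "bij (f \<circ> g) \<and> coarse_equiv (f \<circ> g)"
    using f g by (auto simp: bij_coarse_equiv_iff bij_comp o_inv_distrib intro: bornologous_comp)
  show "f \<circ> g \<circ> h = f \<circ> (g \<circ> h)" by (rule comp_assoc)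
qed

section \<open>The canonical homomorphism\<close>

lemma norm_le_umat:
  assumes "inj f"
  shows "norm_le 1 (umat f)"
proof -
  have "norm_le 1 (\<lambda>z x. if x \<in> UNIV then (mat_id :: 'a mat) z (f x) else 0)"
    unfolding mat_id_eq using assms by (intro norm_le_reindex_columns norm_le_diag_mat) auto
  then show ?thesis by (simp add: umat_def mat_id_def)
qed

lemma umat_comp: "umat (f \<circ> g) = mat_mult (umat f) (umat g)"
  unfolding mat_mult_def by (intro ext, subst infsum_single[of "g _"]) (auto simp: umat_def)

lemma unitary_op_umat:
  assumes "bij f"
  shows "unitary_op (umat f)"
  unfolding unitary_op_def
proof (intro conjI)
  show "bdd_op (umat f)" using bdd_opI[OF norm_le_umat[OF bij_is_inj[OF assms]]] .
  show "mat_mult (umat f) (mat_adj (umat f)) = mat_id"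
    using assms by (intro ext, subst mat_mult_umat_adj) (auto simp: umat_def mat_id_def bij_is_surj surj_f_inv_f)
  have "mat_mult (mat_adj (umat f)) (umat f) x y = mat_id x y" for x y
    unfolding mat_mult_def using bij_is_inj[OF assms]
    by (subst infsum_single[of "f y"]) (auto simp: umat_def mat_adj_def mat_id_def inj_eq)
  then show "mat_mult (mat_adj (umat f)) (umat f) = mat_id" by (intro ext)
qed

lemma mat_adj_umat:
  assumes "bij f"
  shows "mat_adj (umat f) = umat (inv_into UNIV f)"
  using assms by (intro ext) (auto simp: mat_adj_def umat_def bij_is_inj bij_is_surj surj_f_inv_f)

lemma conj_by_umat:
  assumes "bij f"
  shows "conj_by (umat f) a x y = a (inv_into UNIV f x) (inv_into UNIV f y)"
proof -
  have "mat_mult (umat f) a x z = a (inv_into UNIV f x) z" for z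
    unfolding mat_mult_def using assms
    by (subst infsum_single[of "inv_into UNIV f x"]) (auto simp: umat_def bij_is_inj bij_is_surj surj_f_inv_f)
  then show ?thesis by (simp add: conj_by_def mat_mult_umat_adj[OF assms])
qed

text \<open>Conjugation relabels both indices along \<open>f\<close>, so a matrix of propagation
  \<open>R\<close> acquires the propagation that \<open>f\<close> being bornologous assigns to
  \<open>R\<close>, while norms do not grow.\<close>

lemma conj_by_umat_Cu:
  fixes f :: "'a::metric_space \<Rightarrow> 'a"
  assumes f: "bij f" "bornologous f" and a: "a \<in> Cu"
  shows "conj_by (umat f) a \<in> Cu"
  unfolding Cu_iff
proof (intro conjI allI impI)
  have nu: "norm_le 1 (umat f)" by (rule norm_le_umat[OF bij_is_inj[OF f(1)]])
  show "bdd_op (conj_by (umat f) a)" by (intro bdd_op_conj_by bdd_opI[OF nu] Cu_bdd_op a)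
  fix \<epsilon> :: real assume "0 < \<epsilon>"
  then obtain R b where b: "prop_le R b" "norm_le \<epsilon> (mat_diff a b)"
    using a unfolding Cu_iff approx_le_def by blast
  obtain S where S: "\<And>x y. dist x y \<le> R \<Longrightarrow> dist (f x) (f y) \<le> S"
    using f(2) unfolding bornologous_def by blast
  have "prop_le S (conj_by (umat f) b)"
    unfolding prop_le_def
  proof (intro allI impI)
    fix x y :: 'a assume "S < dist x y"
    then have "\<not> dist (inv_into UNIV f x) (inv_into UNIV f y) \<le> R"
      using S[of "inv_into UNIV f x" "inv_into UNIV f y"] f(1) by (auto simp: bij_is_surj surj_f_inv_f)
    then show "conj_by (umat f) b x y = 0" using b(1) by (simp add: conj_by_umat[OF f(1)] prop_le_def)
  qed
  moreover have "norm_le (1 * \<epsilon> * 1) (conj_by (umat f) (mat_diff a b))"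
    unfolding conj_by_def by (intro norm_le_mult nu b) (simp add: nu)
  moreover have "conj_by (umat f) (mat_diff a b) = mat_diff (conj_by (umat f) a) (conj_by (umat f) b)"
    by (intro ext) (simp add: conj_by_umat[OF f(1)] mat_diff_def)
  ultimately show "\<exists>R. approx_le \<epsilon> R (conj_by (umat f) a)" unfolding approx_le_def by auto
qed

lemma normalizes_Cu_umat:
  assumes f: "bij f" "coarse_equiv f"
  shows "normalizes_Cu (umat f)"
  unfolding normalizes_Cu_def mat_adj_umat[OF f(1)]
  using f bij_coarse_equiv_iff[OF f(1)] bij_imp_bij_inv[OF f(1)]
  by (auto intro: unitary_op_umat conj_by_umat_Cu)

lemma Ad_umat_inner_iff:
  assumes f: "bij f" "coarse_equiv f"
  shows "Ad (umat f) \<in> Inn \<longleftrightarrow> close f id"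
proof
  assume "Ad (umat f) \<in> Inn"
  then obtain v where v: "unitary_Cu v" "Ad (umat f) = Ad v" by (auto simp: Inn_def)
  obtain R where R: "approx_le (1/2) R v"
    using unitary_CuD(1)[OF v(1)] by (meson Cu_iff half_gt_zero zero_less_one)
  have "dist (f x) x \<le> R" for x
  proof (rule approx_le_entry[OF R])
    \<comment> \<open>Both automorphisms are evaluated on the matrix unit at \<open>(x, x)\<close>.
      For \<open>u\<^sub>f\<close> the diagonal entry at \<open>f x\<close> is 1; for
      \<open>v\<close> it is the squared modulus of \<open>v (f x) x\<close>.\<close>
    have "conj_by v (mat_unit x x) (f x) (f x) = conj_by (umat f) (mat_unit x x) (f x) (f x)"
      using fun_cong[OF v(2), of "mat_unit x x"] by (simp add: Ad_eq Cu_mat_unit)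
    then have "v (f x) x * cnj (v (f x) x) = 1"
      unfolding conj_by_mat_unit by (simp add: umat_def)
    then have "(cmod (v (f x) x))\<^sup>2 = 1"
      unfolding complex_norm_square[symmetric] of_real_eq_1_iff .
    then have "cmod (v (f x) x) = 1" by (metis norm_ge_zero power2_eq_1_iff real_sqrt_abs real_sqrt_unique abs_of_nonneg real_sqrt_one)
    then show "1/2 < cmod (v (f x) x)" by simp
  qed
  then show "close f id" by (intro closeI[of f id R]) simp
next
  assume "close f id"
  then obtain C where C: "\<And>x. dist (f x) x \<le> C" unfolding close_def by auto
  have "prop_le C (umat f)" unfolding prop_le_def umat_def using C by (auto simp: not_less[symmetric])
  then have "umat f \<in> Cu" using Cu_if_prop_le unitary_op_bdd[OF unitary_op_umat[OF f(1)]] by blast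
  then have "unitary_Cu (umat f)" by (intro unitary_CuI unitary_op_umat f)
  then show "Ad (umat f) \<in> Inn" by (auto simp: Inn_def)
qed

theorem theorem4p6:
  assumes "ulf TYPE('a::metric_space)"
  shows "\<exists>\<Phi>. \<Phi> \<in> iso (BijCoaG :: ('a \<Rightarrow> 'a) set monoid) OutG \<and>
     (\<forall>f \<in> carrier (BijCoaG0 :: ('a \<Rightarrow> 'a) monoid).
        \<Phi> (CloseId #>\<^bsub>BijCoaG0\<^esub> f) = Inn #>\<^bsub>AutG\<^esub> Ad (umat f))"
proof -
  let ?B = "BijCoaG0 :: ('a \<Rightarrow> 'a) monoid" and ?A = "AutG :: ('a mat \<Rightarrow> 'a mat) monoid"
  interpret B: group ?B by (rule group_BijCoaG0)
  interpret N: normal Inn ?A by (rule Inn_normal)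
  have aut: "Ad (umat f) \<in> carrier ?A" if "f \<in> carrier ?B" for f
    using that star_aut_Ad[OF normalizes_Cu_umat[of f]] by simp
  have hom1: "(\<lambda>f. Ad (umat f)) \<in> hom ?B ?A"
    using aut by (auto intro!: homI simp: umat_comp compose_Ad normalizes_Cu_umat)
  define h where "h f = Inn #>\<^bsub>?A\<^esub> Ad (umat f)" for f :: "'a \<Rightarrow> 'a"
  have "(\<lambda>a. Inn #>\<^bsub>?A\<^esub> a) \<circ> (\<lambda>f. Ad (umat f)) \<in> hom ?B (?A Mod Inn)"
    by (rule hom_compose[OF hom1 N.r_coset_hom_Mod])
  then have hom: "h \<in> hom ?B OutG" by (simp add: h_def[abs_def] comp_def OutG_def)
  have grp: "group (OutG :: ('a mat \<Rightarrow> 'a mat) set monoid)"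
    unfolding OutG_def by (rule N.factorgroup_is_group)
  interpret H: group_hom ?B OutG h
    using hom by (intro group_hom.intro group_hom_axioms.intro grp group_BijCoaG0)
  have ker: "kernel ?B OutG h = CloseId"
  proof -
    have "h f = Inn \<longleftrightarrow> close f id" if f: "bij f" "coarse_equiv f" for f
    proof -
      have "Ad (umat f) \<in> carrier ?A" using aut f by simp
      then have "h f = Inn \<longleftrightarrow> Ad (umat f) \<in> Inn"
        unfolding h_def using N.rcos_const[OF group_AutG] N.coset_join1[OF _ _ N.subgroup_axioms] by blast
      then show ?thesis using Ad_umat_inner_iff[OF f] by simp
    qed
    then show ?thesis unfolding kernel_def CloseId_def by (auto simp: OutG_def FactGroup_def)
  qed
  have surj: "h ` carrier ?B = carrier OutG"
  proof (intro equalityI subsetI)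
    show "X \<in> carrier OutG" if "X \<in> h ` carrier ?B" for X using that H.hom_closed by blast
    fix X :: "('a mat \<Rightarrow> 'a mat) set" assume "X \<in> carrier OutG"
    then obtain \<phi> where \<phi>: "star_aut \<phi>" "X = Inn #>\<^bsub>?A\<^esub> \<phi>"
      by (auto simp: OutG_def FactGroup_def RCOSETS_def)
    obtain U where U: "normalizes_Cu U" "\<phi> = Ad U" using star_aut_spatial[OF \<phi>(1)] .
    obtain f where f: "bij f" "coarse_equiv f" "mat_mult U (mat_adj (umat f)) \<in> Cu"
      using normalizer_decomposition[OF assms U(1)] .
    \<comment> \<open>\<open>U\<close> factors as \<open>?v u\<^sub>f\<close> with \<open>?v\<close>
      a unitary of the algebra, so \<open>\<phi>\<close> agrees with \<open>Ad (umat f)\<close>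
      modulo inner automorphisms.\<close>
    let ?v = "mat_mult U (mat_adj (umat f))"
    have uf: "unitary_op (umat f)" and uU: "unitary_op U"
      using unitary_op_umat[OF f(1)] U(1) by (auto simp: normalizes_Cu_def)
    have v: "unitary_Cu ?v" by (intro unitary_CuI unitary_op_mult uU unitary_op_adj uf f)
    have vm: "Ad ?v \<in> Inn" using v by (auto simp: Inn_def)
    have "mat_mult ?v (umat f) = U"
      using uf unitary_op_bdd[OF uU] unitary_op_bdd[OF uf] by (simp add: mat_mult_assoc unitary_op_def)
    then have "\<phi> = Ad ?v \<otimes>\<^bsub>?A\<^esub> Ad (umat f)"
      using compose_Ad[OF unitary_CuD(2)[OF v] normalizes_Cu_umat[OF f(1,2)]] U(2) by simp
    then have "X = (Inn #>\<^bsub>?A\<^esub> Ad ?v) #>\<^bsub>?A\<^esub> Ad (umat f)"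
      using \<phi>(2) N.coset_mult_assoc[OF N.subset N.mem_carrier[OF vm] aut] f by simp
    also have "Inn #>\<^bsub>?A\<^esub> Ad ?v = Inn" by (rule N.rcos_const[OF group_AutG vm])
    finally show "X \<in> h ` carrier ?B" using f by (auto simp: h_def)
  qed
  \<comment> \<open>The map on cosets given by the first isomorphism theorem:
    \<open>the_elem\<close> extracts the single value that \<open>h\<close> takes on a coset of its
    kernel.\<close>
  let ?\<Phi> = "\<lambda>X. the_elem (h ` X)"
  have "?\<Phi> \<in> iso BijCoaG OutG"
    using H.FactGroup_iso_set[OF surj] by (simp add: ker BijCoaG_def)
  moreover have "?\<Phi> (CloseId #>\<^bsub>?B\<^esub> f) = Inn #>\<^bsub>?A\<^esub> Ad (umat f)" if f: "f \<in> carrier ?B" for f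
  proof -
    have "h ` (CloseId #>\<^bsub>?B\<^esub> f) = {h f}"
    proof (intro equalityI subsetI)
      fix X assume "X \<in> h ` (CloseId #>\<^bsub>?B\<^esub> f)"
      then obtain k where k: "k \<in> kernel ?B OutG h" "X = h (k \<otimes>\<^bsub>?B\<^esub> f)"
        unfolding ker by (auto simp: r_coset_def)
      then show "X \<in> {h f}" using f H.hom_mult[of k f] H.hom_closed[OF f] grp
        by (simp add: kernel_def group.is_monoid monoid.l_one)
    next
      fix X assume "X \<in> {h f}"
      moreover have "(id :: 'a \<Rightarrow> 'a) \<in> CloseId" using B.one_closed by (auto simp: CloseId_def close_def)
      ultimately show "X \<in> h ` (CloseId #>\<^bsub>?B\<^esub> f)" by (force simp: r_coset_def)
    qed
    then show ?thesis by (simp add: h_def)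
  qed
  ultimately show ?thesis by blast
qed

end
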